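(* Let $n\ge1$, let $\mathbf{m}\in\mathbb{H}_n$ be a Hessenberg function (natural unit interval order on $[n]$), and let $0\le k<n$. Then the symmetric function $g_{\mathbf{m},k}(x;1)$ (the specialization of $g_{\mathbf{m},k}(x;q)$ at $q=1$) is $e$-positive, i.e. all coefficients in its expansion in the basis of elementary symmetric functions $e_\lambda(x)$ are nonnegative.
   Context: $[n]=\{1,\dots,n\}$, $[k]_q=1+q+\cdots+q^{k-1}$. $e_\lambda,h_\lambda$ are the elementary and complete homogeneous symmetric functions; $\omega$ is the involution of the algebra of symmetric functions with $\omega(h_\lambda)=e_\lambda$. A Hessenberg function of length $n$ is a weakly increasing map $\mathbf{m}:[n]\to[n]$ with $i\le\mathbf{m}(i)$ for all $i$; $\mathbb{H}_n$ is the set of these (they are identified with natural unit interval orders on $[n]$ via $i<_{\mathbf{m}}j$ iff $\mathbf{m}(i)<j$). Define $\rho_0(x;q)=1$ and, recursively for $n\ge1$, $[n]_qh_n(x)=\sum_{i=1}^nh_{n-i}(x)\rho_i(x;q)$; put $\rho_{(\mu_1,\dots,\mu_s)}=\rho_{\mu_1}\cdots\rho_{\mu_s}$. Let $\mathfrak{S}_{n,\mathbf{m}}$ be the set of permutations $\sigma$ of $[n]$ with $\sigma(i)\le\mathbf{m}(i)$ for all $i$. Write $\sigma=\tau_1\tau_2\cdots\tau_j$ for the cycle decomposition (fixed points included), each cycle written with its smallest element first, cycles ordered by increasing minimal elements (so $\tau_1$ contains $1$); $|\tau_i|$ is the length of $\tau_i$; $\sigma^c$ is the word obtained by erasing parentheses;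 $\mathrm{wt}_{\mathbf{m}}(\sigma)=|\{(i,j): i<j\le\mathbf{m}(i),\ j\text{ precedes }i\text{ in }\sigma^c\}|$. For $0\le k<n$, \[ g_{\mathbf{m},k}(x;q)=\sum_{\substack{\sigma=\tau_1\cdots\tau_j\in\mathfrak{S}_{n,\mathbf{m}}\\|\tau_1|\ge n-k}}(-1)^{|\tau_1|-n+k}q^{\mathrm{wt}_{\mathbf{m}}(\sigma)}h_{|\tau_1|-n+k}(x)\,\omega\big(\rho_{(|\tau_2|,\dots,|\tau_j|)}(x;q)\big). \] *)

theory Defs
  imports
    "HOL-Library.Multiset"
    "HOL-Computational_Algebra.Polynomial"
    "HOL-Combinatorics.Combinatorics"
begin

section \<open>The algebra of symmetric functions\<close>

text \<open>
  A monomial in the variables \<open>x\<^sub>0, x\<^sub>1, x\<^sub>2, \<dots>\<close> is encoded as the finite multiset of the indices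
  of its factors, so that its degree is \<^const>\<open>size\<close>, multiplication is \<^const>\<open>plus\<close> and
  divisibility is \<^const>\<open>subseteq_mset\<close>.  A power series is its coefficient function.  A
  symmetric function is a power series of bounded degree invariant under permuting the variables.
\<close>

type_synonym monomial = "nat multiset"

lemma finite_mset_divisors: "finite {a. a \<subseteq># (m :: 'b multiset)}"
proof -
  have "{a. a \<subseteq># m} \<subseteq> {a. set_mset a \<subseteq> set_mset m \<and> size a \<le> size m}"
    by (auto simp: size_mset_mono dest: set_mset_mono)
  also have "\<dots> \<subseteq> mset ` {xs. set xs \<subseteq> set_mset m \<and> length xs \<le> size m}"
  proof
    fix a assume "a \<in> {a. set_mset a \<subseteq> set_mset m \<and> size a \<le> size m}"
    moreover obtain xs where "a = mset xs" by (metis ex_mset)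
    ultimately show "a \<in> mset ` {xs. set xs \<subseteq> set_mset m \<and> length xs \<le> size m}" by auto
  qed
  finally show ?thesis
    by (rule finite_subset) (intro finite_imageI finite_lists_length_le finite_set_mset)
qed

typedef (overloaded) ('a :: zero) symfun =
  "{f :: monomial \<Rightarrow> 'a. (\<forall>\<pi> m. bij \<pi> \<longrightarrow> f (image_mset \<pi> m) = f m) \<and> (\<exists>d. \<forall>m. d < size m \<longrightarrow> f m = 0)}"
  morphisms sf_coeff Abs_symfun
  by (rule exI[of _ "\<lambda>_. 0"]) simp

setup_lifting type_definition_symfun

lemma symfun_eqI: "(\<And>m. sf_coeff f m = sf_coeff g m) \<Longrightarrow> f = g"
  by transfer auto

instantiation symfun :: (comm_ring_1) comm_ring_1
begin

lift_definition zero_symfun :: "'a symfun" is "\<lambda>_. 0" by simp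

lift_definition one_symfun :: "'a symfun" is "\<lambda>m. if m = {#} then 1 else 0"
  by (auto intro: exI[of _ 0])

lift_definition plus_symfun :: "'a symfun \<Rightarrow> 'a symfun \<Rightarrow> 'a symfun" is "\<lambda>f g m. f m + g m"
proof (safe, goal_cases)
  case (2 f g d d')
  then show ?case by (intro exI[of _ "max d d'"]) auto
qed auto

lift_definition minus_symfun :: "'a symfun \<Rightarrow> 'a symfun \<Rightarrow> 'a symfun" is "\<lambda>f g m. f m - g m"
proof (safe, goal_cases)
  case (2 f g d d')
  then show ?case by (intro exI[of _ "max d d'"]) auto
qed auto

lift_definition uminus_symfun :: "'a symfun \<Rightarrow> 'a symfun" is "\<lambda>f m. - f m"
  by auto

lift_definition times_symfun :: "'a symfun \<Rightarrow> 'a symfun \<Rightarrow> 'a symfun"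
  is "\<lambda>f g m. \<Sum>a | a \<subseteq># m. f a * g (m - a)"
proof (safe, goal_cases)
  case (1 f g d d' \<pi> m)
  have inv: "image_mset (inv \<pi>) (image_mset \<pi> b) = b" "image_mset \<pi> (image_mset (inv \<pi>) b) = b" for b
    using \<open>bij \<pi>\<close> by (simp_all add: multiset.map_comp bij_is_inj bij_is_surj flip: comp_def)
      (metis bij_is_surj multiset.map_id surj_iff)
  show ?case
  proof (rule sum.reindex_bij_witness[of _ "image_mset \<pi>" "image_mset (inv \<pi>)"])
    fix a assume "a \<in> {a. a \<subseteq># image_mset \<pi> m}"
    then have sub: "image_mset (inv \<pi>) a \<subseteq># m"
      using image_mset_subseteq_mono[of a "image_mset \<pi> m" "inv \<pi>"] by (simp only: inv mem_Collect_eq)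
    then show "image_mset (inv \<pi>) a \<in> {a. a \<subseteq># m}" by simp
    have "image_mset \<pi> (m - image_mset (inv \<pi>) a) = image_mset \<pi> m - a"
      using image_mset_Diff[OF sub, of \<pi>] by (simp only: inv)
    moreover have "f (image_mset (inv \<pi>) a) = f a"
      using 1(1) \<open>bij \<pi>\<close> bij_imp_bij_inv by blast
    ultimately show "f (image_mset (inv \<pi>) a) * g (m - image_mset (inv \<pi>) a) = f a * g (image_mset \<pi> m - a)"
      using 1(2,3) \<open>bij \<pi>\<close> by metis
  qed (auto simp only: inv mem_Collect_eq image_mset_subseteq_mono)
next
  case (2 f g d d')
  show ?case
  proof (intro exI[of _ "d + d'"] allI impI sum.neutral ballI)
    fix m a assume "d + d' < size m" "a \<in> {a :: monomial. a \<subseteq># m}"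
    then have "d < size a \<or> d' < size (m - a)" by (auto simp: size_Diff_submset)
    then show "f a * g (m - a) = 0" using 2 by auto
  qed
qed

instance
proof
  fix f g h :: "'a symfun"
  show "f + g + h = f + (g + h)" "f + g = g + f" "0 + f = f" "- f + f = 0" "f - g = f + - g"
    by (transfer; simp add: algebra_simps)+
  show "(0 :: 'a symfun) \<noteq> 1"
    by transfer (auto simp: fun_eq_iff)
  show "(f + g) * h = f * h + g * h"
    by transfer (simp add: algebra_simps sum.distrib)
  show "1 * f = f"
  proof (transfer, rule ext)
    fix f :: "monomial \<Rightarrow> 'a" and m :: monomial
    have "(\<Sum>a | a \<subseteq># m. (if a = {#} then 1 else 0) * f (m - a)) = (\<Sum>a | a \<subseteq># m. if a = {#} then f m else 0)"
      by (intro sum.cong) auto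
    also have "\<dots> = f m" by (simp add: sum.delta finite_mset_divisors)
    finally show "(\<Sum>a | a \<subseteq># m. (if a = {#} then 1 else 0) * f (m - a)) = f m" .
  qed
  show "f * g = g * f"
  proof (transfer, rule ext)
    fix f g :: "monomial \<Rightarrow> 'a" and m :: monomial
    show "(\<Sum>a | a \<subseteq># m. f a * g (m - a)) = (\<Sum>a | a \<subseteq># m. g a * f (m - a))"
      by (rule sum.reindex_bij_witness[of _ "\<lambda>a. m - a" "\<lambda>a. m - a"])
        (auto simp: mult.commute subset_mset.diff_diff_right)
  qed
  show "f * g * h = f * (g * h)"
  proof (transfer, rule ext)
    fix f g h :: "monomial \<Rightarrow> 'a" and m :: monomial
    have diff_mono: "a - b \<subseteq># c - b" if "a \<subseteq># c" for a b c :: monomial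
      using that by (simp add: subseteq_mset_def diff_le_mono)
    have "(\<Sum>a | a \<subseteq># m. (\<Sum>b | b \<subseteq># a. f b * g (a - b)) * h (m - a)) =
      (\<Sum>(a, b) \<in> Sigma {a. a \<subseteq># m} (\<lambda>a. {b. b \<subseteq># a}). f b * g (a - b) * h (m - a))"
      by (simp add: sum_distrib_right sum.Sigma finite_mset_divisors)
    also have "\<dots> = (\<Sum>(b, c) \<in> Sigma {b. b \<subseteq># m} (\<lambda>b. {c. c \<subseteq># m - b}). f b * (g c * h (m - b - c)))"
      by (rule sum.reindex_bij_witness[of _ "\<lambda>(b, c). (b + c, b)" "\<lambda>(a, b). (b, a - b)"])
        (auto simp: mult.assoc subset_mset.le_diff_conv2 add.commute
          intro: subset_mset.order_trans diff_mono)
    also have "\<dots> = (\<Sum>a | a \<subseteq># m. f a * (\<Sum>b | b \<subseteq># m - a. g b * h (m - a - b)))"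
      by (simp add: sum_distrib_left sum.Sigma finite_mset_divisors)
    finally show "(\<Sum>a | a \<subseteq># m. (\<Sum>b | b \<subseteq># a. f b * g (a - b)) * h (m - a)) =
      (\<Sum>a | a \<subseteq># m. f a * (\<Sum>b | b \<subseteq># m - a. g b * h (m - a - b)))" .
  qed
qed

end


lift_definition sf_scale :: "'a :: comm_ring_1 \<Rightarrow> 'a symfun \<Rightarrow> 'a symfun" is "\<lambda>c f m. c * f m"
  by (auto, metis mult_zero_right)

interpretation symfun: module sf_scale
  by standard (transfer; simp add: algebra_simps)+

lemma sf_scale_mult_left: "sf_scale c f * g = sf_scale c (f * g)"
  by transfer (simp add: sum_distrib_left mult.assoc)

lemma sf_scale_mult_right: "f * sf_scale c g = sf_scale c (f * g)"
  by transfer (simp add: sum_distrib_left algebra_simps)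

lift_definition sf_h :: "nat \<Rightarrow> 'a :: comm_ring_1 symfun" is "\<lambda>n m. if size m = n then 1 else 0"
  by auto

lift_definition sf_e :: "nat \<Rightarrow> 'a :: comm_ring_1 symfun"
  is "\<lambda>n m. if size m = n \<and> (\<forall>i. count m i \<le> 1) then 1 else 0"
proof (safe, goal_cases)
  case (1 n \<pi> m)
  have "count (image_mset \<pi> m) (\<pi> i) = count m i" for i
  proof -
    have "\<pi> -` {\<pi> i} = {i}" using \<open>bij \<pi>\<close> by (auto simp: bij_def inj_def)
    then show ?thesis by (auto simp: count_image_mset not_in_iff Int_insert_left)
  qed
  moreover have "(\<forall>i. count (image_mset \<pi> m) i \<le> 1) \<longleftrightarrow> (\<forall>i. count (image_mset \<pi> m) (\<pi> i) \<le> 1)"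
    using \<open>bij \<pi>\<close> by (metis bij_pointE)
  ultimately have "(\<forall>i. count (image_mset \<pi> m) i \<le> 1) \<longleftrightarrow> (\<forall>i. count m i \<le> 1)"
    by (simp only:)
  then show ?case by (simp only: size_image_mset)
qed auto

text \<open>Partitions are multisets of positive natural numbers.\<close>

abbreviation is_partition :: "nat multiset \<Rightarrow> bool" where
  "is_partition l \<equiv> 0 \<notin># l"

definition sf_h_part :: "nat multiset \<Rightarrow> 'a :: comm_ring_1 symfun" where
  "sf_h_part l = (\<Prod>i\<in>#l. sf_h i)"

definition sf_e_part :: "nat multiset \<Rightarrow> 'a :: comm_ring_1 symfun" where
  "sf_e_part l = (\<Prod>i\<in>#l. sf_e i)"

definition is_expansion ::
    "(nat multiset \<Rightarrow> 'a :: comm_ring_1 symfun) \<Rightarrow> (nat multiset \<Rightarrow> 'a) \<Rightarrow> 'a symfun \<Rightarrow> bool" where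
  "is_expansion b c f \<longleftrightarrow> finite {l. c l \<noteq> 0} \<and> (\<forall>l. c l \<noteq> 0 \<longrightarrow> is_partition l) \<and>
    f = (\<Sum>l | c l \<noteq> 0. sf_scale (c l) (b l))"

definition e_positive :: "'a :: linordered_idom symfun \<Rightarrow> bool" where
  "e_positive f \<longleftrightarrow> (\<exists>c. is_expansion sf_e_part c f \<and> (\<forall>l. 0 \<le> c l))"

text \<open>\<open>\<omega>\<close> is the linear map with \<open>\<omega> (h\<^sub>\<lambda>) = e\<^sub>\<lambda>\<close> for every partition \<open>\<lambda>\<close>.  The description is
  unambiguous because the \<open>h\<^sub>\<lambda>\<close> are linearly independent; see \<open>sf_omega_eqI\<close> below.\<close>

definition sf_omega :: "'a :: comm_ring_1 symfun \<Rightarrow> 'a symfun" where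
  "sf_omega f = (THE g. \<exists>c. is_expansion sf_h_part c f \<and> is_expansion sf_e_part c g)"


section \<open>Uniqueness of expansions and well-definedness of the involution\<close>

lemma sf_coeff_zero [simp]: "sf_coeff 0 m = 0"
  and sf_coeff_scale [simp]: "sf_coeff (sf_scale c f) m = c * sf_coeff f m"
  and sf_coeff_one: "sf_coeff 1 m = (if m = {#} then 1 else 0)"
  and sf_coeff_mult: "sf_coeff (f * g) m = (\<Sum>a | a \<subseteq># m. sf_coeff f a * sf_coeff g (m - a))"
  by (transfer; simp)+

lemma sf_coeff_add: "sf_coeff (f + g) m = sf_coeff f m + sf_coeff g m"
  by transfer simp

lemma sf_coeff_sum: "sf_coeff (sum f A) m = (\<Sum>x\<in>A. sf_coeff (f x) m)"
  by (induction A rule: infinite_finite_induct) (simp_all add: sf_coeff_add)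

lemma sf_h_0 [simp]: "sf_h 0 = 1" and sf_e_0 [simp]: "sf_e 0 = 1"
  by (transfer; auto simp: fun_eq_iff)+

lemma sum_lessThan_card_le:
  fixes S :: "nat set"
  assumes "finite S"
  shows "\<Sum>{..<card S} \<le> \<Sum>S \<and> (\<Sum>S = \<Sum>{..<card S} \<longrightarrow> S = {..<card S})"
  using assms
proof (induction "card S" arbitrary: S)
  case 0
  then show ?case by simp
next
  case (Suc n)
  then have ne: "S \<noteq> {}" by auto
  define x where "x = Max S"
  define T where "T = S - {x}"
  have x: "x \<in> S" using Suc.prems ne by (simp add: x_def)
  have T: "finite T" "card T = n" "x \<notin> T" "S = insert x T"
    using Suc x by (auto simp: T_def)
  have IH: "\<Sum>{..<n} \<le> \<Sum>T" "\<Sum>T = \<Sum>{..<n} \<Longrightarrow> T = {..<n}"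
    using Suc.hyps(1)[of T] T by auto
  have "S \<subseteq> {..x}" using Suc.prems by (auto simp: x_def)
  then have "Suc n \<le> card {..x}" using Suc.hyps(2) card_mono[of "{..x}" S] by simp
  then have nx: "n \<le> x" by simp
  have S: "\<Sum>S = x + \<Sum>T" using T by simp
  have n: "\<Sum>{..<card S} = n + \<Sum>{..<n}" using Suc.hyps(2)[symmetric] by simp
  have "S = {..<card S}" if "\<Sum>S = \<Sum>{..<card S}"
  proof -
    have "x = n" "\<Sum>T = \<Sum>{..<n}" using that S n nx IH(1) by auto
    then have "S = insert n {..<n}" using T(4) IH(2) by simp
    then show ?thesis using Suc.hyps(2)[symmetric] by (auto simp: lessThan_Suc)
  qed
  then show ?case using S n nx IH(1) by auto
qed

definition lead :: "nat multiset \<Rightarrow> monomial" where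
  "lead l = (\<Sum>n\<in>#l. mset_set {..<n})"

lemma lead_simps [simp]: "lead {#} = {#}" "lead (add_mset n l) = mset_set {..<n} + lead l"
  by (simp_all add: lead_def)

lemma sf_coeff_e_nonzero:
  assumes "sf_coeff (sf_e n :: 'a :: comm_ring_1 symfun) a \<noteq> 0"
  shows "sum_mset (mset_set {..<n}) \<le> sum_mset a"
    and "sum_mset a = sum_mset (mset_set {..<n}) \<Longrightarrow> a = mset_set {..<n}"
proof -
  have a: "size a = n" "\<And>i. count a i \<le> 1"
    using assms by (transfer; auto split: if_splits)+
  have eq: "a = mset_set (set_mset a)"
  proof (rule multiset_eqI)
    fix i show "count a i = count (mset_set (set_mset a)) i"
      using a(2)[of i] by (cases "i \<in># a") (auto simp: count_eq_zero_iff le_Suc_eq)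
  qed
  have n: "card (set_mset a) = n"
    using a(1) eq by (metis size_mset_set)
  have s: "sum_mset a = \<Sum>(set_mset a)"
    by (subst eq) (simp add: sum_unfold_sum_mset)
  show "sum_mset (mset_set {..<n}) \<le> sum_mset a"
    using sum_lessThan_card_le[of "set_mset a"] n s by (simp add: sum_unfold_sum_mset)
  show "a = mset_set {..<n}" if "sum_mset a = sum_mset (mset_set {..<n})"
  proof -
    have "set_mset a = {..<n}"
      using sum_lessThan_card_le[of "set_mset a"] n s that by (simp add: sum_unfold_sum_mset)
    then show ?thesis using eq by simp
  qed
qed

lemma sf_coeff_e_lead: "sf_coeff (sf_e n :: 'a :: comm_ring_1 symfun) (mset_set {..<n}) = 1"
  by transfer (simp add: count_mset_set')

lemma sf_coeff_e_part:
  "(sf_coeff (sf_e_part l :: 'a :: comm_ring_1 symfun) a \<noteq> 0 \<longrightarrow>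
      sum_mset (lead l) \<le> sum_mset a \<and> (sum_mset a = sum_mset (lead l) \<longrightarrow> a = lead l)) \<and>
   sf_coeff (sf_e_part l :: 'a symfun) (lead l) = 1"
proof (induction l arbitrary: a)
  case empty
  then show ?case by (simp add: sf_e_part_def sf_coeff_one)
next
  case (add n l)
  let ?d = "mset_set {..<n}"
  have step: "sum_mset ?d + sum_mset (lead l) \<le> sum_mset a"
      "sum_mset a = sum_mset ?d + sum_mset (lead l) \<Longrightarrow> b = ?d \<and> a - b = lead l"
    if b: "b \<subseteq># a" and nz: "sf_coeff (sf_e n :: 'a symfun) b \<noteq> 0"
      "sf_coeff (sf_e_part l :: 'a symfun) (a - b) \<noteq> 0" for a b
  proof -
    have s: "sum_mset a = sum_mset b + sum_mset (a - b)"
      using b by (metis subset_mset.add_diff_inverse sum_mset.union)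
    note 1 = sf_coeff_e_nonzero[OF nz(1)]
    have 2: "sum_mset (lead l) \<le> sum_mset (a - b)"
      "sum_mset (a - b) = sum_mset (lead l) \<Longrightarrow> a - b = lead l"
      using add.IH nz(2) by blast+
    show "sum_mset ?d + sum_mset (lead l) \<le> sum_mset a" using s 1 2 by linarith
    show "b = ?d \<and> a - b = lead l" if "sum_mset a = sum_mset ?d + sum_mset (lead l)"
      using s 1 2 that by (metis add_le_cancel_right add_le_cancel_left le_antisym)
  qed
  have co: "sf_coeff (sf_e_part (add_mset n l) :: 'a symfun) a =
      (\<Sum>b | b \<subseteq># a. sf_coeff (sf_e n) b * sf_coeff (sf_e_part l) (a - b))" for a
    by (simp add: sf_e_part_def sf_coeff_mult)
  have "sf_coeff (sf_e_part (add_mset n l) :: 'a symfun) (lead (add_mset n l)) =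
      (\<Sum>b | b \<subseteq># ?d + lead l. if b = ?d then 1 else 0)"
    unfolding co lead_simps
  proof (rule sum.cong)
    fix b assume "b \<in> {b. b \<subseteq># ?d + lead l}"
    then show "sf_coeff (sf_e n) b * sf_coeff (sf_e_part l) (?d + lead l - b) = (if b = ?d then 1 else 0 :: 'a)"
      using step(2)[of b "?d + lead l"] add.IH
      by (cases "b = ?d"; cases "sf_coeff (sf_e n :: 'a symfun) b = 0";
          cases "sf_coeff (sf_e_part l :: 'a symfun) (?d + lead l - b) = 0") (simp_all add: sf_coeff_e_lead)
  qed simp
  also have "\<dots> = 1" by (simp add: finite_mset_divisors)
  finally have lead: "sf_coeff (sf_e_part (add_mset n l) :: 'a symfun) (lead (add_mset n l)) = 1" .
  show ?case
  proof (intro conjI impI lead)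
    assume "sf_coeff (sf_e_part (add_mset n l) :: 'a symfun) a \<noteq> 0"
    then obtain b where b: "b \<subseteq># a" "sf_coeff (sf_e n :: 'a symfun) b \<noteq> 0"
        "sf_coeff (sf_e_part l :: 'a symfun) (a - b) \<noteq> 0"
      unfolding co by (metis (mono_tags, lifting) mem_Collect_eq mult_zero_left mult_zero_right sum.not_neutral_contains_not_neutral)
    show "sum_mset (lead (add_mset n l)) \<le> sum_mset a" using step(1)[OF b] by simp
    show "a = lead (add_mset n l)" if "sum_mset a = sum_mset (lead (add_mset n l))"
      using step(2)[OF b] that b(1) by (metis lead_simps(2) subset_mset.add_diff_inverse sum_mset.union)
  qed
qed

lemma count_lead: "count (lead l) i = size {#n \<in># l. i < n#}"
  by (induction l) (auto simp: count_mset_set')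

lemma lead_inject:
  assumes "is_partition k" "is_partition l" "lead k = lead l"
  shows "k = l"
proof (rule multiset_eqI)
  have *: "size {#n \<in># l. i < n#} = size {#n \<in># l. Suc i < n#} + count l (Suc i)" for i and l :: "nat multiset"
    by (induction l) auto
  have "count k (Suc i) = count l (Suc i)" for i
    using *[of i k] *[of i l] count_lead[of k] count_lead[of l] assms(3) by simp
  then show "count k i = count l i" for i
    using assms(1,2) by (cases i) (simp_all add: not_in_iff)
qed

lemma e_part_independent:
  fixes c :: "nat multiset \<Rightarrow> 'a :: comm_ring_1"
  assumes "finite S" "\<And>l. l \<in> S \<Longrightarrow> is_partition l" "(\<Sum>l\<in>S. sf_scale (c l) (sf_e_part l)) = 0" "l \<in> S"
  shows "c l = 0"
proof (rule ccontr)
  assume "c l \<noteq> 0"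
  define T where "T = {l\<in>S. c l \<noteq> 0}"
  have T: "finite T" "T \<noteq> {}" using assms \<open>c l \<noteq> 0\<close> by (auto simp: T_def)
  obtain k where k: "k \<in> T" "\<And>l. l \<in> T \<Longrightarrow> sum_mset (lead k) \<le> sum_mset (lead l)"
    using T arg_min_nat_lemma[of "\<lambda>l. l \<in> T" _ "\<lambda>l. sum_mset (lead l)"] by blast
  have "0 = sf_coeff (\<Sum>l\<in>S. sf_scale (c l) (sf_e_part l)) (lead k)" using assms by simp
  also have "\<dots> = (\<Sum>l\<in>S. c l * sf_coeff (sf_e_part l) (lead k))" by (simp add: sf_coeff_sum)
  also have "\<dots> = (\<Sum>l\<in>S. if l = k then c k else 0)"
  proof (rule sum.cong)
    fix l assume l: "l \<in> S"
    show "c l * sf_coeff (sf_e_part l) (lead k) = (if l = k then c k else 0)"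
    proof (cases "l = k \<or> c l = 0 \<or> sf_coeff (sf_e_part l :: 'a symfun) (lead k) = 0")
      case True
      then show ?thesis using sf_coeff_e_part[of k "lead k", where 'a = 'a] by auto
    next
      case False
      then have "l \<in> T" using l by (auto simp: T_def)
      then have "lead k = lead l"
        using k(2) sf_coeff_e_part[of l "lead k", where 'a = 'a] False by (meson le_antisym)
      then have "l = k"
        using lead_inject assms(2) l k(1) by (metis (no_types, lifting) T_def mem_Collect_eq)
      then show ?thesis using False by blast
    qed
  qed simp
  also have "\<dots> = c k" using k(1) assms(1) by (simp add: T_def)
  finally show False using k(1) by (simp add: T_def)
qed

lemma sf_e_h_alternating:
  assumes "0 < n"
  shows "(\<Sum>i\<le>n. sf_scale ((-1) ^ i) (sf_e i * sf_h (n - i))) = (0 :: 'a :: comm_ring_1 symfun)"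
proof (rule symfun_eqI)
  fix m :: monomial
  have [simp]: "sf_coeff (sf_h n :: 'a symfun) m = (if size m = n then 1 else 0)" for n m
    by transfer simp
  have [simp]: "sf_coeff (sf_e n :: 'a symfun) m = (if size m = n \<and> (\<forall>i. count m i \<le> 1) then 1 else 0)" for n m
    by transfer simp
  let ?Q = "{a. a \<subseteq># m \<and> (\<forall>i. count a i \<le> 1)}"
  have fin: "finite ?Q" by (rule finite_subset[OF _ finite_mset_divisors[of m]]) auto
  have "sf_coeff (\<Sum>i\<le>n. sf_scale ((-1) ^ i) (sf_e i * sf_h (n - i))) m =
      (\<Sum>i\<le>n. \<Sum>a | a \<subseteq># m. if size m = n \<and> i = size a \<and> (\<forall>j. count a j \<le> 1) then (-1) ^ size a else (0 :: 'a))"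
    unfolding sf_coeff_sum sf_coeff_scale sf_coeff_mult sum_distrib_left
    by (intro sum.cong refl) (auto simp: size_Diff_submset dest: size_mset_mono)
  also have "\<dots> = (\<Sum>a | a \<subseteq># m. \<Sum>i\<le>n. if i = size a then if size m = n \<and> (\<forall>j. count a j \<le> 1) then (-1) ^ size a else (0 :: 'a) else 0)"
    by (subst sum.swap) (intro sum.cong refl, auto)
  also have "\<dots> = (\<Sum>a | a \<subseteq># m. if size m = n \<and> (\<forall>j. count a j \<le> 1) then (-1) ^ size a else (0 :: 'a))"
    by (intro sum.cong refl) (auto dest: size_mset_mono)
  also have "\<dots> = (if size m = n then \<Sum>a\<in>?Q. (-1) ^ size a else 0)"
    by (auto simp: sum.If_cases finite_mset_divisors Int_def intro!: sum.cong)
  also have "\<dots> = 0"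
  proof (cases "size m = n")
    case True
    with assms obtain x where x: "x \<in># m" by fastforce
    have "(\<Sum>a\<in>?Q. (-1) ^ size a :: 'a) =
        (\<Sum>a\<in>{a\<in>?Q. x \<in># a}. (-1) ^ size a) + (\<Sum>a\<in>{a\<in>?Q. x \<notin># a}. (-1) ^ size a)"
      by (subst sum.union_disjoint[symmetric])
        (auto intro!: sum.cong finite_subset[OF _ fin])
    also have "(\<Sum>a\<in>{a\<in>?Q. x \<in># a}. (-1) ^ size a :: 'a) = (\<Sum>a\<in>{a\<in>?Q. x \<notin># a}. - ((-1) ^ size a))"
    proof (rule sum.reindex_bij_witness[of _ "add_mset x" "\<lambda>a. a - {#x#}"])
      fix a assume "a \<in> {a\<in>?Q. x \<in># a}"
      then have a: "a \<subseteq># m" "\<forall>i. count a i \<le> 1" "x \<in># a" by auto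
      then show "add_mset x (a - {#x#}) = a" by simp
      have "count a x = 1" using a(2,3) by (metis count_greater_eq_one_iff le_antisym)
      then have "x \<notin># a - {#x#}" by (simp add: not_in_iff)
      moreover have "count (a - {#x#}) i \<le> 1" for i using a(2)[rule_format, of i] by simp
      ultimately show "a - {#x#} \<in> {a\<in>?Q. x \<notin># a}"
        using a(1) by (auto intro: subset_mset.order_trans[OF diff_subset_eq_self])
      show "- ((-1) ^ size (a - {#x#})) = ((-1) ^ size a :: 'a)"
        using a(3) by (metis insert_DiffM size_add_mset power_Suc mult_minus1)
    next
      fix a assume "a \<in> {a\<in>?Q. x \<notin># a}"
      then have a: "a \<subseteq># m" "\<forall>i. count a i \<le> 1" "x \<notin># a" by auto
      then show "add_mset x a - {#x#} = a" by simp
      have "add_mset x a \<subseteq># m"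
        unfolding subseteq_mset_def
      proof
        fix i show "count (add_mset x a) i \<le> count m i"
          using a(1,3) x mset_subset_eq_count[OF a(1), of i] by (auto simp: not_in_iff Suc_le_eq)
      qed
      then show "add_mset x a \<in> {a\<in>?Q. x \<in># a}"
        using a by (auto simp: not_in_iff)
    qed
    finally show ?thesis using True by (simp add: sum_negf)
  qed simp
  finally show "sf_coeff (\<Sum>i\<le>n. sf_scale ((-1) ^ i) (sf_e i * sf_h (n - i))) m = sf_coeff (0 :: 'a symfun) m"
    by simp
qed

definition e_span :: "nat \<Rightarrow> 'a :: comm_ring_1 symfun set" where
  "e_span k = symfun.span (sf_e_part ` {l. is_partition l \<and> k \<le> size l})"

lemma e_part_in_e_span: "is_partition l \<Longrightarrow> k \<le> size l \<Longrightarrow> sf_e_part l \<in> e_span k"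
  by (auto simp: e_span_def intro: symfun.span_base)

lemma e_span_mono: "j \<le> k \<Longrightarrow> e_span k \<subseteq> e_span j"
  unfolding e_span_def by (intro symfun.span_mono) auto

lemma e_span_intros:
  "0 \<in> e_span k"
  "f \<in> e_span k \<Longrightarrow> g \<in> e_span k \<Longrightarrow> f + g \<in> e_span k"
  "f \<in> e_span k \<Longrightarrow> sf_scale c f \<in> e_span k"
  "f \<in> e_span k \<Longrightarrow> - f \<in> e_span k"
  "(\<And>x. x \<in> A \<Longrightarrow> F x \<in> e_span k) \<Longrightarrow> sum F A \<in> e_span k"
  unfolding e_span_def
  by (rule symfun.span_zero, rule symfun.span_add, assumption+, rule symfun.span_scale, assumption,
      rule symfun.span_neg, assumption, rule symfun.span_sum)

lemma e_span_mult:
  assumes "f \<in> e_span j" "g \<in> e_span k"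
  shows "f * g \<in> e_span (j + k)"
proof -
  have *: "sf_e_part l * g \<in> e_span (j + k)" if l: "is_partition l" "j \<le> size l" for l
    using assms(2) unfolding e_span_def[of k]
  proof (induction rule: symfun.span_induct_alt)
    case base
    then show ?case by (simp add: e_span_intros)
  next
    case (step c x y)
    then obtain l' where l': "x = sf_e_part l'" "is_partition l'" "k \<le> size l'" by auto
    have "sf_e_part l * x = sf_e_part (l + l')" by (simp add: l'(1) sf_e_part_def)
    moreover have "sf_e_part (l + l') \<in> e_span (j + k)"
      using l l' by (intro e_part_in_e_span) auto
    ultimately have "sf_scale c (sf_e_part l * x) + sf_e_part l * y \<in> e_span (j + k)"
      using step by (intro e_span_intros) simp_all
    then show ?case by (simp add: distrib_left sf_scale_mult_right)
  qed
  show ?thesis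
    using assms(1) unfolding e_span_def[of j]
  proof (induction rule: symfun.span_induct_alt)
    case base
    then show ?case by (simp add: e_span_intros)
  next
    case (step c x y)
    then show ?case using * by (auto simp: distrib_right sf_scale_mult_left intro!: e_span_intros)
  qed
qed

lemma e_span_explicit:
  assumes "f \<in> e_span k"
  shows "\<exists>S c. finite S \<and> (\<forall>l\<in>S. is_partition l \<and> k \<le> size l) \<and> f = (\<Sum>l\<in>S. sf_scale (c l) (sf_e_part l))"
  using assms unfolding e_span_def
proof (induction rule: symfun.span_induct_alt)
  case base
  then show ?case by (intro exI[of _ "{}"]) auto
next
  case (step a x y)
  then obtain S c where S: "finite S" "\<forall>l\<in>S. is_partition l \<and> k \<le> size l"
    "y = (\<Sum>l\<in>S. sf_scale (c l) (sf_e_part l))" by blast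
  obtain l where l: "x = sf_e_part l" "is_partition l" "k \<le> size l" using step by auto
  have "sf_scale a x = (\<Sum>i\<in>insert l S. sf_scale (if i = l then a else 0) (sf_e_part i))"
  proof -
    have "sf_scale a x = (\<Sum>i\<in>{l}. sf_scale (if i = l then a else 0) (sf_e_part i))"
      by (simp add: l(1))
    also have "\<dots> = (\<Sum>i\<in>insert l S. sf_scale (if i = l then a else 0) (sf_e_part i))"
      using S(1) by (intro sum.mono_neutral_left) auto
    finally show ?thesis .
  qed
  moreover have "y = (\<Sum>i\<in>insert l S. sf_scale (if i \<in> S then c i else 0) (sf_e_part i))"
    unfolding S(3) using S(1) by (intro sum.mono_neutral_cong_left) auto
  ultimately have "sf_scale a x + y =
      (\<Sum>i\<in>insert l S. sf_scale ((if i = l then a else 0) + (if i \<in> S then c i else 0)) (sf_e_part i))"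
    by (simp add: symfun.scale_left_distrib sum.distrib)
  moreover have "finite (insert l S)" "\<forall>i\<in>insert l S. is_partition i \<and> k \<le> size i"
    using S l by auto
  ultimately show ?case
    by (intro exI[of _ "insert l S"]
        exI[of _ "\<lambda>i. (if i = l then a else 0) + (if i \<in> S then c i else 0)"] conjI)
qed

lemma sf_h_triangular:
  "0 < n \<Longrightarrow> (sf_h n :: 'a :: comm_ring_1 symfun) - sf_scale ((-1) ^ Suc n) (sf_e n) \<in> e_span 2"
proof (induction n rule: less_induct)
  case (less n)
  have e1: "(sf_e i :: 'a symfun) \<in> e_span 1" if "0 < i" for i
    using e_part_in_e_span[of "{#i#}" 1] that by (simp add: sf_e_part_def)
  have h1: "(sf_h i :: 'a symfun) \<in> e_span 1" if "0 < i" "i < n" for i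
  proof -
    have "sf_h i - sf_scale ((-1) ^ Suc i) (sf_e i) \<in> (e_span 1 :: 'a symfun set)"
      using less.IH[OF that(2,1)] e_span_mono[of 1 2] by auto
    from e_span_intros(2)[OF this e_span_intros(3)[OF e1[OF that(1)]], of "(-1) ^ Suc i"]
    show ?thesis by simp
  qed
  have n: "{..n} = insert 0 (insert n {0<..<n})" using less.prems by auto
  have "0 = (\<Sum>i\<le>n. sf_scale ((-1) ^ i) (sf_e i * sf_h (n - i)) :: 'a symfun)"
    using sf_e_h_alternating[OF less.prems] by metis
  also have "\<dots> = sf_h n + sf_scale ((-1) ^ n) (sf_e n) +
      (\<Sum>i\<in>{0<..<n}. sf_scale ((-1) ^ i) (sf_e i * sf_h (n - i)))"
    unfolding n using less.prems by simp
  finally have "sf_h n + sf_scale ((-1) ^ n) (sf_e n) =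
      - (\<Sum>i\<in>{0<..<n}. sf_scale ((-1) ^ i) (sf_e i * sf_h (n - i)) :: 'a symfun)"
    unfolding eq_neg_iff_add_eq_0 by (rule sym)
  then have "sf_h n - sf_scale ((-1) ^ Suc n) (sf_e n) =
      - (\<Sum>i\<in>{0<..<n}. sf_scale ((-1) ^ i) (sf_e i * sf_h (n - i)) :: 'a symfun)"
    by simp
  also have "\<dots> \<in> e_span 2"
  proof (intro e_span_intros(3,4,5))
    fix i assume "i \<in> {0<..<n}"
    then show "sf_e i * sf_h (n - i) \<in> (e_span 2 :: 'a symfun set)"
      using e_span_mult[OF e1 h1, of i "n - i"] by (simp add: numeral_2_eq_2)
  qed
  finally show ?case .
qed

lemma sf_h_part_triangular:
  "is_partition l \<Longrightarrow>
    (\<exists>s\<in>{1, -1}. (sf_h_part l :: 'a :: comm_ring_1 symfun) - sf_scale s (sf_e_part l) \<in> e_span (Suc (size l)))"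
proof (induction l)
  case empty
  then show ?case by (auto simp: sf_h_part_def sf_e_part_def e_span_intros)
next
  case (add n l)
  then have "is_partition l" by simp
  from add.IH[OF this] obtain s where s: "s \<in> {1, -1 :: 'a}"
    and v: "sf_h_part l - sf_scale s (sf_e_part l) \<in> e_span (Suc (size l))"
    by blast
  let ?t = "(-1) ^ Suc n :: 'a"
  let ?u = "sf_h n - sf_scale ?t (sf_e n)" and ?v = "sf_h_part l - sf_scale s (sf_e_part l)"
  have u: "?u \<in> e_span 2" using sf_h_triangular[of n] add.prems by auto
  have e: "sf_e n \<in> (e_span 1 :: 'a symfun set)" "sf_e_part l \<in> (e_span (size l) :: 'a symfun set)"
    using e_part_in_e_span[of "{#n#}" 1] e_part_in_e_span[of l "size l"] add.prems
    by (auto simp: sf_e_part_def)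
  have "?u * ?v \<in> e_span (Suc (size (add_mset n l)))"
    using e_span_mult[OF u v] e_span_mono[of "Suc (size (add_mset n l))" "2 + Suc (size l)"] by auto
  moreover have "sf_scale s (?u * sf_e_part l) \<in> e_span (Suc (size (add_mset n l)))"
    using e_span_intros(3)[OF e_span_mult[OF u e(2)]] by simp
  moreover have "sf_scale ?t (sf_e n * ?v) \<in> e_span (Suc (size (add_mset n l)))"
    using e_span_intros(3)[OF e_span_mult[OF e(1) v], of ?t] by (simp del: power_Suc)
  ultimately have "?u * ?v + sf_scale s (?u * sf_e_part l) + sf_scale ?t (sf_e n * ?v)
      \<in> e_span (Suc (size (add_mset n l)))"
    by (intro e_span_intros(2))
  also have "?u * ?v + sf_scale s (?u * sf_e_part l) + sf_scale ?t (sf_e n * ?v) =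
      sf_h_part (add_mset n l) - sf_scale (?t * s) (sf_e_part (add_mset n l))"
    by (simp add: sf_h_part_def sf_e_part_def left_diff_distrib right_diff_distrib sf_scale_mult_left
        sf_scale_mult_right symfun.scale_right_diff_distrib mult.commute[of s] del: power_Suc)
  finally have "sf_h_part (add_mset n l) - sf_scale (?t * s) (sf_e_part (add_mset n l)) \<in> e_span (Suc (size (add_mset n l)))" .
  moreover have "?t * s \<in> {1, -1}"
    using s by (cases "even n") auto
  ultimately show ?case by blast
qed

lemma h_part_independent:
  fixes c :: "nat multiset \<Rightarrow> 'a :: comm_ring_1"
  assumes S: "finite S" "\<And>l. l \<in> S \<Longrightarrow> is_partition l"
    and sum0: "(\<Sum>l\<in>S. sf_scale (c l) (sf_h_part l)) = 0" and l: "l \<in> S"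
  shows "c l = 0"
proof (rule ccontr)
  assume "c l \<noteq> 0"
  define T where "T = {l\<in>S. c l \<noteq> 0}"
  have T: "finite T" "\<And>l. l \<in> T \<Longrightarrow> is_partition l" "l \<in> T"
    using S l \<open>c l \<noteq> 0\<close> by (auto simp: T_def)
  obtain k where k: "k \<in> T" "\<And>l. l \<in> T \<Longrightarrow> size k \<le> size l"
    using T arg_min_nat_lemma[of "\<lambda>l. l \<in> T" _ size] by blast
  obtain s :: "nat multiset \<Rightarrow> 'a" where
    s: "\<And>l. is_partition l \<Longrightarrow> s l \<in> {1, -1} \<and> sf_h_part l - sf_scale (s l) (sf_e_part l) \<in> e_span (Suc (size l))"
    using sf_h_part_triangular[where 'a = 'a] by metis
  have sumT: "(\<Sum>l\<in>T. sf_scale (c l) (sf_h_part l)) = 0"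
    using sum0 S(1) by (subst sum.mono_neutral_left[of S T]) (auto simp: T_def)
  have "(\<Sum>l\<in>T. sf_scale (c l) (sf_h_part l - sf_scale (s l) (sf_e_part l))) \<in> e_span (Suc (size k))"
  proof (intro e_span_intros(3,5))
    fix l assume "l \<in> T"
    then show "sf_h_part l - sf_scale (s l) (sf_e_part l) \<in> e_span (Suc (size k))"
      using s[of l] T(2) k(2) e_span_mono[of "Suc (size k)" "Suc (size l)"] by auto
  qed
  also have "(\<Sum>l\<in>T. sf_scale (c l) (sf_h_part l - sf_scale (s l) (sf_e_part l))) =
      - (\<Sum>l\<in>T. sf_scale (c l * s l) (sf_e_part l))"
    using sumT by (simp add: symfun.scale_right_diff_distrib sum_subtractf)
  finally obtain U d where U: "finite U" "\<And>l. l \<in> U \<Longrightarrow> is_partition l \<and> Suc (size k) \<le> size l"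
    "- (\<Sum>l\<in>T. sf_scale (c l * s l) (sf_e_part l)) = (\<Sum>l\<in>U. sf_scale (d l) (sf_e_part l))"
    using e_span_explicit[of "- (\<Sum>l\<in>T. sf_scale (c l * s l) (sf_e_part l))" "Suc (size k)"] by blast
  define b where "b l = (if l \<in> T then c l * s l else 0) + (if l \<in> U then d l else 0)" for l
  have "(\<Sum>l\<in>T \<union> U. sf_scale (b l) (sf_e_part l)) =
      (\<Sum>l\<in>T \<union> U. sf_scale (if l \<in> T then c l * s l else 0) (sf_e_part l)) +
      (\<Sum>l\<in>T \<union> U. sf_scale (if l \<in> U then d l else 0) (sf_e_part l))"
    by (simp add: b_def symfun.scale_left_distrib sum.distrib)
  also have "(\<Sum>l\<in>T \<union> U. sf_scale (if l \<in> T then c l * s l else 0) (sf_e_part l)) =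
      (\<Sum>l\<in>T. sf_scale (c l * s l) (sf_e_part l))"
    using T(1) U(1) by (intro sum.mono_neutral_cong_right) auto
  also have "(\<Sum>l\<in>T \<union> U. sf_scale (if l \<in> U then d l else 0) (sf_e_part l)) =
      (\<Sum>l\<in>U. sf_scale (d l) (sf_e_part l))"
    using T(1) U(1) by (intro sum.mono_neutral_cong_right) auto
  also have "(\<Sum>l\<in>T. sf_scale (c l * s l) (sf_e_part l)) + \<dots> = 0"
    using U(3) by (metis add.right_inverse)
  finally have "b k = 0"
    using T U k(1) by (intro e_part_independent[of "T \<union> U" b k]) auto
  moreover have "k \<notin> U" using U(2)[of k] by auto
  ultimately have "c k * s k = 0" using k(1) by (simp add: b_def)
  then have "c k = 0" using s[OF T(2)[OF k(1)]] by auto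
  then show False using k(1) by (simp add: T_def)
qed

lemma is_expansion_sum:
  assumes "finite S" "\<And>l. l \<in> S \<Longrightarrow> is_partition l" "\<And>l. l \<notin> S \<Longrightarrow> c l = 0"
  shows "is_expansion b c (\<Sum>l\<in>S. sf_scale (c l) (b l))"
proof -
  have "{l. c l \<noteq> 0} \<subseteq> S" using assms(3) by auto
  moreover from this have "finite {l. c l \<noteq> 0}"
    using assms(1) by (rule finite_subset)
  moreover have "(\<Sum>l | c l \<noteq> 0. sf_scale (c l) (b l)) = (\<Sum>l\<in>S. sf_scale (c l) (b l))"
    using assms(1,3) by (intro sum.mono_neutral_left) auto
  ultimately show ?thesis
    unfolding is_expansion_def using assms(2) by auto
qed

lemma is_expansion_unique_aux:
  fixes c d :: "nat multiset \<Rightarrow> 'a :: comm_ring_1"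
  assumes indep: "\<And>S (c :: nat multiset \<Rightarrow> 'a) l. finite S \<Longrightarrow> (\<And>l. l \<in> S \<Longrightarrow> is_partition l) \<Longrightarrow>
      (\<Sum>l\<in>S. sf_scale (c l) (b l)) = 0 \<Longrightarrow> l \<in> S \<Longrightarrow> c l = 0"
    and "is_expansion b c f" "is_expansion b d f"
  shows "c = d"
proof (rule ext)
  fix l
  let ?S = "{l. c l \<noteq> 0} \<union> {l. d l \<noteq> 0}"
  have fin: "finite ?S" and part: "\<And>l. l \<in> ?S \<Longrightarrow> is_partition l"
    using assms(2,3) by (auto simp: is_expansion_def)
  have "(\<Sum>l\<in>?S. sf_scale (c l) (b l)) = (\<Sum>l | c l \<noteq> 0. sf_scale (c l) (b l))"
    "(\<Sum>l\<in>?S. sf_scale (d l) (b l)) = (\<Sum>l | d l \<noteq> 0. sf_scale (d l) (b l))"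
    using fin by (intro sum.mono_neutral_right; auto)+
  moreover have "\<dots> = f" "(\<Sum>l | c l \<noteq> 0. sf_scale (c l) (b l)) = f"
    using assms(2,3) by (simp_all add: is_expansion_def)
  ultimately have "(\<Sum>l\<in>?S. sf_scale (c l) (b l)) = f" "(\<Sum>l\<in>?S. sf_scale (d l) (b l)) = f"
    by simp_all
  then have "(\<Sum>l\<in>?S. sf_scale (c l - d l) (b l)) = 0"
    by (simp add: symfun.scale_left_diff_distrib sum_subtractf)
  from indep[OF fin part this, of l] show "c l = d l" by fastforce
qed

lemma is_expansion_e_unique:
  fixes c d :: "nat multiset \<Rightarrow> 'a :: comm_ring_1"
  assumes "is_expansion sf_e_part c f" "is_expansion sf_e_part d f"
  shows "c = d"
proof (rule is_expansion_unique_aux[OF _ assms])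
  fix S :: "nat multiset set" and a :: "nat multiset \<Rightarrow> 'a" and l
  assume "finite S" "\<And>l. l \<in> S \<Longrightarrow> is_partition l"
    "(\<Sum>l\<in>S. sf_scale (a l) (sf_e_part l)) = 0" "l \<in> S"
  then show "a l = 0" by (rule e_part_independent[of S a l])
qed

lemma is_expansion_h_unique:
  fixes c d :: "nat multiset \<Rightarrow> 'a :: comm_ring_1"
  assumes "is_expansion sf_h_part c f" "is_expansion sf_h_part d f"
  shows "c = d"
proof (rule is_expansion_unique_aux[OF _ assms])
  fix S :: "nat multiset set" and a :: "nat multiset \<Rightarrow> 'a" and l
  assume "finite S" "\<And>l. l \<in> S \<Longrightarrow> is_partition l"
    "(\<Sum>l\<in>S. sf_scale (a l) (sf_h_part l)) = 0" "l \<in> S"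
  then show "a l = 0" by (rule h_part_independent[of S a l])
qed

lemma sf_omega_eqI:
  assumes "is_expansion sf_h_part c f" "is_expansion sf_e_part c g"
  shows "sf_omega f = g"
  unfolding sf_omega_def
proof (rule the_equality)
  show "\<exists>c. is_expansion sf_h_part c f \<and> is_expansion sf_e_part c g" using assms by blast
next
  fix g' assume "\<exists>c. is_expansion sf_h_part c f \<and> is_expansion sf_e_part c g'"
  then have "is_expansion sf_e_part c g'" using is_expansion_h_unique assms(1) by blast
  then show "g' = g" using assms(2) by (simp add: is_expansion_def)
qed

lemma sf_omega_sum:
  assumes "finite S" "\<And>l. l \<in> S \<Longrightarrow> is_partition l"
  shows "sf_omega (\<Sum>l\<in>S. sf_scale (c l) (sf_h_part l)) = (\<Sum>l\<in>S. sf_scale (c l) (sf_e_part l))"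
proof -
  define d where "d l = (if l \<in> S then c l else 0)" for l
  have eq: "(\<Sum>l\<in>S. sf_scale (d l) (b l)) = (\<Sum>l\<in>S. sf_scale (c l) (b l))" for b :: "nat multiset \<Rightarrow> 'a symfun"
    by (simp add: d_def)
  have "is_expansion b d (\<Sum>l\<in>S. sf_scale (c l) (b l))" for b
    using is_expansion_sum[OF assms, of d b] by (simp add: eq d_def)
  then show ?thesis by (intro sf_omega_eqI)
qed

lemma sf_omega_h_part: "is_partition l \<Longrightarrow> sf_omega (sf_h_part l) = sf_e_part l"
  using sf_omega_sum[of "{l}" "\<lambda>_. 1"] by simp


section \<open>The polynomials \<open>\<rho>\<close>\<close>

definition q_int :: "nat \<Rightarrow> int poly" where
  "q_int k = (\<Sum>i<k. monom 1 i)"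

function sf_rho :: "nat \<Rightarrow> int poly symfun" where
  "sf_rho n = (if n = 0 then 1 else
     sf_scale (q_int n) (sf_h n) - (\<Sum>i\<in>{1..<n}. sf_h (n - i) * sf_rho i))"
  by auto
termination by (relation "measure id") auto

declare sf_rho.simps [simp del]

lemma sf_rho_0: "sf_rho 0 = 1"
  by (subst sf_rho.simps) simp

lemma sf_rho_recursion:
  assumes "1 \<le> n"
  shows "sf_scale (q_int n) (sf_h n) = (\<Sum>i=1..n. sf_h (n - i) * sf_rho i)"
proof -
  have "(\<Sum>i=1..n. sf_h (n - i) * sf_rho i) = (\<Sum>i\<in>{1..<n}. sf_h (n - i) * sf_rho i) + sf_rho n"
    using assms by (cases n) (simp_all add: atLeastLessThanSuc_atLeastAtMost)
  then show ?thesis using assms by (subst (asm) sf_rho.simps[of n]) simp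
qed


section \<open>Hessenberg functions and the symmetric functions \<open>g\<close>\<close>

definition hessenberg :: "nat \<Rightarrow> (nat \<Rightarrow> nat) \<Rightarrow> bool" where
  "hessenberg n m \<longleftrightarrow> m \<in> {1..n} \<rightarrow> {1..n} \<and> mono_on {1..n} m \<and> (\<forall>i\<in>{1..n}. i \<le> m i)"

definition hess_perms :: "nat \<Rightarrow> (nat \<Rightarrow> nat) \<Rightarrow> (nat \<Rightarrow> nat) set" where
  "hess_perms n m = {\<sigma>. \<sigma> permutes {1..n} \<and> (\<forall>i\<in>{1..n}. \<sigma> i \<le> m i)}"

text \<open>\<open>support \<sigma> a\<close> is the library's list \<open>[a, \<sigma> a, \<sigma> (\<sigma> a), \<dots>]\<close> running once through the
  cycle of \<open>a\<close>.  Each cycle is started at its minimum, and the cycles are listed by increasing minima.\<close>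

definition cycle_list :: "nat \<Rightarrow> (nat \<Rightarrow> nat) \<Rightarrow> nat list list" where
  "cycle_list n \<sigma> =
     map (support \<sigma>) (sorted_list_of_set {a \<in> {1..n}. \<forall>b \<in> set (support \<sigma> a). a \<le> b})"

definition cycle_word :: "nat \<Rightarrow> (nat \<Rightarrow> nat) \<Rightarrow> nat list" where
  "cycle_word n \<sigma> = concat (cycle_list n \<sigma>)"

definition precedes_in :: "'a list \<Rightarrow> 'a \<Rightarrow> 'a \<Rightarrow> bool" where
  "precedes_in w x y \<longleftrightarrow> (\<exists>r s. r < s \<and> s < length w \<and> w ! r = x \<and> w ! s = y)"

definition hess_wt :: "nat \<Rightarrow> (nat \<Rightarrow> nat) \<Rightarrow> (nat \<Rightarrow> nat) \<Rightarrow> nat" where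
  "hess_wt n m \<sigma> =
     card {(i, j). i \<in> {1..n} \<and> j \<in> {1..n} \<and> i < j \<and> j \<le> m i \<and> precedes_in (cycle_word n \<sigma>) j i}"

text \<open>With \<open>d = |\<tau>\<^sub>1| - (n - k)\<close>, which is nonnegative on the index set, the summand of \<open>\<sigma>\<close> is
  \<open>(-1)\<^sup>d q\<^sup>w\<^sup>t h\<^sub>d \<omega>(\<rho>)\<close>; the indeterminate \<open>q\<close> is that of \<^typ>\<open>int poly\<close>.\<close>

definition hess_g :: "nat \<Rightarrow> (nat \<Rightarrow> nat) \<Rightarrow> nat \<Rightarrow> int poly symfun" where
  "hess_g n m k =
     (\<Sum>\<sigma> | \<sigma> \<in> hess_perms n m \<and> n - k \<le> length (hd (cycle_list n \<sigma>)).
        let d = length (hd (cycle_list n \<sigma>)) - (n - k) in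
        sf_scale ((-1) ^ d * monom 1 (hess_wt n m \<sigma>))
          (sf_h d * sf_omega (\<Prod>\<tau>\<leftarrow>tl (cycle_list n \<sigma>). sf_rho (length \<tau>))))"

text \<open>Substituting the value \<open>c\<close> for the indeterminate in every coefficient.\<close>

lift_definition sf_specialize :: "'a :: comm_ring_1 \<Rightarrow> 'a poly symfun \<Rightarrow> 'a symfun"
  is "\<lambda>c f m. poly (f m) c"
  by (auto, metis poly_0)

end

theory Submission
  imports Defs
begin

text \<open>
  At \<open>q = 1\<close> the recursion for \<open>\<rho>\<^sub>n\<close> is Newton's identity, so \<open>\<omega>(\<rho>\<^sub>n)\<close> becomes \<open>\<omega>(p\<^sub>n)\<close>, the image of
  the power sum.  Let \<open>A\<^sub>j\<close> be the sum, over the permutations \<open>\<sigma> \<le> m\<close> whose cycle through \<open>1\<close> has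
  length \<open>j\<close>, of the product of the \<open>\<omega>(p)\<close> of the lengths of the other cycles.  Then \<open>g\<^sub>k\<close> at \<open>q = 1\<close>
  is the alternating sum of the \<open>h\<^sub>d A\<^sub>j\<close> with \<open>j = n - k + d\<close>.  Because the \<open>h\<close> and the \<open>e\<close> are
  inverse to each other up to signs, it is enough to find e-positive \<open>T\<^sub>h\<close> such that
  \<open>A\<^sub>j = \<Sum>\<^sub>h e\<^sub>h\<^sub>-\<^sub>j T\<^sub>h\<close> for every \<open>j\<close>; then \<open>g\<^sub>k = T\<^sub>n\<^sub>-\<^sub>k\<close> (\<open>tab_cycle_inversion\<close>).

  The \<open>T\<^sub>h\<close> come from the random growth of standard Young tableaux that Hikita used for the
  Stanley-Stembridge conjecture, taken at \<open>q = 1\<close>.  The vertices \<open>n, n - 1, \<dots>, 1\<close> arrive in this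
  order, and each adds a box to a Young diagram.  If \<open>D\<close> is the set of rows holding the neighbours
  \<open>i + 1, \<dots>, m i\<close> of the arriving vertex \<open>i\<close>, the new box goes to row \<open>x + 1\<close> with probability
  equal to the residue at \<open>z = x\<close> of \<open>(1/z) \<Prod>\<^sub>d\<^sub>\<in>\<^sub>D (z - d + 1)/(z - d)\<close>.  A diagram with column
  heights \<open>\<lambda>\<^sub>1, \<lambda>\<^sub>2, \<dots>\<close> contributes \<open>\<Prod> \<lambda>\<^sub>j! e(\<lambda>\<^sub>j)\<close>, and \<open>T\<^sub>h\<close> collects the diagrams in which vertex \<open>1\<close> is
  in row \<open>h\<close>, with the factor \<open>h e\<^sub>h\<close> of its column taken out.  Positivity of \<open>T\<^sub>h\<close> is visible, as the
  probabilities are nonnegative.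

  What has to be proved is the identity between \<open>A\<close> and \<open>T\<close> (\<open>cyc_marked_eq_tab_cycle\<close>).  Both sides,
  as functions of \<open>m\<close>, satisfy the same two modular laws, which say that certain second
  differences in \<open>m\<close> vanish.  For permutations this is conjugation by a transposition of two
  vertices whose neighbours differ at a single vertex only (\<open>cyc_marked_column_law\<close>, \<open>cyc_marked_row_law\<close>).  For fillings
  it is the exchange of the rows of two such vertices, under which the second difference of the
  probabilities changes its sign (\<open>rows_prob_column_law\<close>, \<open>rows_prob_row_law\<close>).  In no case the
  vertex \<open>1\<close> is moved, so the laws hold for the versions refined by the cycle or row of \<open>1\<close>.

  The modular laws determine everything from the Hessenberg functions in which the smallest vertex
  has at most one neighbour (\<open>all_hessenberg\<close>).  For these, deleting the smallest vertex expresses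
  both sides in the same way through the smaller vertex set, so an induction applies.  For this
  induction the vertex set is an interval \<open>{a..n}\<close> with fixed \<open>n\<close> and decreasing \<open>a\<close>, and the vertex
  \<open>a\<close> plays the role of \<open>1\<close>.

  The probabilities are rational, so the identity is proved over the rationals.  Since \<open>g\<^sub>k\<close> is an
  integral combination of the \<open>e\<^sub>\<lambda>\<close> and such combinations are unique, the integral coefficients
  are the nonnegative rational ones.
\<close>

section \<open>Hessenberg functions and modular laws\<close>

definition hess_on :: "nat \<Rightarrow> nat \<Rightarrow> (nat \<Rightarrow> nat) \<Rightarrow> bool" where
  "hess_on a n m \<longleftrightarrow> (\<forall>i\<in>{a..n}. i \<le> m i \<and> m i \<le> n) \<and> (\<forall>i\<in>{a..n}. \<forall>j\<in>{a..n}. i \<le> j \<longrightarrow> m i \<le> m j)"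

lemma hess_onD:
  assumes "hess_on a n m" "a \<le> i" "i \<le> n"
  shows "i \<le> m i" "m i \<le> n"
  using assms by (auto simp: hess_on_def)

lemma hess_on_mono:
  assumes "hess_on a n m" "a \<le> i" "i \<le> j" "j \<le> n"
  shows "m i \<le> m j"
  using assms by (auto simp: hess_on_def)

lemma hess_on_Suc: "hess_on a n m \<Longrightarrow> hess_on (Suc a) n m"
  by (auto simp: hess_on_def)

lemma hess_on_update:
  assumes "hess_on a n m" "t \<le> p" "p \<le> n"
    and "\<And>u. a \<le> u \<Longrightarrow> u < t \<Longrightarrow> m u \<le> p" "\<And>u. t < u \<Longrightarrow> u \<le> n \<Longrightarrow> p \<le> m u"
  shows "hess_on a n (m(t := p))"
  unfolding hess_on_def
proof (intro conjI ballI impI)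
  fix i j assume ij: "i \<in> {a..n}" "j \<in> {a..n}" "i \<le> j"
  then have "m i \<le> m j" using hess_on_mono[OF assms(1), of i j] by simp
  then show "(m(t := p)) i \<le> (m(t := p)) j"
    using ij assms(4)[of i] assms(5)[of j] by (cases "i = t"; cases "j = t") simp_all
next
  fix i assume "i \<in> {a..n}"
  then show "i \<le> (m(t := p)) i" "(m(t := p)) i \<le> n"
    using hess_onD[OF assms(1), of i] assms(2,3) by simp_all
qed

text \<open>
  The laws express that, for a function \<open>F\<close> of \<open>m\<close> and \<open>P m\<close> meaning \<open>F m = 0\<close>, a second
  difference of \<open>F\<close> vanishes.  Read \<open>m\<close> as a graph in which \<open>i < j\<close> are adjacent if \<open>j \<le> m i\<close>.  In the
  column law \<open>q - 1\<close> and \<open>q\<close> are twins except that \<open>t\<close> may be adjacent to both, to the first, or to none; in the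
  row law \<open>s\<close> and \<open>s + 1\<close> are twins except that \<open>q\<close> may be adjacent to both, to the second, or to none.
  The column law extrapolates from two smaller values of \<open>m t\<close> to the largest one, the row law
  interpolates between the two symmetric positions.
\<close>

locale modular_closed =
  fixes a n :: nat and P :: "(nat \<Rightarrow> nat) \<Rightarrow> bool"
  assumes column_law: "\<And>m t q. \<lbrakk>hess_on a n m; a \<le> t; t + 2 \<le> q; q \<le> n; m t = q; m (q - 1) = m q;
      \<And>u. a \<le> u \<Longrightarrow> u < t \<Longrightarrow> m u \<le> q - 2; \<And>u. t < u \<Longrightarrow> u \<le> n \<Longrightarrow> q \<le> m u;
      P (m(t := q - 1)); P (m(t := q - 2))\<rbrakk> \<Longrightarrow> P m"
    and row_law: "\<And>m s q. \<lbrakk>hess_on a n m; a < s; s + 2 \<le> q; q \<le> n; m s = q; m (Suc s) = q;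
      \<And>u. a \<le> u \<Longrightarrow> u < s \<Longrightarrow> m u \<le> q - 1 \<and> m u \<noteq> s;
      P m; P (m(s := q - 1, Suc s := q - 1))\<rbrakk> \<Longrightarrow> P (m(s := q - 1))"
    and base: "\<And>m. hess_on a n m \<Longrightarrow> m a \<le> Suc a \<Longrightarrow> P m"
begin

text \<open>
  Vertices \<open>s\<close> and \<open>s + 1\<close> that no smaller vertex distinguishes may be assumed to be twins.  If
  \<open>m (s + 1)\<close> exceeds \<open>m s\<close> by one, this is the row law.  If it exceeds \<open>m s\<close> by more, put
  \<open>q = m (s + 1)\<close>: no vertex below \<open>q - 1\<close> distinguishes \<open>q - 1\<close> and \<open>q\<close>, so by induction these may
  be assumed to be twins, and then the column law for \<open>t = s + 1\<close> shrinks the gap.  The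
  assumption on \<open>m'\<close> fixes the values below \<open>s\<close> only, because the construction changes values
  from \<open>s\<close> on.
\<close>

lemma equalize:
  assumes "hess_on a n m" "a < s" "s < n" "\<And>u. a \<le> u \<Longrightarrow> u \<le> s \<Longrightarrow> m u \<noteq> s"
    and "\<And>m'. hess_on a n m' \<Longrightarrow> (\<And>u. u < s \<Longrightarrow> m' u = m u) \<Longrightarrow> m' s = m' (Suc s) \<Longrightarrow> P m'"
  shows "P m"
  using assms
  \<comment> \<open>Lexicographic in \<open>n - s\<close> and the gap, which is at most \<open>n\<close>.\<close>
proof (induction "(n - s) * (n + 1) + (m (Suc s) - m s)" arbitrary: m s rule: less_induct)
  case less
  note hm = less.prems(1) and as = less.prems(2) and sn = less.prems(3)
    and nos = less.prems(4) and twin = less.prems(5)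
  define q where "q = m (Suc s)"
  have ms: "Suc s \<le> m s" "m s \<le> q" "q \<le> n"
    using hess_onD[OF hm, of s] hess_onD[OF hm, of "Suc s"] hess_on_mono[OF hm, of s "Suc s"] nos[of s] as sn
    by (auto simp: q_def)
  have below: "m u \<le> m s" if "a \<le> u" "u \<le> s" for u
    using hess_on_mono[OF hm, of u s] that sn by simp
  have above: "q \<le> m u" if "s < u" "u \<le> n" for u
    using hess_on_mono[OF hm, of "Suc s" u] that as by (simp add: q_def)
  consider "m s = q" | "q = Suc (m s)" | "m s + 2 \<le> q" using ms by linarith
  then show ?case
  proof cases
    case 1
    then show ?thesis using twin[of m] hm by (simp add: q_def)
  next
    case 2
    let ?m1 = "m(s := q)" and ?m2 = "m(Suc s := q - 1)"
    have sub: "a \<le> u \<Longrightarrow> u \<le> s \<Longrightarrow> m u \<le> q - 1" for u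
      using below 2 by fastforce
    have h1: "hess_on a n ?m1"
    proof (rule hess_on_update[OF hm])
      show "m u \<le> q" if "a \<le> u" "u < s" for u using sub[of u] that by simp
    qed (use ms above in auto)
    have h2: "hess_on a n ?m2"
    proof (rule hess_on_update[OF hm])
      show "m u \<le> q - 1" if "a \<le> u" "u < Suc s" for u using sub[of u] that by simp
      show "q - 1 \<le> m u" if "Suc s < u" "u \<le> n" for u using above[of u] that by simp
    qed (use ms 2 in auto)
    have "P (?m1(s := q - 1))"
    proof (rule row_law[of ?m1 s q])
      show "P ?m1" using h1 by (intro twin) (auto simp: q_def)
      have "?m1(s := q - 1, Suc s := q - 1) = ?m2" using 2 by auto
      then show "P (?m1(s := q - 1, Suc s := q - 1))"
        using h2 2 by (simp only:) (intro twin; auto)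
    qed (use h1 as ms 2 nos sub in \<open>auto simp: q_def\<close>)
    moreover have "?m1(s := q - 1) = m" using 2 by auto
    ultimately show ?thesis by simp
  next
    case 3
    let ?r = "q - 1"
    have r: "s + 2 \<le> ?r" "?r < n" "Suc ?r = q" using 3 ms by linarith+
    have meas: "(n - ?r) * (n + 1) + (m (Suc ?r) - m ?r) < (n - s) * (n + 1) + (m (Suc s) - m s)"
    proof -
      have "m (Suc ?r) \<le> n" using hess_onD[OF hm, of "Suc ?r"] r as by simp
      then have "(n - ?r) * (n + 1) + (m (Suc ?r) - m ?r) < (Suc (n - ?r)) * (n + 1)" by simp
      also have "\<dots> \<le> (n - s) * (n + 1)" using r by (intro mult_right_mono) auto
      finally show ?thesis by (rule trans_less_add1)
    qed
    show ?thesis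
    proof (rule less.hyps[OF meas])
      show "hess_on a n m" "a < ?r" "?r < n" using hm r as by auto
      show "m u \<noteq> ?r" if "a \<le> u" "u \<le> ?r" for u
        using below[of u] above[of u] that 3 r by (cases "u \<le> s") fastforce+
    next
      fix m' assume m': "hess_on a n m'" "\<And>u. u < ?r \<Longrightarrow> m' u = m u" "m' ?r = m' (Suc ?r)"
      have eqs: "m' s = m s" "m' (Suc s) = q" using m'(2) r by (auto simp: q_def)
      have step: "P (m'(Suc s := p))" if p: "m s \<le> p" "p < q" for p
      proof (rule less.hyps[of s])
        show "(n - s) * (n + 1) + ((m'(Suc s := p)) (Suc s) - (m'(Suc s := p)) s) <
            (n - s) * (n + 1) + (m (Suc s) - m s)"
          using eqs p by (simp add: q_def)
        have lo: "m' u \<le> m s" if "a \<le> u" "u \<le> s" for u using below that m'(2) r by simp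
        have hi: "q \<le> m' u" if "s < u" "u \<le> n" for u
          using hess_on_mono[OF m'(1), of "Suc s" u] that as eqs by simp
        show "hess_on a n (m'(Suc s := p))"
        proof (rule hess_on_update[OF m'(1)])
          show "m' u \<le> p" if "a \<le> u" "u < Suc s" for u using lo[of u] that p by simp
          show "p \<le> m' u" if "Suc s < u" "u \<le> n" for u using hi[of u] that p by simp
        qed (use ms p in auto)
        show "a < s" "s < n" using as sn by auto
        show "(m'(Suc s := p)) u \<noteq> s" if "a \<le> u" "u \<le> s" for u
          using nos[OF that] m'(2)[of u] that r by simp
      next
        fix m'' assume m'': "hess_on a n m''" "\<And>u. u < s \<Longrightarrow> m'' u = (m'(Suc s := p)) u" "m'' s = m'' (Suc s)"
        show "P m''" using m'' m'(2) r by (intro twin) auto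
      qed
      show "P m'"
      proof (rule column_law[of m' "Suc s" q])
        show "P (m'(Suc s := q - 1))" "P (m'(Suc s := q - 2))" using 3 by (auto intro!: step)
        show "m' u \<le> q - 2" if "a \<le> u" "u < Suc s" for u
          using below[of u] that m'(2)[of u] r 3 by fastforce
        show "q \<le> m' u" if "Suc s < u" "u \<le> n" for u
          using hess_on_mono[OF m'(1), of "Suc s" u] that as eqs by simp
      qed (use m' r as ms eqs in auto)
    qed
  qed
qed

text \<open>
  With \<open>q = m a \<ge> a + 2\<close>, no vertex below \<open>q - 1\<close> distinguishes \<open>q - 1\<close> and \<open>q\<close>; once they are twins, the
  column law for \<open>t = a\<close> lowers \<open>m a\<close>.
\<close>

theorem all_hessenberg:
  assumes "hess_on a n m" "a \<le> n"
  shows "P m"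
  using assms
proof (induction "m a" arbitrary: m rule: less_induct)
  case less
  note hm = less.prems(1)
  define q where "q = m a"
  have q: "a \<le> q" "q \<le> n" using hess_onD[OF hm, of a] less.prems by (auto simp: q_def)
  have ge: "q \<le> m u" if "a \<le> u" "u \<le> n" for u
    using hess_on_mono[OF hm, of a u] that by (simp add: q_def)
  show ?case
  proof (cases "q \<le> Suc a")
    case True
    then show ?thesis using base[OF hm] by (simp add: q_def)
  next
    case False
    show ?thesis
    proof (rule equalize[OF hm, of "q - 1"])
      show "a < q - 1" "q - 1 < n" using False q by auto
      show "m u \<noteq> q - 1" if "a \<le> u" "u \<le> q - 1" for u
        using ge[of u] that q False by fastforce
    next
      fix m' assume m': "hess_on a n m'" "\<And>u. u < q - 1 \<Longrightarrow> m' u = m u" "m' (q - 1) = m' (Suc (q - 1))"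
      have ma: "m' a = q" using m'(2)[of a] False by (simp add: q_def)
      have step: "P (m'(a := p))" if p: "a \<le> p" "p < q" for p
      proof (rule less.hyps)
        show "hess_on a n (m'(a := p))"
        proof (rule hess_on_update[OF m'(1)])
          show "p \<le> m' u" if "a < u" "u \<le> n" for u
            using hess_on_mono[OF m'(1), of a u] that ma p by simp
        qed (use p q in auto)
      qed (use p less.prems in \<open>auto simp: q_def\<close>)
      show "P m'"
      proof (rule column_law[of m' a q])
        show "P (m'(a := q - 1))" "P (m'(a := q - 2))" using False by (auto intro!: step)
        show "q \<le> m' u" if "a < u" "u \<le> n" for u
          using hess_on_mono[OF m'(1), of a u] that ma by simp
      qed (use m' False q ma in auto)
    qed
  qed
qed

end


section \<open>Permutations below a Hessenberg function, weighted by cycle type\<close>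

definition cycle_weight :: "(nat \<Rightarrow> 'b :: comm_monoid_mult) \<Rightarrow> 'a set set \<Rightarrow> 'b" where
  "cycle_weight f \<C> = (\<Prod>C\<in>\<C>. f (card C))"

definition perms_on :: "nat \<Rightarrow> nat \<Rightarrow> (nat \<Rightarrow> nat) \<Rightarrow> (nat \<Rightarrow> nat) set" where
  "perms_on a n m = {\<sigma>. \<sigma> permutes {a..n} \<and> (\<forall>i\<in>{a..n}. \<sigma> i \<le> m i)}"

definition cyc_total :: "(nat \<Rightarrow> 'b :: comm_ring_1) \<Rightarrow> nat \<Rightarrow> nat \<Rightarrow> (nat \<Rightarrow> nat) \<Rightarrow> 'b" where
  "cyc_total f a n m = (\<Sum>\<sigma>\<in>perms_on a n m. cycle_weight f (orbit \<sigma> ` {a..n}))"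

text \<open>
  The cycle of the smallest vertex \<open>a\<close> is recorded by its length only and contributes no factor.
\<close>

definition marked_weight :: "(nat \<Rightarrow> 'b :: comm_ring_1) \<Rightarrow> nat \<Rightarrow> nat \<Rightarrow> nat \<Rightarrow> (nat \<Rightarrow> nat) \<Rightarrow> 'b" where
  "marked_weight f a n k \<sigma> =
     (if card (orbit \<sigma> a) = k then cycle_weight f (orbit \<sigma> ` {a..n} - {orbit \<sigma> a}) else 0)"

definition cyc_marked :: "(nat \<Rightarrow> 'b :: comm_ring_1) \<Rightarrow> nat \<Rightarrow> nat \<Rightarrow> (nat \<Rightarrow> nat) \<Rightarrow> nat \<Rightarrow> 'b" where
  "cyc_marked f a n m k = (\<Sum>\<sigma>\<in>perms_on a n m. marked_weight f a n k \<sigma>)"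

lemma finite_perms_on [simp]: "finite (perms_on a n m)"
  by (rule finite_subset[OF _ finite_permutations[of "{a..n}"]]) (auto simp: perms_on_def)

lemma permutes_self_in_orbit: "\<sigma> permutes {a..n :: nat} \<Longrightarrow> x \<in> orbit \<sigma> x"
  by (rule permutation_self_in_orbit) (auto simp: permutation_permutes)

lemma orbit_eq_iff_permutes:
  assumes "\<sigma> permutes {a..n :: nat}"
  shows "orbit \<sigma> x = orbit \<sigma> y \<longleftrightarrow> x \<in> orbit \<sigma> y"
  by (metis assms cyclic_on_orbit finite_atLeastAtMost orbit_cyclic_eq3 permutes_self_in_orbit)

section \<open>Modular laws for permutations\<close>

lemma orbit_conj_transpose:
  assumes "\<sigma> permutes {a..n :: nat}"
  shows "orbit (transpose b c \<circ> \<sigma> \<circ> transpose b c) (transpose b c x) = transpose b c ` orbit \<sigma> x"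
  by (rule orbit_inverse[symmetric]) (use permutes_self_in_orbit[OF assms] in auto)

text \<open>
  Conjugation by a transposition permutes the cycles and preserves their lengths; the cycle of \<open>a\<close>
  stays the cycle of \<open>a\<close> because the transposition fixes \<open>a\<close>.
\<close>

lemma marked_weight_conj:
  assumes "\<sigma> permutes {a..n}" and "b \<in> {a<..n}" "c \<in> {a<..n}"
  shows "marked_weight f a n k (transpose b c \<circ> \<sigma> \<circ> transpose b c) = marked_weight f a n k \<sigma>"
proof -
  let ?\<tau> = "transpose b c"
  let ?\<sigma> = "?\<tau> \<circ> \<sigma> \<circ> ?\<tau>"
  have \<tau>: "?\<tau> permutes {a..n}" using assms by (intro permutes_swap_id) auto
  have inj: "inj (image ?\<tau>)"
    by (rule injI) (simp add: inj_image_eq_iff[OF permutes_inj[OF \<tau>]])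
  have card: "card (?\<tau> ` C) = card C" for C by (simp add: card_image)
  have oa: "orbit ?\<sigma> a = ?\<tau> ` orbit \<sigma> a"
    using orbit_conj_transpose[OF assms(1), of b c a] assms(2,3) by simp
  have "orbit ?\<sigma> ` {a..n} = orbit ?\<sigma> ` ?\<tau> ` {a..n}"
    using permutes_image[OF \<tau>] by simp
  also have "\<dots> = image ?\<tau> ` orbit \<sigma> ` {a..n}"
    unfolding image_image orbit_conj_transpose[OF assms(1)] ..
  finally have "orbit ?\<sigma> ` {a..n} - {orbit ?\<sigma> a} = image ?\<tau> ` (orbit \<sigma> ` {a..n} - {orbit \<sigma> a})"
    using inj by (auto simp: oa inj_eq)
  moreover have "cycle_weight f (image ?\<tau> ` \<C>) = cycle_weight f \<C>" for \<C> :: "nat set set"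
    unfolding cycle_weight_def by (subst prod.reindex) (use inj in \<open>auto intro: inj_on_subset simp: card\<close>)
  ultimately show ?thesis
    unfolding marked_weight_def by (simp add: oa card)
qed

lemma sum_marked_weight_conj:
  assumes "b \<in> {a<..n}" "c \<in> {a<..n}"
    and "\<And>\<sigma>. \<sigma> \<in> S \<Longrightarrow> \<sigma> permutes {a..n} \<and> transpose b c \<circ> \<sigma> \<circ> transpose b c \<in> T"
    and "\<And>\<sigma>. \<sigma> \<in> T \<Longrightarrow> \<sigma> permutes {a..n} \<and> transpose b c \<circ> \<sigma> \<circ> transpose b c \<in> S"
  shows "(\<Sum>\<sigma>\<in>S. marked_weight f a n k \<sigma>) = (\<Sum>\<sigma>\<in>T. marked_weight f a n k \<sigma>)"
  by (rule sum.reindex_bij_witness[of _ "\<lambda>\<sigma>. transpose b c \<circ> \<sigma> \<circ> transpose b c"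
        "\<lambda>\<sigma>. transpose b c \<circ> \<sigma> \<circ> transpose b c"])
    (use assms in \<open>auto simp: fun_eq_iff marked_weight_conj\<close>)

lemma permutes_conj_transpose:
  "\<sigma> permutes {a..n} \<Longrightarrow> b \<in> {a..n} \<Longrightarrow> c \<in> {a..n} \<Longrightarrow>
    transpose b c \<circ> \<sigma> \<circ> transpose b c permutes {a..n :: nat}"
  by (intro permutes_compose permutes_swap_id)

lemma cyc_marked_split:
  assumes "t \<in> {a..n}" "m t = q" "0 < q"
  shows "cyc_marked f a n m k = cyc_marked f a n (m(t := q - 1)) k +
    (\<Sum>\<sigma> | \<sigma> \<in> perms_on a n m \<and> \<sigma> t = q. marked_weight f a n k \<sigma>)"
proof -
  have split: "(\<forall>i\<in>{a..n}. Q i) \<longleftrightarrow> Q t \<and> (\<forall>i\<in>{a..n} - {t}. Q i)" for Q using assms(1) by auto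
  have "\<sigma> t \<le> q \<longleftrightarrow> \<sigma> t \<le> q - 1 \<or> \<sigma> t = q" for \<sigma> :: "nat \<Rightarrow> nat" using assms(3) by linarith
  then have "perms_on a n m = perms_on a n (m(t := q - 1)) \<union> {\<sigma> \<in> perms_on a n m. \<sigma> t = q}"
    using assms unfolding perms_on_def split by auto
  moreover have "perms_on a n (m(t := q - 1)) \<inter> {\<sigma> \<in> perms_on a n m. \<sigma> t = q} = {}"
    using assms unfolding perms_on_def split by auto
  ultimately show ?thesis
    unfolding cyc_marked_def
    by (subst \<open>perms_on a n m = _\<close>, subst sum.union_disjoint) (auto intro: finite_subset[OF _ finite_perms_on])
qed

lemma transpose_le_iff: "M \<noteq> q \<Longrightarrow> transpose q (Suc q) x \<le> M \<longleftrightarrow> x \<le> (M :: nat)"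
  by (auto simp: transpose_def)

text \<open>
  Both first differences are sums over permutations with a prescribed value at \<open>t\<close>: the value \<open>q\<close> in
  one case, \<open>q - 1\<close> in the other.  Conjugation by the transposition of \<open>q - 1\<close> and \<open>q\<close> exchanges the two
  conditions at \<open>t\<close>, and it preserves the remaining ones because no other bound equals \<open>q - 1\<close> and the bounds at
  \<open>q - 1\<close> and \<open>q\<close> agree.
\<close>

lemma cyc_marked_column_law:
  assumes "t \<in> {a..n}" "Suc t < q" "q \<le> n" "m t = q" "m (q - 1) = m q"
    and "\<And>u. u \<in> {a..n} \<Longrightarrow> u \<noteq> t \<Longrightarrow> m u \<noteq> q - 1"
  shows "cyc_marked f a n m k + cyc_marked f a n (m(t := q - 2)) k =
    cyc_marked f a n (m(t := q - 1)) k + cyc_marked f a n (m(t := q - 1)) k"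
proof -
  obtain r where q: "q = Suc r" using assms by (cases q) auto
  let ?c = "\<lambda>\<sigma>. transpose r q \<circ> \<sigma> \<circ> transpose r q"
  have rq: "r \<in> {a<..n}" "q \<in> {a<..n}" using assms q by auto
  have other: "(\<forall>i\<in>{a..n} - {t}. ?c \<sigma> i \<le> m i) \<longleftrightarrow> (\<forall>i\<in>{a..n} - {t}. \<sigma> i \<le> m i)" for \<sigma>
  proof -
    have tr: "transpose r q ` ({a..n} - {t}) = {a..n} - {t}"
      using rq assms(2) q by (intro permutes_image permutes_swap_id) auto
    have m: "m (transpose r q i) = m i" for i using assms(5) by (auto simp: transpose_def q)
    have "(\<forall>i\<in>{a..n} - {t}. \<sigma> i \<le> m i) \<longleftrightarrow> (\<forall>i\<in>transpose r q ` ({a..n} - {t}). \<sigma> i \<le> m i)"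
      using tr by simp
    also have "\<dots> \<longleftrightarrow> (\<forall>i\<in>{a..n} - {t}. ?c \<sigma> i \<le> m i)"
      using assms(6) unfolding ball_simps comp_apply q by (intro ball_cong refl) (simp add: transpose_le_iff m[unfolded q])
    finally show ?thesis ..
  qed
  have t: "transpose r q t = t" using assms q by (auto simp: transpose_def)
  have split: "(\<forall>i\<in>{a..n}. Q i) \<longleftrightarrow> Q t \<and> (\<forall>i\<in>{a..n} - {t}. Q i)" for Q using assms(1) by auto
  have "(\<Sum>\<sigma> | \<sigma> \<in> perms_on a n m \<and> \<sigma> t = q. marked_weight f a n k \<sigma>) =
      (\<Sum>\<sigma> | \<sigma> \<in> perms_on a n (m(t := r)) \<and> \<sigma> t = r. marked_weight f a n k \<sigma>)"
  proof (rule sum_marked_weight_conj[OF rq])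
    fix \<sigma> assume "\<sigma> \<in> {\<sigma> \<in> perms_on a n m. \<sigma> t = q}"
    then have \<sigma>: "\<sigma> permutes {a..n}" "\<forall>i\<in>{a..n} - {t}. \<sigma> i \<le> m i" "\<sigma> t = q" by (auto simp: perms_on_def)
    moreover have "?c \<sigma> t = r" using \<sigma>(3) t by simp
    ultimately show "\<sigma> permutes {a..n} \<and> ?c \<sigma> \<in> {\<sigma> \<in> perms_on a n (m(t := r)). \<sigma> t = r}"
      using permutes_conj_transpose[OF \<sigma>(1), of r q] rq other[of \<sigma>]
      unfolding perms_on_def mem_Collect_eq split by (auto simp del: comp_apply)
  next
    fix \<sigma> assume "\<sigma> \<in> {\<sigma> \<in> perms_on a n (m(t := r)). \<sigma> t = r}"
    then have \<sigma>: "\<sigma> permutes {a..n}" "\<forall>i\<in>{a..n} - {t}. \<sigma> i \<le> m i" "\<sigma> t = r"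
      unfolding perms_on_def mem_Collect_eq split by auto
    moreover have "?c \<sigma> t = q" using \<sigma>(3) t by simp
    ultimately show "\<sigma> permutes {a..n} \<and> ?c \<sigma> \<in> {\<sigma> \<in> perms_on a n m. \<sigma> t = q}"
      using permutes_conj_transpose[OF \<sigma>(1), of r q] rq other[of \<sigma>] assms(4)
      unfolding perms_on_def mem_Collect_eq split by (auto simp del: comp_apply)
  qed
  moreover have "cyc_marked f a n m k = cyc_marked f a n (m(t := r)) k +
      (\<Sum>\<sigma> | \<sigma> \<in> perms_on a n m \<and> \<sigma> t = q. marked_weight f a n k \<sigma>)"
    using cyc_marked_split[of t a n m q f k] assms q by simp
  moreover have "cyc_marked f a n (m(t := r)) k = cyc_marked f a n (m(t := r - 1)) k +
      (\<Sum>\<sigma> | \<sigma> \<in> perms_on a n (m(t := r)) \<and> \<sigma> t = r. marked_weight f a n k \<sigma>)"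
    using cyc_marked_split[of t a n "m(t := r)" r f k] assms q by simp
  moreover have "q - 1 = r" "q - 2 = r - 1" using q by auto
  ultimately show ?thesis by simp
qed

text \<open>
  Here the first differences prescribe the value \<open>q\<close> at \<open>s\<close> and at \<open>s + 1\<close>, and conjugation by the
  transposition of \<open>s\<close> and \<open>s + 1\<close> exchanges them.  Injectivity gives the sharper bound \<open>q - 1\<close> at the other
  of the two points.
\<close>

lemma cyc_marked_row_law:
  assumes "a < s" "s + 2 \<le> q" "q \<le> n" "m s = q" "m (Suc s) = q"
    and "\<And>u. u \<in> {a..n} \<Longrightarrow> m u \<noteq> s"
  shows "cyc_marked f a n m k + cyc_marked f a n (m(s := q - 1, Suc s := q - 1)) k =
    cyc_marked f a n (m(s := q - 1)) k + cyc_marked f a n (m(s := q - 1)) k"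
proof -
  let ?\<tau> = "transpose s (Suc s)"
  let ?c = "\<lambda>\<sigma>. ?\<tau> \<circ> \<sigma> \<circ> ?\<tau>"
  have s: "s \<in> {a<..n}" "Suc s \<in> {a<..n}" using assms by auto
  have other: "(\<forall>i\<in>{a..n} - {s, Suc s}. ?c \<sigma> i \<le> m i) \<longleftrightarrow> (\<forall>i\<in>{a..n} - {s, Suc s}. \<sigma> i \<le> m i)" for \<sigma>
    using assms(6) by (intro ball_cong refl) (auto simp: transpose_le_iff)
  have fq: "?\<tau> q = q" using assms by (auto simp: transpose_def)
  have lt: "?\<tau> x \<le> q - 1 \<longleftrightarrow> x \<le> q - 1" for x using assms by (intro transpose_le_iff) auto
  have split: "(\<forall>i\<in>{a..n}. Q i) \<longleftrightarrow> Q s \<and> Q (Suc s) \<and> (\<forall>i\<in>{a..n} - {s, Suc s}. Q i)" for Q using s by auto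
  have "(\<Sum>\<sigma> | \<sigma> \<in> perms_on a n m \<and> \<sigma> s = q. marked_weight f a n k \<sigma>) =
      (\<Sum>\<sigma> | \<sigma> \<in> perms_on a n (m(s := q - 1)) \<and> \<sigma> (Suc s) = q. marked_weight f a n k \<sigma>)"
  proof (rule sum_marked_weight_conj[OF s])
    fix \<sigma> assume "\<sigma> \<in> {\<sigma> \<in> perms_on a n m. \<sigma> s = q}"
    then have \<sigma>: "\<sigma> permutes {a..n}" "\<forall>i\<in>{a..n} - {s, Suc s}. \<sigma> i \<le> m i" "\<sigma> s = q" "\<sigma> (Suc s) \<le> m (Suc s)"
      using s by (auto simp: perms_on_def)
    have "\<sigma> (Suc s) \<noteq> q" using \<sigma>(1,3) by (metis n_not_Suc_n permutes_def)
    then have "\<sigma> (Suc s) \<le> q - 1" using \<sigma>(4) assms(5) by simp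
    then have "?c \<sigma> s \<le> q - 1" "?c \<sigma> (Suc s) = q" using \<sigma>(3) fq lt by auto
    then show "\<sigma> permutes {a..n} \<and> ?c \<sigma> \<in> {\<sigma> \<in> perms_on a n (m(s := q - 1)). \<sigma> (Suc s) = q}"
      using permutes_conj_transpose[OF \<sigma>(1), of s "Suc s"] s other[of \<sigma>] \<sigma> assms(5)
      unfolding perms_on_def mem_Collect_eq split by (auto simp del: comp_apply)
  next
    fix \<sigma> assume "\<sigma> \<in> {\<sigma> \<in> perms_on a n (m(s := q - 1)). \<sigma> (Suc s) = q}"
    then have \<sigma>: "\<sigma> permutes {a..n}" "\<forall>i\<in>{a..n} - {s, Suc s}. \<sigma> i \<le> m i" "\<sigma> (Suc s) = q" "\<sigma> s \<le> q - 1"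
      unfolding perms_on_def mem_Collect_eq split by auto
    then have "?c \<sigma> (Suc s) \<le> q" "?c \<sigma> s = q" using fq lt[of "\<sigma> s"] by auto
    then show "\<sigma> permutes {a..n} \<and> ?c \<sigma> \<in> {\<sigma> \<in> perms_on a n m. \<sigma> s = q}"
      using permutes_conj_transpose[OF \<sigma>(1), of s "Suc s"] s other[of \<sigma>] \<sigma> assms(4,5)
      unfolding perms_on_def mem_Collect_eq split by (auto simp del: comp_apply)
  qed
  moreover have "cyc_marked f a n m k = cyc_marked f a n (m(s := q - 1)) k +
      (\<Sum>\<sigma> | \<sigma> \<in> perms_on a n m \<and> \<sigma> s = q. marked_weight f a n k \<sigma>)"
    using assms s by (intro cyc_marked_split) auto
  moreover have "cyc_marked f a n (m(s := q - 1)) k = cyc_marked f a n (m(s := q - 1, Suc s := q - 1)) k +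
      (\<Sum>\<sigma> | \<sigma> \<in> perms_on a n (m(s := q - 1)) \<and> \<sigma> (Suc s) = q. marked_weight f a n k \<sigma>)"
    using assms s by (intro cyc_marked_split) auto
  ultimately show ?thesis by simp
qed

section \<open>Removing the smallest vertex of a permutation\<close>

lemma orbit_fixed: "\<sigma> a = a \<Longrightarrow> orbit \<sigma> a = {a}"
  by (simp add: orbit_eq_singleton_iff)

lemma perms_on_fixed: "{\<sigma> \<in> perms_on a n m. \<sigma> a = a} = perms_on (Suc a) n m" if "a \<le> n" "a \<le> m a"
proof -
  have ins: "{a..n} = insert a {Suc a..n}" using that by auto
  show ?thesis
  proof (intro equalityI subsetI)
    fix \<sigma> assume "\<sigma> \<in> {\<sigma> \<in> perms_on a n m. \<sigma> a = a}"
    then show "\<sigma> \<in> perms_on (Suc a) n m"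
      using permutes_superset[of \<sigma> "{a..n}" "{Suc a..n}"] by (auto simp: perms_on_def ins)
  next
    fix \<sigma> assume \<sigma>: "\<sigma> \<in> perms_on (Suc a) n m"
    then have "\<sigma> permutes {a..n}" "\<sigma> a = a"
      by (auto simp: perms_on_def intro: permutes_subset permutes_not_in)
    then show "\<sigma> \<in> {\<sigma> \<in> perms_on a n m. \<sigma> a = a}"
      using \<sigma> that by (auto simp: perms_on_def ins)
  qed
qed

lemma marked_weight_fixed:
  assumes "\<sigma> permutes {Suc a..n}" "a \<le> n"
  shows "marked_weight f a n k \<sigma> = (if k = 1 then cycle_weight f (orbit \<sigma> ` {Suc a..n}) else 0)"
proof -
  have "\<sigma> a = a" using assms by (intro permutes_not_in) auto
  then have oa: "orbit \<sigma> a = {a}" by (rule orbit_fixed)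
  have ins: "{a..n} = insert a {Suc a..n}" using assms by auto
  have "{a} \<notin> orbit \<sigma> ` {Suc a..n}"
  proof
    assume "{a} \<in> orbit \<sigma> ` {Suc a..n}"
    then obtain x where "x \<in> {Suc a..n}" "orbit \<sigma> x = {a}" by auto
    then show False using permutes_self_in_orbit[OF assms(1), of x] by simp
  qed
  then have "orbit \<sigma> ` {a..n} - {orbit \<sigma> a} = orbit \<sigma> ` {Suc a..n}"
    unfolding ins image_insert oa by auto
  then show ?thesis by (auto simp: marked_weight_def oa)
qed

lemma cyc_marked_fixed:
  assumes "a \<le> n" "a \<le> m a"
  shows "(\<Sum>\<sigma> | \<sigma> \<in> perms_on a n m \<and> \<sigma> a = a. marked_weight f a n k \<sigma>) =
    (if k = 1 then cyc_total f (Suc a) n m else 0)"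
  unfolding perms_on_fixed[of a n m, OF assms] cyc_total_def
  using assms by (auto intro!: sum.cong sum.neutral simp: perms_on_def marked_weight_fixed)

lemma cyc_marked_isolated:
  assumes "a \<le> n" "m a = a"
  shows "cyc_marked f a n m k = (if k = 1 then cyc_total f (Suc a) n m else 0)"
proof -
  have "perms_on a n m = {\<sigma> \<in> perms_on a n m. \<sigma> a = a}"
  proof (intro equalityI subsetI CollectI conjI)
    fix \<sigma> assume \<sigma>: "\<sigma> \<in> perms_on a n m"
    then have "\<sigma> permutes {a..n}" "\<sigma> a \<le> a"
      using assms by (simp_all add: perms_on_def) (metis atLeastAtMost_iff order_refl)
    then have "a \<le> \<sigma> a" using permutes_in_image[of \<sigma> "{a..n}" a] assms by simp
    then show "\<sigma> a = a" using \<open>\<sigma> a \<le> a\<close> by simp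
  qed auto
  then show ?thesis
    unfolding cyc_marked_def using cyc_marked_fixed[of a n m f k] assms by simp
qed

text \<open>
  Composing with the transposition of \<open>a\<close> and \<open>a + 1\<close> inserts \<open>a\<close> into the cycle of \<open>a + 1\<close>, directly before \<open>a + 1\<close>.
\<close>

lemma orbit_insert_transpose:
  assumes \<sigma>: "\<sigma> permutes {Suc a..n :: nat}" and "a < n"
  defines "\<pi> \<equiv> transpose a (Suc a) \<circ> \<sigma>"
  shows "orbit \<pi> a = insert a (orbit \<sigma> (Suc a))"
    and "x \<notin> orbit \<sigma> (Suc a) \<Longrightarrow> x \<noteq> a \<Longrightarrow> orbit \<pi> x = orbit \<sigma> x"
proof -
  have sa: "\<sigma> a = a" using \<sigma> by (intro permutes_not_in) auto
  have \<pi>a: "\<pi> a = Suc a" by (simp add: \<pi>_def sa)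
  have \<pi>: "\<pi> x = (if \<sigma> x = Suc a then a else \<sigma> x)" if "x \<noteq> a" for x
  proof -
    have "\<sigma> x \<noteq> a" using that sa injD[OF permutes_inj[OF \<sigma>], of x a] by auto
    then show ?thesis by (simp add: \<pi>_def transpose_def)
  qed
  show "orbit \<pi> a = insert a (orbit \<sigma> (Suc a))"
  proof (intro equalityI subsetI)
    fix y assume "y \<in> orbit \<pi> a"
    then show "y \<in> insert a (orbit \<sigma> (Suc a))"
    proof induction
      case base
      then show ?case using \<pi>a permutes_self_in_orbit[OF \<sigma>] by simp
    next
      case (step y)
      show ?case
      proof (cases "y = a")
        case True
        then show ?thesis using \<pi>a permutes_self_in_orbit[OF \<sigma>] by simp
      next
        case False
        then show ?thesis using step \<pi>[OF False] by (auto intro: orbit.step)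
      qed
    qed
  next
    have one: "Suc a \<in> orbit \<pi> a" using orbit.base[of \<pi> a] \<pi>a by simp
    have in_orb: "y \<in> orbit \<pi> a" if "y \<in> orbit \<sigma> (Suc a)" for y
    proof -
      have ne: "y \<noteq> a" if "y \<in> orbit \<sigma> (Suc a)" for y
        using permutes_orbit_subset[OF \<sigma>, of "Suc a"] that \<open>a < n\<close> by auto
      show ?thesis using that
      proof induction
        case base
        show ?case
          using \<pi>[of "Suc a"] one orbit.step[OF one] by (cases "\<sigma> (Suc a) = Suc a") auto
      next
        case (step y)
        show ?case
          using \<pi>[OF ne[OF step(1)]] one orbit.step[OF step(2)] by (cases "\<sigma> y = Suc a") auto
      qed
    qed
    have "a \<in> orbit \<pi> a"
    proof (rule permutes_self_in_orbit)
      show "\<pi> permutes {a..n}"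
        unfolding \<pi>_def using \<open>a < n\<close>
        by (intro permutes_compose[OF permutes_subset[OF \<sigma>]] permutes_swap_id) auto
    qed
    then show "y \<in> orbit \<pi> a" if "y \<in> insert a (orbit \<sigma> (Suc a))" for y
      using that in_orb by auto
  qed
  show "orbit \<pi> x = orbit \<sigma> x" if x: "x \<notin> orbit \<sigma> (Suc a)" "x \<noteq> a"
  proof (rule orbit_cong)
    show "x \<in> orbit \<sigma> x" by (rule permutes_self_in_orbit[OF \<sigma>])
    fix y assume y: "y \<in> orbit \<sigma> x"
    have "Suc a \<notin> orbit \<sigma> x" using orbit_eq_iff_permutes[OF \<sigma>] x permutes_self_in_orbit[OF \<sigma>] by metis
    moreover have "\<sigma> y \<in> orbit \<sigma> x" using y by (rule orbit.step)
    moreover have "y \<noteq> a"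
    proof
      assume "y = a"
      then have "x \<in> orbit \<sigma> a" using y orbit_eq_iff_permutes[OF \<sigma>] permutes_self_in_orbit[OF \<sigma>] by metis
      then show False using x sa by (simp add: orbit_fixed)
    qed
    ultimately show "\<pi> y = \<sigma> y" using \<pi> by metis
  qed
qed

lemma marked_weight_insert:
  assumes \<sigma>: "\<sigma> permutes {Suc a..n}" and "a < n"
  shows "marked_weight f a n k (transpose a (Suc a) \<circ> \<sigma>) = (if 0 < k then marked_weight f (Suc a) n (k - 1) \<sigma> else 0)"
proof -
  let ?\<pi> = "transpose a (Suc a) \<circ> \<sigma>"
  have oa: "orbit ?\<pi> a = insert a (orbit \<sigma> (Suc a))"
    using orbit_insert_transpose(1)[OF assms] .
  have sub: "orbit \<sigma> (Suc a) \<subseteq> {Suc a..n}"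
    using permutes_orbit_subset[OF \<sigma>, of "Suc a"] \<open>a < n\<close> by auto
  then have fin: "finite (orbit \<sigma> (Suc a))" "a \<notin> orbit \<sigma> (Suc a)" by (auto intro: finite_subset)
  have \<pi>: "?\<pi> permutes {a..n}"
    using \<open>a < n\<close> by (intro permutes_compose[OF permutes_subset[OF \<sigma>]] permutes_swap_id) auto
  have rest: "orbit p ` S - {orbit p v} = orbit p ` (S - orbit p v)" if "p permutes {b..c}" for p :: "nat \<Rightarrow> nat" and S v b c
    using orbit_eq_iff_permutes[OF that] by auto
  have "{a..n} - orbit ?\<pi> a = {Suc a..n} - orbit \<sigma> (Suc a)"
    unfolding oa by auto
  moreover have "orbit ?\<pi> ` ({Suc a..n} - orbit \<sigma> (Suc a)) = orbit \<sigma> ` ({Suc a..n} - orbit \<sigma> (Suc a))"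
    using orbit_insert_transpose(2)[OF assms] by (intro image_cong) auto
  ultimately have "orbit ?\<pi> ` {a..n} - {orbit ?\<pi> a} = orbit \<sigma> ` {Suc a..n} - {orbit \<sigma> (Suc a)}"
    unfolding rest[OF \<pi>] rest[OF \<sigma>] by simp
  moreover have "card (orbit ?\<pi> a) = Suc (card (orbit \<sigma> (Suc a)))" unfolding oa using fin by simp
  ultimately show ?thesis unfolding marked_weight_def by (cases k) (simp_all only: nat.inject diff_Suc_1 zero_less_Suc if_True if_False nat.distinct order.irrefl)
qed

text \<open>
  If \<open>a + 1\<close> is the only neighbour of \<open>a\<close>, then \<open>a\<close> is a fixed point or is mapped to \<open>a + 1\<close>; in the second case
  deleting \<open>a\<close> from its cycle shortens the marked cycle by one.
\<close>

lemma cyc_marked_pendant: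
  assumes "a < n" "m a = Suc a" "hess_on a n m"
  shows "cyc_marked f a n m k =
    (if k = 1 then cyc_total f (Suc a) n m else 0) + (if 0 < k then cyc_marked f (Suc a) n m (k - 1) else 0)"
proof -
  let ?\<tau> = "transpose a (Suc a)"
  have "cyc_marked f a n m k = cyc_marked f a n (m(a := a)) k +
      (\<Sum>\<sigma> | \<sigma> \<in> perms_on a n m \<and> \<sigma> a = Suc a. marked_weight f a n k \<sigma>)"
    using cyc_marked_split[of a a n m "Suc a" f k] assms by simp
  moreover have "(\<Sum>\<sigma> | \<sigma> \<in> perms_on a n m \<and> \<sigma> a = Suc a. marked_weight f a n k \<sigma>) =
      (\<Sum>\<sigma>\<in>perms_on (Suc a) n m. marked_weight f a n k (?\<tau> \<circ> \<sigma>))"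
  proof (rule sum.reindex_bij_witness[of _ "\<lambda>\<sigma>. ?\<tau> \<circ> \<sigma>" "\<lambda>\<sigma>. ?\<tau> \<circ> \<sigma>"])
    fix \<sigma> assume "\<sigma> \<in> {\<sigma> \<in> perms_on a n m. \<sigma> a = Suc a}"
    then have \<sigma>: "\<sigma> permutes {a..n}" "\<forall>i\<in>{a..n}. \<sigma> i \<le> m i" "\<sigma> a = Suc a" by (auto simp: perms_on_def)
    show "?\<tau> \<circ> (?\<tau> \<circ> \<sigma>) = \<sigma>" by (auto simp: fun_eq_iff)
    then show "marked_weight f a n k (?\<tau> \<circ> (?\<tau> \<circ> \<sigma>)) = marked_weight f a n k \<sigma>" by simp
    have "?\<tau> \<circ> \<sigma> permutes {a..n}" using \<sigma>(1) assms(1) by (intro permutes_compose permutes_swap_id) auto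
    then have "?\<tau> \<circ> \<sigma> permutes {Suc a..n}"
    proof (rule permutes_superset)
      fix x assume "x \<in> {a..n} - {Suc a..n}"
      then have "x = a" by auto
      then show "(?\<tau> \<circ> \<sigma>) x = x" using \<sigma>(3) by simp
    qed
    moreover have "(?\<tau> \<circ> \<sigma>) i \<le> m i" if "i \<in> {Suc a..n}" for i
      using \<sigma>(2) that hess_onD(1)[OF assms(3), of i] by (auto simp: transpose_def)
    ultimately show "?\<tau> \<circ> \<sigma> \<in> perms_on (Suc a) n m" by (auto simp: perms_on_def)
  next
    fix \<sigma> assume "\<sigma> \<in> perms_on (Suc a) n m"
    then have \<sigma>: "\<sigma> permutes {Suc a..n}" "\<forall>i\<in>{Suc a..n}. \<sigma> i \<le> m i" by (auto simp: perms_on_def)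
    have sa: "\<sigma> a = a" using \<sigma> by (intro permutes_not_in) auto
    show "?\<tau> \<circ> (?\<tau> \<circ> \<sigma>) = \<sigma>" by (auto simp: fun_eq_iff)
    have "?\<tau> \<circ> \<sigma> permutes {a..n}"
      using assms(1) by (intro permutes_compose[OF permutes_subset[OF \<sigma>(1)]] permutes_swap_id) auto
    moreover have "(?\<tau> \<circ> \<sigma>) i \<le> m i" if "i \<in> {a..n}" for i
    proof (cases "i = a")
      case False
      then have i: "i \<in> {Suc a..n}" using that by auto
      then have "\<sigma> i \<in> {Suc a..n}" using permutes_in_image[OF \<sigma>(1)] by blast
      then show ?thesis
        using \<sigma>(2) i hess_onD(1)[OF assms(3), of i] by (auto simp: transpose_def)
    qed (simp add: sa assms)
    ultimately show "?\<tau> \<circ> \<sigma> \<in> {\<sigma> \<in> perms_on a n m. \<sigma> a = Suc a}" by (auto simp: perms_on_def sa)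
  qed
  moreover have "\<dots> = (if 0 < k then cyc_marked f (Suc a) n m (k - 1) else 0)"
    using assms(1) by (auto simp: cyc_marked_def perms_on_def marked_weight_insert intro!: sum.cong sum.neutral)
  moreover have "cyc_marked f a n (m(a := a)) k = (if k = 1 then cyc_total f (Suc a) n m else 0)"
  proof -
    have "perms_on (Suc a) n (m(a := a)) = perms_on (Suc a) n m" by (auto simp: perms_on_def)
    then show ?thesis using cyc_marked_isolated[of a n "m(a := a)" f k] assms(1) by (simp add: cyc_total_def)
  qed
  ultimately show ?thesis by simp
qed

lemma cyc_total_marked:
  assumes "a \<le> n" "Suc n - a \<le> N"
  shows "cyc_total f a n m = (\<Sum>k=1..N. f k * cyc_marked f a n m k)"
proof -
  have "(\<Sum>k=1..N. f k * marked_weight f a n k \<sigma>) = cycle_weight f (orbit \<sigma> ` {a..n})"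
    if "\<sigma> \<in> perms_on a n m" for \<sigma>
  proof -
    have \<sigma>: "\<sigma> permutes {a..n}" using that by (simp add: perms_on_def)
    have sub: "orbit \<sigma> a \<subseteq> {a..n}" using permutes_orbit_subset[OF \<sigma>, of a] assms by simp
    then have "card (orbit \<sigma> a) \<le> Suc n - a" using card_mono[OF _ sub] by simp
    moreover have "0 < card (orbit \<sigma> a)"
      using finite_subset[OF sub] orbit_nonempty[of \<sigma> a] by (simp add: card_gt_0_iff)
    ultimately have "card (orbit \<sigma> a) \<in> {1..N}" using assms(2) by simp
    then have "(\<Sum>k=1..N. f k * marked_weight f a n k \<sigma>) =
        f (card (orbit \<sigma> a)) * cycle_weight f (orbit \<sigma> ` {a..n} - {orbit \<sigma> a})"
      unfolding marked_weight_def if_distrib mult_zero_right by (simp add: if_distrib sum.delta cong: if_cong)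
    also have "\<dots> = cycle_weight f (orbit \<sigma> ` {a..n})"
      unfolding cycle_weight_def using assms by (subst prod.remove[of _ "orbit \<sigma> a"]) auto
    finally show ?thesis .
  qed
  then show ?thesis
    unfolding cyc_total_def cyc_marked_def sum_distrib_left by (subst sum.swap) simp
qed


section \<open>Row insertion probabilities\<close>

text \<open>
  \<open>row_factor d h\<close> is the factor \<open>(z - d + 1)/(z - d)\<close> at \<open>z = h - 1\<close>, with its residue at the pole
  \<open>z = d\<close> divided by \<open>z\<close> in place of the undefined value.  With this convention \<open>row_prob D h\<close> is the
  residue of \<open>(1/z) \<Prod>\<^sub>d\<^sub>\<in>\<^sub>D (z - d + 1)/(z - d)\<close> at \<open>z = h - 1\<close>: for \<open>h = 1\<close> the pole comes from \<open>1/z\<close>, otherwise from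
  the factor of \<open>d = h - 1\<close>, whose value \<open>1/d\<close> accounts for \<open>1/z\<close>.
\<close>

definition row_factor :: "nat \<Rightarrow> nat \<Rightarrow> rat" where
  "row_factor d h = (if Suc d = h then 1 / of_nat d else (of_nat h - of_nat d) / (of_nat h - 1 - of_nat d))"

definition row_prob :: "nat set \<Rightarrow> nat \<Rightarrow> rat" where
  "row_prob D h = (if h = 1 \<or> h - 1 \<in> D then \<Prod>d\<in>D. row_factor d h else 0)"

text \<open>
  With \<open>k = h - 1 - d\<close> the factor is \<open>(k + 1)/k\<close>, which is negative for no nonzero integer \<open>k\<close>.
\<close>

lemma row_factor_nonneg: "0 \<le> row_factor d h"
proof (cases "h \<le> d")
  case True
  then have "(of_nat h :: rat) \<le> of_nat d" by simp
  then show ?thesis by (auto simp: row_factor_def divide_nonpos_nonpos)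
next
  case False
  then have "(of_nat (Suc d) :: rat) \<le> of_nat h" by (subst of_nat_le_iff) simp
  then show ?thesis by (simp add: row_factor_def)
qed

lemma row_prob_nonneg: "0 \<le> row_prob D h"
  by (simp add: row_prob_def prod_nonneg row_factor_nonneg)

lemma row_prob_empty [simp]: "row_prob {} h = (if h = 1 then 1 else 0)"
  by (simp add: row_prob_def)

lemma row_prob_occupied:
  assumes "finite D" "h \<in> D" shows "row_prob D h = 0"
proof -
  have "row_factor h h = 0" by (simp add: row_factor_def)
  then have "(\<Prod>d\<in>D. row_factor d h) = 0" using assms by (intro prod_zero) auto
  then show ?thesis by (simp add: row_prob_def)
qed

lemma row_prob_nonzeroD:
  assumes "row_prob D h \<noteq> 0" "finite D"
  shows "h \<notin> D" "h = 1 \<or> h - 1 \<in> D"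
  using assms row_prob_occupied by (blast, metis row_prob_def)

lemma row_prob_insert:
  assumes "finite D" "d \<notin> D" "0 < h" "Suc d \<noteq> h"
  shows "row_prob (insert d D) h = row_factor d h * row_prob D h"
  using assms by (auto simp: row_prob_def)

lemma row_prob_insert_pole:
  assumes "finite D" "d \<notin> D" "0 < d"
  shows "row_prob (insert d D) (Suc d) = (\<Prod>x\<in>D. row_factor x (Suc d)) / of_nat d"
    and "row_prob D (Suc d) = 0"
  using assms by (auto simp: row_prob_def row_factor_def)

lemma row_factor_regular:
  "Suc d \<noteq> h \<Longrightarrow> row_factor d h = 1 + 1 / (of_nat h - 1 - of_nat d)"
  "Suc d \<noteq> h \<Longrightarrow> (of_nat h :: rat) - 1 - of_nat d \<noteq> 0"
proof -
  assume "Suc d \<noteq> h"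
  then have "(of_nat (Suc d) :: rat) \<noteq> of_nat h" by (subst of_nat_eq_iff)
  then show *: "(of_nat h :: rat) - 1 - of_nat d \<noteq> 0" by auto
  show "row_factor d h = 1 + 1 / (of_nat h - 1 - of_nat d)"
    using * \<open>Suc d \<noteq> h\<close> by (simp add: row_factor_def field_simps)
qed

text \<open>
  If two vertices with the same set \<open>D\<close> of neighbouring rows arrive one after the other, the
  rows \<open>x\<close> then \<open>y\<close> and the rows \<open>y\<close> then \<open>x\<close> have probabilities in the ratio
  \<open>(\<delta> + 1) : (\<delta> - 1)\<close> with \<open>\<delta> = y - x\<close>, since the second vertex meets an additional factor that depends on \<open>\<delta>\<close> only.
  If \<open>\<bar>\<delta>\<bar> = 1\<close> one of the two orders is impossible.
\<close>

lemma row_prob_swap: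
  assumes D: "finite D" "0 \<notin> D" and xy: "x \<notin> D" "y \<notin> D" "x \<noteq> y" "0 < x" "0 < y"
  shows "(of_nat y - of_nat x - 1) * (row_prob D x * row_prob (insert x D) y) =
    (of_nat y - of_nat x + 1) * (row_prob D y * row_prob (insert y D) x)"
proof -
  consider "y = Suc x" | "x = Suc y" | "Suc x \<noteq> y" "Suc y \<noteq> x" by blast
  then show ?thesis
  proof cases
    case 1
    then show ?thesis using D xy by (simp add: row_prob_insert_pole)
  next
    case 2
    then show ?thesis using D xy by (simp add: row_prob_insert_pole)
  next
    case 3
    have ne: "(of_nat y - of_nat x - 1 :: rat) \<noteq> 0" "(of_nat x - of_nat y - 1 :: rat) \<noteq> 0"
      using row_factor_regular(2)[OF 3(1)] row_factor_regular(2)[OF 3(2)] by (auto simp: algebra_simps)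
    have "row_prob (insert x D) y = (of_nat y - of_nat x) / (of_nat y - of_nat x - 1) * row_prob D y"
      "row_prob (insert y D) x = (of_nat x - of_nat y) / (of_nat x - of_nat y - 1) * row_prob D x"
      using D xy 3 by (auto simp: row_prob_insert row_factor_def algebra_simps)
    then have "(of_nat y - of_nat x - 1) * row_prob (insert x D) y = (of_nat y - of_nat x) * row_prob D y"
      "(of_nat x - of_nat y - 1) * row_prob (insert y D) x = (of_nat x - of_nat y) * row_prob D x"
      using ne by simp_all
    then show ?thesis by algebra
  qed
qed

lemma second_difference_identity:
  fixes a b :: rat
  assumes "a \<noteq> 0" "b \<noteq> 0"
  shows "(1 + 1 / a) * (1 + 1 / b) - 2 * (1 + 1 / b) + 1 = (b - a + 1) / (a * b)"
  using assms by (simp add: field_simps)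

text \<open>
  For generic \<open>h\<close> and \<open>z = h - 1\<close>, \<open>K x y\<close> is \<open>row_prob D h\<close> times \<open>(1 - (y - x))/((z - x)(z - y))\<close>, whose
  denominator is symmetric in \<open>x\<close> and \<open>y\<close>; at the poles \<open>h = x + 1\<close> and \<open>h = y + 1\<close> the residues behave in the same way.
\<close>

lemma row_prob_second_difference:
  assumes D: "finite D" "0 \<notin> D" and xy: "x \<notin> D" "y \<notin> D" "x \<noteq> y" "0 < x" "0 < y" and h: "0 < h"
  defines "K \<equiv> \<lambda>u v. row_prob (insert u (insert v D)) h - 2 * row_prob (insert v D) h + row_prob D h"
  shows "(of_nat y - of_nat x + 1) * K x y = (1 - (of_nat y - of_nat x)) * K y x"
proof -
  have pole: "(of_nat v - of_nat u + 1) * K u v = (1 - (of_nat v - of_nat u)) * K v u"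
    if "u \<notin> D" "v \<notin> D" "u \<noteq> v" "0 < u" "h = Suc u" for u v
  proof -
    let ?R = "(\<Prod>d\<in>D. row_factor d h) / of_nat u"
    have v: "Suc v \<noteq> h" using that by auto
    have "row_prob D h = 0" "row_prob (insert u D) h = ?R" "row_prob (insert v D) h = 0"
      using D that by (simp_all add: row_prob_insert_pole)
    moreover have "row_prob (insert v (insert u D)) h = row_factor v h * ?R"
      using D that v by (simp add: row_prob_insert row_prob_insert_pole)
    moreover have "(of_nat u - of_nat v) * row_factor v h = of_nat u - of_nat v + 1"
      using row_factor_regular[OF v] that by (simp add: field_simps)
    ultimately show ?thesis
      unfolding K_def insert_commute[of u v] by algebra
  qed
  consider "h = Suc x" | "h = Suc y" | "Suc x \<noteq> h" "Suc y \<noteq> h" by blast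
  then show ?thesis
  proof cases
    case 1
    then show ?thesis using pole xy by simp
  next
    case 2
    then show ?thesis using pole[of y x] xy by (simp add: algebra_simps)
  next
    case 3
    let ?a = "of_nat h - 1 - of_nat x :: rat" and ?b = "of_nat h - 1 - of_nat y :: rat"
    have ne: "?a \<noteq> 0" "?b \<noteq> 0" using 3 row_factor_regular(2) by blast+
    have "K u v = row_prob D h * (row_factor u h * row_factor v h - 2 * row_factor v h + 1)"
      if "(u, v) \<in> {(x, y), (y, x)}" for u v
      using that D xy 3 h unfolding K_def by (auto simp: row_prob_insert algebra_simps)
    then have K_rf: "K x y = row_prob D h * (row_factor x h * row_factor y h - 2 * row_factor y h + 1)"
      "K y x = row_prob D h * (row_factor y h * row_factor x h - 2 * row_factor x h + 1)" by simp_all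
    then have K: "K x y = row_prob D h * ((1 + 1 / ?a) * (1 + 1 / ?b) - 2 * (1 + 1 / ?b) + 1)"
      "K y x = row_prob D h * ((1 + 1 / ?b) * (1 + 1 / ?a) - 2 * (1 + 1 / ?a) + 1)"
      using row_factor_regular(1)[OF 3(1)] row_factor_regular(1)[OF 3(2)] by simp_all
    have "(1 + 1 / ?a) * (1 + 1 / ?b) - 2 * (1 + 1 / ?b) + 1 = (?b - ?a + 1) / (?a * ?b)"
      "(1 + 1 / ?b) * (1 + 1 / ?a) - 2 * (1 + 1 / ?a) + 1 = (?a - ?b + 1) / (?a * ?b)"
      using second_difference_identity[OF ne] second_difference_identity[OF ne(2,1)]
      by (simp_all only: mult.commute[of ?b ?a])
    then have K': "K x y = row_prob D h * ((?b - ?a + 1) / (?a * ?b))"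
      "K y x = row_prob D h * ((?a - ?b + 1) / (?a * ?b))" using K by simp_all
    have "of_nat y - of_nat x + 1 = ?a - ?b + 1" "1 - (of_nat y - of_nat x) = ?b - ?a + 1" by simp_all
    then show ?thesis unfolding K' by (simp only: mult_ac times_divide_eq_left times_divide_eq_right)
  qed
qed

text \<open>
  The factors \<open>\<delta> + 1\<close> and \<open>\<delta> - 1\<close> with which exchanging \<open>x\<close> and \<open>y\<close> changes \<open>w\<close> and \<open>K\<close> cancel up to the sign.
\<close>

lemma row_prob_column_law:
  assumes D: "finite D" "0 \<notin> D" "finite E" "0 \<notin> E"
    and xy: "x \<notin> D" "y \<notin> D" "x \<notin> E" "y \<notin> E" "x \<noteq> y" "0 < x" "0 < y" and h: "0 < h"
  defines "K \<equiv> \<lambda>u v. row_prob (insert u (insert v E)) h - 2 * row_prob (insert v E) h + row_prob E h"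
    and "w \<equiv> \<lambda>u v. row_prob D u * row_prob (insert u D) v"
  shows "w x y * K x y + w y x * K y x = 0"
proof -
  let ?\<delta> = "of_nat y - of_nat x :: rat"
  have w: "(?\<delta> - 1) * w x y = (?\<delta> + 1) * w y x"
    unfolding w_def by (rule row_prob_swap) (use D xy in auto)
  have K: "(?\<delta> + 1) * K x y = (1 - ?\<delta>) * K y x"
    unfolding K_def by (rule row_prob_second_difference) (use D xy h in auto)
  \<comment> \<open>Multiplying by \<open>(\<delta> - 1) * (\<delta> + 1)\<close> loses the cases \<open>\<delta> = 1\<close> and \<open>\<delta> = -1\<close>, where one of the weights is zero.\<close>
  consider "?\<delta> = 1" | "?\<delta> = -1" | "?\<delta> - 1 \<noteq> 0" "?\<delta> + 1 \<noteq> 0" by (auto simp: algebra_simps)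
  then show ?thesis
  proof cases
    case 3
    have "(?\<delta> - 1) * (?\<delta> + 1) * (w x y * K x y + w y x * K y x) =
        ((?\<delta> - 1) * w x y) * ((?\<delta> + 1) * K x y) + ((?\<delta> + 1) * w y x) * ((?\<delta> - 1) * K y x)"
      by (simp add: algebra_simps)
    also have "\<dots> = 0" unfolding w K by (simp add: algebra_simps)
    finally show ?thesis using 3 by simp
  qed (use w K in simp_all)
qed

text \<open>
  With \<open>z\<close> and \<open>z'\<close> one less than \<open>x\<close> and \<open>y\<close> and \<open>\<delta> = y - x\<close>, the generic value of \<open>Q x y\<close> is
  \<open>row_prob D x * row_prob D y * \<delta>/(\<delta> - 1) * (1 - \<delta>)/((z - v)(z' - v))\<close>, and this is antisymmetric in \<open>x\<close> and \<open>y\<close>.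
  The remaining cases are those of an occupied row (\<open>x\<close> or \<open>y\<close> in \<open>D\<close>, or \<open>x = y\<close>) and those in which \<open>x\<close> or \<open>y\<close> sits at
  a pole: \<open>x\<close> or \<open>y\<close> is \<open>v + 1\<close>, or \<open>x\<close> and \<open>y\<close> are adjacent rows.
\<close>

lemma row_prob_row_law:
  assumes D: "finite D" "0 \<notin> D" "v \<notin> D" "0 < v" and xy: "0 < x" "0 < y"
  defines "Q \<equiv> \<lambda>x y. row_prob (insert v D) x * row_prob (insert x (insert v D)) y
      - 2 * (row_prob (insert v D) x * row_prob (insert x D) y)
      + row_prob D x * row_prob (insert x D) y"
  shows "Q x y + Q y x = 0"
proof -
  let ?f = "\<lambda>h. \<Prod>d\<in>D. row_factor d h"
  have degen: "Q x y + Q y x = 0" if "x \<in> D" for x y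
    using D that by (simp add: Q_def row_prob_occupied insert_absorb)
  have same: "Q x x = 0" for x
    using D by (simp add: Q_def row_prob_occupied)
  have pole: "Q x y + Q y x = 0"
    if "x \<notin> D" "y \<notin> D" "x \<noteq> y" "0 < y" "x = Suc v" for x y
  proof -
    let ?R = "?f x / of_nat v"
    have x0: "row_prob D x = 0" "row_prob (insert v D) x = ?R"
      using D that by (simp_all add: row_prob_insert_pole)
    consider "y = v" | "y = Suc x" | "y \<noteq> v" "y \<noteq> Suc x" by blast
    then show ?thesis
    proof cases
      case 1
      have "row_factor x y = 1 / 2"
        using 1 that by (simp add: row_factor_def)
      then show ?thesis
        unfolding Q_def using D that x0 1
        by (simp add: row_prob_insert row_prob_occupied insert_commute insert_absorb)
    next
      case 2
      have "row_factor v y = 2" using 2 that by (simp add: row_factor_def)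
      moreover have "row_prob D y = 0" "row_prob (insert v D) y = 0"
        using D that 2 by (simp_all add: row_prob_insert_pole)
      moreover have "row_prob (insert x D) y = ?f y / of_nat x"
        using D that 2 by (simp add: row_prob_insert_pole)
      moreover have "row_prob (insert v (insert x D)) y = row_factor v y * (?f y / of_nat x)"
        using D that 2 by (simp add: row_prob_insert row_prob_insert_pole)
      ultimately show ?thesis
        unfolding Q_def insert_commute[of x v] using x0 by simp
    next
      case 3
      have s: "Suc v \<noteq> y" "Suc x \<noteq> y" "Suc y \<noteq> x" using 3 that by auto
      let ?\<delta> = "of_nat y - of_nat x :: rat"
      have ne: "?\<delta> \<noteq> 0" "?\<delta> - 1 \<noteq> 0" "?\<delta> + 1 \<noteq> 0"
        using that row_factor_regular(2)[OF s(2)] row_factor_regular(2)[OF s(3)] by (auto simp: algebra_simps)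
      have f: "row_factor v y = (?\<delta> + 1) / ?\<delta>" "row_factor x y = ?\<delta> / (?\<delta> - 1)"
        "row_factor y x = ?\<delta> / (?\<delta> + 1)"
        using s that ne by (auto simp: row_factor_def divide_simps) (auto simp: algebra_simps)
      have vals: "row_prob (insert x (insert v D)) y = row_factor x y * (row_factor v y * row_prob D y)"
        "row_prob (insert x D) y = row_factor x y * row_prob D y"
        "row_prob (insert v D) y = row_factor v y * row_prob D y"
        "row_prob (insert y (insert v D)) x = row_factor y x * ?R"
        "row_prob (insert y D) x = 0"
        using D that s x0 3 by (simp_all add: row_prob_insert)
      have "Q x y + Q y x = ?R * row_prob D y * (row_factor x y * row_factor v y - 2 * row_factor x y
          + row_factor v y * row_factor y x)"
        unfolding Q_def vals x0 by (simp add: algebra_simps)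
      also have "row_factor x y * row_factor v y - 2 * row_factor x y + row_factor v y * row_factor y x = 0"
        unfolding f using ne by (simp add: divide_simps)
      finally show ?thesis by simp
    qed
  qed
  have step: "Q x y + Q y x = 0"
    if "x \<notin> D" "y = Suc x" "0 < x" "x \<noteq> Suc v" "x \<noteq> v" for x y
  proof -
    have s: "Suc v \<noteq> x" "Suc v \<noteq> y" using that by auto
    have y0: "row_prob D y = 0" "row_prob (insert v D) y = 0"
      using D that by (simp_all add: row_prob_insert_pole)
    have "row_prob (insert x D) y = ?f y / of_nat x"
      "row_prob (insert v (insert x D)) y = row_factor v y * (?f y / of_nat x)"
      "row_prob (insert v D) x = row_factor v x * row_prob D x"
      using D that s by (simp_all add: row_prob_insert row_prob_insert_pole)
    then have "Q x y = row_prob D x * (?f y / of_nat x) * (row_factor v x * row_factor v y - 2 * row_factor v x + 1)"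
      unfolding Q_def insert_commute[of x v] by (simp add: algebra_simps add_divide_distrib diff_divide_distrib)
    also have "row_factor v x * row_factor v y - 2 * row_factor v x + 1 = 0"
    proof -
      let ?c = "of_nat x - of_nat v :: rat"
      have "?c \<noteq> 0" "?c - 1 \<noteq> 0"
        using row_factor_regular(2)[OF s(1)] that by (auto simp: algebra_simps)
      then have "?c / (?c - 1) * ((?c + 1) / ?c) - 2 * (?c / (?c - 1)) + 1 = 0"
        by (simp add: divide_simps)
      moreover have "row_factor v x = ?c / (?c - 1)" "row_factor v y = (?c + 1) / ?c"
        using s that by (simp_all add: row_factor_def algebra_simps)
      ultimately show ?thesis by simp
    qed
    finally show ?thesis unfolding Q_def using y0 by simp
  qed
  have generic: "Q x y + Q y x = 0"
    if "x \<notin> D" "y \<notin> D" "x \<noteq> y" "x \<noteq> Suc v" "y \<noteq> Suc v" "x \<noteq> Suc y" "y \<noteq> Suc x"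
  proof -
    let ?a = "of_nat x - 1 - of_nat v :: rat" and ?b = "of_nat y - 1 - of_nat v :: rat"
    have s: "Suc v \<noteq> x" "Suc v \<noteq> y" "Suc x \<noteq> y" "Suc y \<noteq> x" using that by auto
    have ne: "?a \<noteq> 0" "?b \<noteq> 0" using s row_factor_regular(2) by blast+
    have ne': "of_nat y - 1 - of_nat x \<noteq> (0 :: rat)" "of_nat x - 1 - of_nat y \<noteq> (0 :: rat)"
      using s row_factor_regular(2) by blast+
    have vals: "row_prob (insert v D) x = row_factor v x * row_prob D x"
      "row_prob (insert v D) y = row_factor v y * row_prob D y"
      "row_prob (insert x D) y = row_factor x y * row_prob D y"
      "row_prob (insert y D) x = row_factor y x * row_prob D x"
      using D that s xy by (simp_all add: row_prob_insert)
    have vals': "row_prob (insert v D) z * row_prob (insert z (insert v D)) w =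
        row_factor v z * row_prob D z * (row_factor z w * (row_factor v w * row_prob D w))"
      if "(z, w) \<in> {(x, y), (y, x)}" for z w
    proof (cases "z = v")
      case True
      then show ?thesis using D by (simp add: row_prob_occupied row_factor_def)
    next
      case False
      have zw: "Suc v \<noteq> z" "Suc v \<noteq> w" "Suc z \<noteq> w" "z \<notin> insert v D" "0 < z" "0 < w"
        using that False s xy \<open>x \<notin> D\<close> \<open>y \<notin> D\<close> by auto
      have "row_prob (insert z (insert v D)) w = row_factor z w * row_prob (insert v D) w"
        using D zw by (intro row_prob_insert) auto
      also have "row_prob (insert v D) w = row_factor v w * row_prob D w"
        using D zw by (intro row_prob_insert) auto
      finally show ?thesis using D zw by (simp add: row_prob_insert)
    qed
    have prods: "row_prob (insert v D) x * row_prob (insert x (insert v D)) y =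
        row_factor v x * row_prob D x * (row_factor x y * (row_factor v y * row_prob D y))"
      "row_prob (insert v D) y * row_prob (insert y (insert v D)) x =
        row_factor v y * row_prob D y * (row_factor y x * (row_factor v x * row_prob D x))"
      using vals' by auto
    have f: "row_factor v x = 1 + 1 / ?a" "row_factor v y = 1 + 1 / ?b"
      "row_factor x y = 1 + 1 / (?b - ?a - 1)" "row_factor y x = 1 + 1 / (?a - ?b - 1)"
      using s by (simp_all add: row_factor_regular algebra_simps)
    have ne'': "?b - ?a - 1 \<noteq> 0" "?a - ?b - 1 \<noteq> 0" using ne' by (auto simp: algebra_simps)
    have "Q x y + Q y x = row_prob D x * row_prob D y *
        (row_factor x y * (row_factor v x * row_factor v y - 2 * row_factor v x + 1) +
         row_factor y x * (row_factor v y * row_factor v x - 2 * row_factor v y + 1))"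
      unfolding Q_def prods unfolding vals by (simp add: algebra_simps)
    also have "row_factor x y * (row_factor v x * row_factor v y - 2 * row_factor v x + 1) +
         row_factor y x * (row_factor v y * row_factor v x - 2 * row_factor v y + 1) = 0"
    proof -
      define a b where "a = ?a" and "b = ?b"
      have 1: "row_factor v x * row_factor v y - 2 * row_factor v x + 1 = (a - b + 1) / (a * b)"
        "row_factor v y * row_factor v x - 2 * row_factor v y + 1 = (b - a + 1) / (a * b)"
        using second_difference_identity[OF ne] second_difference_identity[OF ne(2,1)]
        unfolding f a_def[symmetric] b_def[symmetric] by (simp_all only: mult.commute)
      have 2: "row_factor x y = (b - a) / (b - a - 1)" "row_factor y x = (a - b) / (a - b - 1)"
        using ne'' unfolding f a_def[symmetric] b_def[symmetric] by (simp_all add: divide_simps)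
      have 3: "(b - a) / (b - a - 1) * ((a - b + 1) / (a * b)) = - ((b - a) / (a * b))"
        "(a - b) / (a - b - 1) * ((b - a + 1) / (a * b)) = - ((a - b) / (a * b))"
        using ne ne'' unfolding a_def[symmetric] b_def[symmetric]
        by (simp_all add: divide_simps) (simp_all add: algebra_simps)
      show ?thesis unfolding 1 2 3 using ne unfolding a_def[symmetric] b_def[symmetric]
        by (simp add: divide_simps)
    qed
    finally show ?thesis by simp
  qed
  consider "x \<in> D" | "y \<in> D" | "x = y" | "x \<notin> D" "y \<notin> D" "x \<noteq> y" "x = Suc v"
    | "x \<notin> D" "y \<notin> D" "x \<noteq> y" "y = Suc v"
    | "x \<notin> D" "y = Suc x" "x \<noteq> Suc v" "y \<noteq> Suc v" | "y \<notin> D" "x = Suc y" "x \<noteq> Suc v" "y \<noteq> Suc v"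
    | "x \<notin> D" "y \<notin> D" "x \<noteq> y" "x \<noteq> Suc v" "y \<noteq> Suc v" "x \<noteq> Suc y" "y \<noteq> Suc x"
    by blast
  then show ?thesis
  proof cases
    case 1
    then show ?thesis by (rule degen)
  next
    case 2
    then show ?thesis using degen[of y x] by simp
  next
    case 3
    then show ?thesis using same by simp
  next
    case 4
    then show ?thesis using pole[of x y] xy by simp
  next
    case 5
    then show ?thesis using pole[of y x] xy by simp
  next
    case 6
    then show ?thesis using step[of x y] xy by auto
  next
    case 7
    then show ?thesis using step[of y x] xy by auto
  next
    case 8
    then show ?thesis by (rule generic)
  qed
qed


section \<open>Modular laws for random fillings\<close>

text \<open>
  A filling \<open>\<rho>\<close> assigns a row to each vertex.  Rows up to \<open>n\<close> suffice, as a new box is at most one row above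
  the rows in use.
\<close>

definition rows_prob :: "nat \<Rightarrow> nat \<Rightarrow> (nat \<Rightarrow> nat) \<Rightarrow> (nat \<Rightarrow> nat) \<Rightarrow> rat" where
  "rows_prob a n m \<rho> = (\<Prod>i\<in>{a..n}. row_prob (\<rho> ` {i<..m i}) (\<rho> i))"

abbreviation fillings :: "nat \<Rightarrow> nat \<Rightarrow> (nat \<Rightarrow> nat) set" where
  "fillings a n \<equiv> {a..n} \<rightarrow>\<^sub>E {1..n}"

lemma finite_fillings [simp]: "finite (fillings a n)"
  by (simp add: finite_PiE)

definition tab_sum :: "nat \<Rightarrow> nat \<Rightarrow> (nat \<Rightarrow> nat) \<Rightarrow> ((nat \<Rightarrow> nat) \<Rightarrow> rat symfun) \<Rightarrow> rat symfun" where
  "tab_sum a n m \<Phi> = (\<Sum>\<rho>\<in>fillings a n. sf_scale (rows_prob a n m \<rho>) (\<Phi> \<rho>))"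

lemma rows_prob_nonneg: "0 \<le> rows_prob a n m \<rho>"
  by (simp add: rows_prob_def prod_nonneg row_prob_nonneg)

lemma fillings_swap:
  "b \<in> {a..n} \<Longrightarrow> c \<in> {a..n} \<Longrightarrow> \<rho> \<in> fillings a n \<Longrightarrow> \<rho> \<circ> transpose b c \<in> fillings a n"
  by (auto simp: PiE_iff extensional_def transpose_def split: if_splits)

lemma sum_antisymmetric_zero:
  fixes Q :: "(nat \<Rightarrow> nat) \<Rightarrow> rat"
  assumes "b \<in> {a..n}" "c \<in> {a..n}"
    and anti: "\<And>\<rho>. \<rho> \<in> fillings a n \<Longrightarrow> Q \<rho> + Q (\<rho> \<circ> transpose b c) = 0"
    and sym: "\<And>\<rho>. \<Phi> (\<rho> \<circ> transpose b c) = \<Phi> \<rho>"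
  shows "(\<Sum>\<rho>\<in>fillings a n. sf_scale (Q \<rho>) (\<Phi> \<rho>)) = (0 :: rat symfun)"
proof -
  let ?S = "\<Sum>\<rho>\<in>fillings a n. sf_scale (Q \<rho>) (\<Phi> \<rho>)"
  have "?S = (\<Sum>\<rho>\<in>fillings a n. sf_scale (Q (\<rho> \<circ> transpose b c)) (\<Phi> (\<rho> \<circ> transpose b c)))"
    by (rule sum.reindex_bij_witness[of _ "\<lambda>\<rho>. \<rho> \<circ> transpose b c" "\<lambda>\<rho>. \<rho> \<circ> transpose b c"])
      (use assms(1,2) fillings_swap[of b a n c] in \<open>auto simp: comp_assoc\<close>)
  also have "\<dots> = (\<Sum>\<rho>\<in>fillings a n. - sf_scale (Q \<rho>) (\<Phi> \<rho>))"
  proof (rule sum.cong)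
    fix \<rho> assume "\<rho> \<in> fillings a n"
    then have "Q (\<rho> \<circ> transpose b c) = - Q \<rho>" using anti[of \<rho>] by simp
    then show "sf_scale (Q (\<rho> \<circ> transpose b c)) (\<Phi> (\<rho> \<circ> transpose b c)) = - sf_scale (Q \<rho>) (\<Phi> \<rho>)"
      by (simp add: sym)
  qed simp
  finally have "?S = - ?S" by (simp add: sum_negf)
  moreover have "f = 0" if "f = - f" for f :: "rat symfun"
  proof (rule symfun_eqI)
    fix x
    have "sf_coeff f x = - sf_coeff f x" using that by (metis uminus_symfun.rep_eq)
    then show "sf_coeff f x = sf_coeff 0 x" by simp
  qed
  ultimately show ?thesis by blast
qed

lemma swap_image:
  assumes "b \<in> S \<longleftrightarrow> c \<in> S" shows "(\<rho> \<circ> transpose b c) ` S = \<rho> ` S"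
proof -
  have "transpose b c ` S = S" using assms by simp
  then show ?thesis by (metis image_comp)
qed

lemma rows_prob_split:
  assumes "finite T" "T \<subseteq> {a..n}"
  shows "rows_prob a n m \<rho> = (\<Prod>i\<in>T. row_prob (\<rho> ` {i<..m i}) (\<rho> i)) *
    (\<Prod>i\<in>{a..n} - T. row_prob (\<rho> ` {i<..m i}) (\<rho> i))"
  unfolding rows_prob_def using assms by (subst prod.subset_diff[of T]) (auto simp: mult.commute)

text \<open>
  The rows of \<open>q\<close>, \<open>q - 1\<close> and \<open>t\<close> contribute \<open>?w\<close> and \<open>?K\<close>; the product \<open>R\<close> of the other probabilities is unchanged when the
  rows of \<open>q - 1\<close> and \<open>q\<close> are exchanged, because these two belong to the same of the sets \<open>{i<..m i}\<close>.
  If the rows of \<open>q - 1\<close> and \<open>q\<close> are not distinct from each other and from the neighbouring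
  rows, then all probabilities vanish.
\<close>

lemma rows_prob_column_law:
  assumes hm: "hess_on a n m" and t: "a \<le> t" "t + 2 \<le> q" "q \<le> n" "m t = q" "m (q - 1) = m q"
    and below: "\<And>u. a \<le> u \<Longrightarrow> u < t \<Longrightarrow> m u \<le> q - 2" and above: "\<And>u. t < u \<Longrightarrow> u \<le> n \<Longrightarrow> q \<le> m u"
    and \<rho>: "\<rho> \<in> fillings a n"
  defines "Q \<equiv> \<lambda>\<rho>. rows_prob a n m \<rho> - 2 * rows_prob a n (m(t := q - 1)) \<rho> + rows_prob a n (m(t := q - 2)) \<rho>"
  shows "Q \<rho> + Q (\<rho> \<circ> transpose (q - 1) q) = 0"
proof -
  define r where "r = q - 1"
  have r: "q = Suc r" "t < r" "a < r" "q - 2 = r - 1" using t by (auto simp: r_def)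
  define D where "D = \<rho> ` {q<..m q}"
  define E where "E = \<rho> ` {t<..r - 1}"
  define R where "R \<rho> = (\<Prod>i\<in>{a..n} - {t, r, q}. row_prob (\<rho> ` {i<..m i}) (\<rho> i))" for \<rho>
  \<comment> \<open>\<open>u\<close> and \<open>v\<close> are the rows of \<open>q\<close> and \<open>q - 1\<close>; of these two vertices \<open>q\<close> arrives first.\<close>
  let ?K = "\<lambda>u v. row_prob (insert u (insert v E)) (\<rho> t) - 2 * row_prob (insert v E) (\<rho> t) + row_prob E (\<rho> t)"
  let ?w = "\<lambda>u v. row_prob D u * row_prob (insert u D) v"
  have mq: "q \<le> m q" "m q \<le> n" using hess_onD[OF hm, of q] t by auto
  have int: "{r<..m q} = insert q {q<..m q}" "{t<..q} = insert q (insert r {t<..r - 1})"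
    "{t<..r} = insert r {t<..r - 1}" using r mq by auto
  have sub: "{t, r, q} \<subseteq> {a..n}" using r t by auto
  have formula: "Q \<rho>' = ?w (\<rho>' q) (\<rho>' r) * ?K (\<rho>' q) (\<rho>' r) * R \<rho>'"
    if "\<rho>' ` {q<..m q} = D" "\<rho>' ` {t<..r - 1} = E" "\<rho>' t = \<rho> t" for \<rho>'
  proof -
    have "rows_prob a n (m(t := c)) \<rho>' = row_prob (\<rho>' ` {t<..c}) (\<rho> t) * ?w (\<rho>' q) (\<rho>' r) * R \<rho>'" for c
    proof -
      have "(\<Prod>i\<in>{t, r, q}. row_prob (\<rho>' ` {i<..(m(t := c)) i}) (\<rho>' i)) =
          row_prob (\<rho>' ` {t<..c}) (\<rho> t) * ?w (\<rho>' q) (\<rho>' r)"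
        using r t(5) that int by (simp add: r_def[symmetric])
      moreover have "(\<Prod>i\<in>{a..n} - {t, r, q}. row_prob (\<rho>' ` {i<..(m(t := c)) i}) (\<rho>' i)) = R \<rho>'"
        unfolding R_def by (intro prod.cong) auto
      ultimately show ?thesis by (subst rows_prob_split[OF _ sub]) simp_all
    qed
    note this[of q] this[of r] this[of "r - 1"]
    moreover have "m(t := q) = m" using t by auto
    ultimately show ?thesis
      unfolding Q_def r_def[symmetric] r(4) using int that by (simp add: algebra_simps)
  qed
  have inv: "R (\<rho> \<circ> transpose r q) = R \<rho>"
    unfolding R_def
  proof (rule prod.cong)
    fix i assume i: "i \<in> {a..n} - {t, r, q}"
    have "r \<in> {i<..m i} \<longleftrightarrow> q \<in> {i<..m i}"
      using i below[of i] above[of i] r by (cases "i < t") auto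
    then show "row_prob ((\<rho> \<circ> transpose r q) ` {i<..m i}) ((\<rho> \<circ> transpose r q) i) = row_prob (\<rho> ` {i<..m i}) (\<rho> i)"
      using i by (simp only: swap_image) simp
  qed simp
  have tr: "(\<rho> \<circ> transpose r q) q = \<rho> r" "(\<rho> \<circ> transpose r q) r = \<rho> q" "(\<rho> \<circ> transpose r q) t = \<rho> t"
    "(\<rho> \<circ> transpose r q) ` {q<..m q} = D" "(\<rho> \<circ> transpose r q) ` {t<..r - 1} = E"
    using r by (simp, simp, simp) (unfold D_def E_def, (rule swap_image; use r in auto)+)
  have "Q \<rho> + Q (\<rho> \<circ> transpose r q) =
      (?w (\<rho> q) (\<rho> r) * ?K (\<rho> q) (\<rho> r) + ?w (\<rho> r) (\<rho> q) * ?K (\<rho> r) (\<rho> q)) * R \<rho>"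
    using formula[of \<rho>] formula[of "\<rho> \<circ> transpose r q"] by (simp only: tr inv D_def[symmetric] E_def[symmetric]) (simp add: algebra_simps)
  also have "\<dots> = 0"
  proof -
    have fin: "finite D" "finite E" by (auto simp: D_def E_def)
    have pos: "0 < \<rho> i" if "i \<in> {a..n}" for i using \<rho> that by (auto simp: PiE_iff Suc_le_eq)
    have avoid: "0 \<notin> \<rho> ` S" if "S \<subseteq> {a..n}" for S
      using pos that by (metis imageE less_irrefl subsetD)
    have pos': "0 \<notin> D" "0 \<notin> E"
      unfolding D_def E_def using r t mq by (intro avoid; auto)+
    have E0: "R \<rho> = 0" if inE: "\<rho> q \<in> E \<or> \<rho> r \<in> E"
    proof -
      obtain i where "i \<in> {t<..r - 1}" "\<rho> i = \<rho> q \<or> \<rho> i = \<rho> r"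
        using inE unfolding E_def by (metis imageE)
      then have i: "t < i" "i < r" "\<rho> i = \<rho> q \<or> \<rho> i = \<rho> r" using r by auto
      then have "\<rho> i \<in> \<rho> ` {i<..m i}" using above[of i] r t by auto
      then have "row_prob (\<rho> ` {i<..m i}) (\<rho> i) = 0" by (intro row_prob_occupied) auto
      moreover have "i \<in> {a..n} - {t, r, q}" using i r t by auto
      ultimately show ?thesis unfolding R_def by (intro prod_zero) auto
    qed
    consider "\<rho> q \<in> E \<or> \<rho> r \<in> E" | "\<rho> q = \<rho> r \<or> \<rho> q \<in> D \<or> \<rho> r \<in> D"
      | "\<rho> q \<notin> E" "\<rho> r \<notin> E" "\<rho> q \<noteq> \<rho> r" "\<rho> q \<notin> D" "\<rho> r \<notin> D" by blast
    then show ?thesis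
    proof cases
      case 1
      then show ?thesis using E0 by simp
    next
      case 2
      then have "?w (\<rho> q) (\<rho> r) = 0" "?w (\<rho> r) (\<rho> q) = 0"
        using fin by (auto simp: row_prob_occupied)
      then show ?thesis by (simp only: mult_zero_left add_0_left)
    next
      case 3
      then show ?thesis
        using row_prob_column_law[OF fin(1) pos'(1) fin(2) pos'(2), of "\<rho> q" "\<rho> r" "\<rho> t"] pos r t by simp
    qed
  qed
  finally show ?thesis by (simp add: r_def)
qed

text \<open>
  As before, with the rows of \<open>s\<close> and \<open>s + 1\<close> exchanged.  The role of \<open>v\<close> is played by the row of \<open>q\<close>.
\<close>

lemma rows_prob_row_law:
  assumes hm: "hess_on a n m" and s: "a < s" "s + 2 \<le> q" "q \<le> n" "m s = q" "m (Suc s) = q"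
    and below: "\<And>u. a \<le> u \<Longrightarrow> u < s \<Longrightarrow> m u \<noteq> s"
    and \<rho>: "\<rho> \<in> fillings a n"
  defines "Q \<equiv> \<lambda>\<rho>. rows_prob a n m \<rho> - 2 * rows_prob a n (m(s := q - 1)) \<rho> + rows_prob a n (m(s := q - 1, Suc s := q - 1)) \<rho>"
  shows "Q \<rho> + Q (\<rho> \<circ> transpose s (Suc s)) = 0"
proof -
  define r where "r = q - 1"
  have r: "q = Suc r" "Suc s \<le> r" using s by (auto simp: r_def)
  define D where "D = \<rho> ` {Suc s<..r}"
  define R where "R \<rho> = (\<Prod>i\<in>{a..n} - {s, Suc s}. row_prob (\<rho> ` {i<..m i}) (\<rho> i))" for \<rho>
  let ?v = "\<rho> q"
  let ?q = "\<lambda>x y. row_prob (insert ?v D) x * row_prob (insert x (insert ?v D)) y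
      - 2 * (row_prob (insert ?v D) x * row_prob (insert x D) y)
      + row_prob D x * row_prob (insert x D) y"
  have int: "{s<..r} = insert (Suc s) {Suc s<..r}" "{s<..q} = insert (Suc s) (insert q {Suc s<..r})"
    "{Suc s<..q} = insert q {Suc s<..r}" using r by auto
  have sub: "{s, Suc s} \<subseteq> {a..n}" using r s by auto
  have formula: "Q \<rho>' = ?q (\<rho>' (Suc s)) (\<rho>' s) * R \<rho>'"
    if "\<rho>' ` {Suc s<..r} = D" "\<rho>' q = ?v" for \<rho>'
  proof -
    have "rows_prob a n (m(s := c, Suc s := d)) \<rho>' =
        row_prob (\<rho>' ` {s<..c}) (\<rho>' s) * row_prob (\<rho>' ` {Suc s<..d}) (\<rho>' (Suc s)) * R \<rho>'" for c d
    proof -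
      have "(\<Prod>i\<in>{a..n} - {s, Suc s}. row_prob (\<rho>' ` {i<..(m(s := c, Suc s := d)) i}) (\<rho>' i)) = R \<rho>'"
        unfolding R_def by (intro prod.cong) auto
      then show ?thesis by (subst rows_prob_split[OF _ sub]) simp_all
    qed
    note this[of q q] this[of r q] this[of r r]
    moreover have "m(s := q, Suc s := q) = m" "m(s := r, Suc s := q) = m(s := r)" using s by auto
    ultimately show ?thesis
      unfolding Q_def r_def[symmetric] using int that by (simp add: algebra_simps)
  qed
  have inv: "R (\<rho> \<circ> transpose s (Suc s)) = R \<rho>"
    unfolding R_def
  proof (rule prod.cong)
    fix i assume i: "i \<in> {a..n} - {s, Suc s}"
    have "s \<in> {i<..m i} \<longleftrightarrow> Suc s \<in> {i<..m i}"
      using i below[of i] by (cases "i < s") auto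
    then show "row_prob ((\<rho> \<circ> transpose s (Suc s)) ` {i<..m i}) ((\<rho> \<circ> transpose s (Suc s)) i) = row_prob (\<rho> ` {i<..m i}) (\<rho> i)"
      using i by (simp only: swap_image) simp
  qed simp
  have tr: "(\<rho> \<circ> transpose s (Suc s)) (Suc s) = \<rho> s" "(\<rho> \<circ> transpose s (Suc s)) s = \<rho> (Suc s)" "(\<rho> \<circ> transpose s (Suc s)) q = ?v"
    "(\<rho> \<circ> transpose s (Suc s)) ` {Suc s<..r} = D"
    using r by (simp, simp, simp) (unfold D_def, rule swap_image, simp)
  have "Q \<rho> + Q (\<rho> \<circ> transpose s (Suc s)) = (?q (\<rho> (Suc s)) (\<rho> s) + ?q (\<rho> s) (\<rho> (Suc s))) * R \<rho>"
    using formula[of \<rho>] formula[of "\<rho> \<circ> transpose s (Suc s)"]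
    by (simp only: tr inv D_def[symmetric]) (simp add: algebra_simps)
  also have "\<dots> = 0"
  proof (cases "?v \<in> D")
    case True
    then obtain i where i: "Suc s < i" "i \<le> r" "\<rho> i = ?v" by (auto simp: D_def)
    then have "q \<le> m i" using hess_on_mono[OF hm, of "Suc s" i] s r by simp
    then have "\<rho> i \<in> \<rho> ` {i<..m i}" using i r by auto
    then have "row_prob (\<rho> ` {i<..m i}) (\<rho> i) = 0" by (intro row_prob_occupied) auto
    moreover have "i \<in> {a..n} - {s, Suc s}" using i r s by auto
    ultimately have "R \<rho> = 0" unfolding R_def by (intro prod_zero) auto
    then show ?thesis by simp
  next
    case False
    have pos: "0 < \<rho> i" if "i \<in> {a..n}" for i using \<rho> that by (auto simp: PiE_iff Suc_le_eq)
    have avoid: "0 \<notin> \<rho> ` S" if "S \<subseteq> {a..n}" for S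
      using pos that by (metis imageE less_irrefl subsetD)
    have "0 \<notin> D" unfolding D_def using r s by (intro avoid) auto
    then show ?thesis
      using row_prob_row_law[of D ?v "\<rho> (Suc s)" "\<rho> s"] False pos r s by (simp add: D_def)
  qed
  finally show ?thesis .
qed

lemma tab_sum_second_difference:
  assumes "b \<in> {a..n}" "c \<in> {a..n}"
    and "\<And>\<rho>. \<rho> \<in> fillings a n \<Longrightarrow>
      rows_prob a n m \<rho> - 2 * rows_prob a n m' \<rho> + rows_prob a n m'' \<rho> +
      (rows_prob a n m (\<rho> \<circ> transpose b c) - 2 * rows_prob a n m' (\<rho> \<circ> transpose b c) +
        rows_prob a n m'' (\<rho> \<circ> transpose b c)) = 0"
    and "\<And>\<rho>. \<Phi> (\<rho> \<circ> transpose b c) = \<Phi> \<rho>"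
  shows "tab_sum a n m \<Phi> + tab_sum a n m'' \<Phi> = tab_sum a n m' \<Phi> + tab_sum a n m' \<Phi>"
proof -
  have "(\<Sum>\<rho>\<in>fillings a n. sf_scale (rows_prob a n m \<rho> - 2 * rows_prob a n m' \<rho> + rows_prob a n m'' \<rho>) (\<Phi> \<rho>)) = 0"
    by (rule sum_antisymmetric_zero[where b = b and c = c and \<Phi> = \<Phi> and Q =
        "\<lambda>\<rho>. rows_prob a n m \<rho> - 2 * rows_prob a n m' \<rho> + rows_prob a n m'' \<rho>"]) (fact assms)+
  also have "(\<Sum>\<rho>\<in>fillings a n. sf_scale (rows_prob a n m \<rho> - 2 * rows_prob a n m' \<rho> + rows_prob a n m'' \<rho>) (\<Phi> \<rho>)) =
      tab_sum a n m \<Phi> - (tab_sum a n m' \<Phi> + tab_sum a n m' \<Phi>) + tab_sum a n m'' \<Phi>"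
  proof -
    have "sf_scale (x - 2 * y + z) f = sf_scale x f - (sf_scale y f + sf_scale y f) + sf_scale z f" for x y z and f :: "rat symfun"
    proof -
      have "sf_scale (2 * y) f = sf_scale y f + sf_scale y f"
        by (simp only: mult_2 symfun.scale_left_distrib)
      then show ?thesis by (simp only: symfun.scale_left_distrib symfun.scale_left_diff_distrib)
    qed
    then show ?thesis unfolding tab_sum_def by (simp only: sum.distrib sum_subtractf)
  qed
  finally show ?thesis by (simp only: diff_add_eq right_minus_eq eq_iff_diff_eq_0[symmetric])
qed


section \<open>Newton's identities\<close>

text \<open>
  For \<open>c n = n\<close> these are the \<open>\<omega>(p\<^sub>n)\<close>, and for \<open>c n = [n]\<^sub>q\<close> the \<open>\<omega>(\<rho>\<^sub>n)\<close>.
\<close>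

function newton :: "(nat \<Rightarrow> 'a :: comm_ring_1) \<Rightarrow> nat \<Rightarrow> 'a symfun" where
  "newton c n = sf_scale (c n) (sf_e n) - (\<Sum>i\<in>{1..<n}. sf_e (n - i) * newton c i)"
  by auto
termination by (relation "measure snd") auto

declare newton.simps [simp del]

lemma newton_recursion:
  assumes "1 \<le> n"
  shows "(\<Sum>i=1..n. sf_e (n - i) * newton c i) = sf_scale (c n) (sf_e n)"
proof -
  have "(\<Sum>i=1..n. sf_e (n - i) * newton c i) = (\<Sum>i\<in>{1..<n}. sf_e (n - i) * newton c i) + newton c n"
    using assms by (cases n) (simp_all add: atLeastLessThanSuc_atLeastAtMost)
  then show ?thesis using newton.simps[of c n] by simp
qed

section \<open>Symmetric functions attached to fillings\<close>

definition row_count :: "nat \<Rightarrow> nat \<Rightarrow> (nat \<Rightarrow> nat) \<Rightarrow> nat \<Rightarrow> nat" where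
  "row_count a n \<rho> x = card {i \<in> {a..n}. \<rho> i = x}"

text \<open>
  If \<open>\<kappa> x\<close> is the length of row \<open>x\<close> of a Young diagram, then \<open>\<kappa> x - \<kappa> (x + 1)\<close> is the number of columns of height \<open>x\<close>.  One
  column of height \<open>h\<close> is left out; \<open>h = 0\<close> keeps all columns.
\<close>

definition column_prod :: "nat \<Rightarrow> (nat \<Rightarrow> nat) \<Rightarrow> nat \<Rightarrow> rat symfun" where
  "column_prod n \<kappa> h = (\<Prod>x\<in>{1..n}. sf_scale (fact x) (sf_e x) ^ (\<kappa> x - \<kappa> (Suc x) - (if x = h then 1 else 0)))"

text \<open>
  The marked column has height \<open>h\<close> and weight \<open>h! e\<^sub>h\<close>; taking out \<open>h e\<^sub>h\<close> leaves \<open>(h - 1)!\<close>.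
\<close>

definition tab_marked :: "nat \<Rightarrow> nat \<Rightarrow> (nat \<Rightarrow> nat) \<Rightarrow> nat \<Rightarrow> rat symfun" where
  "tab_marked a n m h = tab_sum a n m (\<lambda>\<rho>.
     if \<rho> a = h then sf_scale (fact (h - 1)) (column_prod n (row_count a n \<rho>) h) else 0)"

definition tab_total :: "nat \<Rightarrow> nat \<Rightarrow> (nat \<Rightarrow> nat) \<Rightarrow> rat symfun" where
  "tab_total a n m = tab_sum a n m (\<lambda>\<rho>. column_prod n (row_count a n \<rho>) 0)"

lemma row_count_swap:
  assumes "b \<in> {a..n}" "c \<in> {a..n}"
  shows "row_count a n (\<rho> \<circ> transpose b c) = row_count a n \<rho>"
proof
  fix x
  have "bij_betw (transpose b c) {i \<in> {a..n}. (\<rho> \<circ> transpose b c) i = x} {i \<in> {a..n}. \<rho> i = x}"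
  proof (rule bij_betw_byWitness[of _ "transpose b c"])
    show "transpose b c ` {i \<in> {a..n}. (\<rho> \<circ> transpose b c) i = x} \<subseteq> {i \<in> {a..n}. \<rho> i = x}"
      "transpose b c ` {i \<in> {a..n}. \<rho> i = x} \<subseteq> {i \<in> {a..n}. (\<rho> \<circ> transpose b c) i = x}"
      using assms by (auto simp: transpose_def)
  qed auto
  then show "row_count a n (\<rho> \<circ> transpose b c) x = row_count a n \<rho> x"
    unfolding row_count_def by (rule bij_betw_same_card)
qed

lemma row_count_insert:
  assumes "a \<le> n"
  shows "row_count a n (\<rho>(a := h)) = (row_count (Suc a) n \<rho>)(h := Suc (row_count (Suc a) n \<rho> h))"
proof
  fix x
  have *: "{i \<in> {a..n}. (\<rho>(a := h)) i = x} =
      (if x = h then insert a {i \<in> {Suc a..n}. \<rho> i = x} else {i \<in> {Suc a..n}. \<rho> i = x})"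
    using assms by auto
  show "row_count a n (\<rho>(a := h)) x = ((row_count (Suc a) n \<rho>)(h := Suc (row_count (Suc a) n \<rho> h))) x"
    unfolding row_count_def * by simp
qed

lemma row_count_Suc:
  assumes "a \<le> n"
  shows "row_count a n \<rho> x = row_count (Suc a) n \<rho> x + (if \<rho> a = x then 1 else 0)"
  using row_count_insert[OF assms, of \<rho> "\<rho> a"] by auto

lemma row_count_append:
  assumes "a \<le> Suc b" "b \<le> n"
  shows "row_count a n \<rho> x = row_count a b \<rho> x + row_count (Suc b) n \<rho> x"
proof -
  have "{i \<in> {a..n}. \<rho> i = x} = {i \<in> {a..b}. \<rho> i = x} \<union> {i \<in> {Suc b..n}. \<rho> i = x}"
    using assms by auto
  then show ?thesis unfolding row_count_def by (simp add: card_Un_disjoint disjoint_iff)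
qed

lemma rows_prob_Suc:
  assumes "a \<le> n"
  shows "rows_prob a n m \<rho> = row_prob (\<rho> ` {a<..m a}) (\<rho> a) * rows_prob (Suc a) n m \<rho>"
proof -
  have "{a..n} = insert a {Suc a..n}" using assms by auto
  then show ?thesis unfolding rows_prob_def by simp
qed

lemma rows_prob_nonzero_tail:
  assumes "rows_prob a n m \<rho> \<noteq> 0" "a \<le> b"
  shows "rows_prob b n m \<rho> \<noteq> 0"
  using assms by (auto simp: rows_prob_def)

text \<open>
  With positive probability the boxes form a Young diagram at every stage, and the last box ends its column.  The
  new box in row \<open>h > 1\<close> needs a neighbour in row \<open>h - 1\<close> and no neighbour in row \<open>h\<close>.  The vertices beyond the
  neighbours form a diagram already, so row \<open>h - 1\<close> is strictly longer than row \<open>h\<close> before the box is added.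
\<close>

lemma rows_prob_shape:
  assumes "hess_on a n m" "rows_prob a n m \<rho> \<noteq> 0" "\<And>i. i \<in> {a..n} \<Longrightarrow> 0 < \<rho> i"
    and "a \<le> n"
  shows "row_count a n \<rho> (Suc (\<rho> a)) < row_count a n \<rho> (\<rho> a)"
proof -
  have "(\<forall>x>0. row_count a n \<rho> (Suc x) \<le> row_count a n \<rho> x) \<and>
      (a \<le> n \<longrightarrow> row_count a n \<rho> (Suc (\<rho> a)) < row_count a n \<rho> (\<rho> a))"
    using assms(1-3)
  proof (induction "Suc n - a" arbitrary: a rule: less_induct)
    case less
    show ?case
    proof (cases "a \<le> n")
      case False
      then show ?thesis by (simp add: row_count_def)
    next
      case True
      have tail: "\<forall>x>0. row_count b n \<rho> (Suc x) \<le> row_count b n \<rho> x" if "a < b" for b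
        using less.hyps[of b] less.prems that True rows_prob_nonzero_tail[of a n m \<rho> b]
        by (force simp: hess_on_def)
      define h where "h = \<rho> a"
      have h: "0 < h" using less.prems(3)[of a] True by (simp add: h_def)
      have "row_prob (\<rho> ` {a<..m a}) h \<noteq> 0"
        using less.prems(2) rows_prob_Suc[OF True, of m \<rho>] by (auto simp: h_def)
      then have D: "h \<notin> \<rho> ` {a<..m a}" "h = 1 \<or> h - 1 \<in> \<rho> ` {a<..m a}"
        by (rule row_prob_nonzeroD, simp)+
      have cnt: "row_count a n \<rho> x = row_count (Suc a) n \<rho> x + (if h = x then 1 else 0)" for x
        using row_count_Suc[OF True] by (simp add: h_def)
      have key: "row_count (Suc a) n \<rho> h < row_count (Suc a) n \<rho> (h - 1)" if ne: "h \<noteq> 1"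
      proof -
        have ma: "a \<le> m a" "m a \<le> n" using hess_onD[OF less.prems(1), of a] True by auto
        obtain i where i: "i \<in> {a<..m a}" "\<rho> i = h - 1" using D(2) ne by (metis imageE)
        have "row_count (Suc a) (m a) \<rho> h = 0"
          using D(1) by (force simp: row_count_def)
        moreover have "0 < row_count (Suc a) (m a) \<rho> (h - 1)"
          using i by (auto simp: row_count_def card_gt_0_iff)
        moreover have "row_count (Suc (m a)) n \<rho> h \<le> row_count (Suc (m a)) n \<rho> (h - 1)"
          using tail[of "Suc (m a)"] ma h ne by (cases h) auto
        ultimately show ?thesis
          using row_count_append[of "Suc a" "m a" n \<rho>] ma by simp
      qed
      show ?thesis
      proof (intro conjI allI impI)
        fix x :: nat assume x: "0 < x"
        then have "row_count (Suc a) n \<rho> (Suc x) \<le> row_count (Suc a) n \<rho> x" using tail by simp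
        then show "row_count a n \<rho> (Suc x) \<le> row_count a n \<rho> x"
          using key x unfolding cnt by (cases "h = Suc x") auto
      next
        show "row_count a n \<rho> (Suc (\<rho> a)) < row_count a n \<rho> (\<rho> a)"
          using tail[of "Suc a"] h unfolding cnt h_def[symmetric] by (simp add: less_Suc_eq_le)
      qed
    qed
  qed
  then show ?thesis using assms(4) by blast
qed

lemma rows_prob_bound:
  assumes "hess_on a n m" "rows_prob a n m \<rho> \<noteq> 0" "a \<le> n"
  shows "\<rho> a \<le> Suc n - a"
  using assms
proof (induction "n - a" arbitrary: a rule: less_induct)
  case less
  have "row_prob (\<rho> ` {a<..m a}) (\<rho> a) \<noteq> 0"
    using less.prems rows_prob_Suc[of a n m \<rho>] by auto
  then consider "\<rho> a = 1" | i where "i \<in> {a<..m a}" "\<rho> a - 1 = \<rho> i"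
    using row_prob_nonzeroD(2)[of "\<rho> ` {a<..m a}" "\<rho> a"] by blast
  then show ?case
  proof cases
    case 2
    moreover have "m a \<le> n" using hess_onD[of a n m a] less.prems by simp
    ultimately have "\<rho> i \<le> Suc n - i"
      using less.hyps[of i] less.prems rows_prob_nonzero_tail[of a n m \<rho> i] by (force simp: hess_on_def)
    then show ?thesis using 2 \<open>m a \<le> n\<close> by auto
  qed (use less.prems in auto)
qed

lemma column_prod_remove:
  assumes "h \<in> {1..n}" "\<kappa> (Suc h) < \<kappa> h"
  shows "column_prod n \<kappa> 0 = sf_scale (fact h) (sf_e h * column_prod n \<kappa> h)"
proof -
  let ?E = "\<lambda>x. sf_scale (fact x) (sf_e x) :: rat symfun"
  obtain k where k: "\<kappa> h - \<kappa> (Suc h) = Suc k" using assms by (metis less_imp_Suc_add diff_Suc_Suc add_diff_cancel_left' add_Suc_right)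
  have "column_prod n \<kappa> 0 = ?E h ^ Suc k * (\<Prod>x\<in>{1..n} - {h}. ?E x ^ (\<kappa> x - \<kappa> (Suc x)))"
    unfolding column_prod_def using assms
    by (subst prod.remove[of _ h]) (auto simp: k[simplified] intro!: arg_cong2[of _ _ _ _ "(*)"] prod.cong)
  moreover have "column_prod n \<kappa> h = ?E h ^ k * (\<Prod>x\<in>{1..n} - {h}. ?E x ^ (\<kappa> x - \<kappa> (Suc x)))"
    unfolding column_prod_def using assms
    by (subst prod.remove[of _ h]) (auto simp: k[simplified] intro!: arg_cong2[of _ _ _ _ "(*)"] prod.cong)
  ultimately show ?thesis by (simp add: sf_scale_mult_left mult.assoc)
qed

lemma column_prod_first_row:
  "column_prod n (\<kappa>(1 := Suc (\<kappa> 1))) 1 = column_prod n \<kappa> 0"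
  unfolding column_prod_def by (intro prod.cong) auto

text \<open>
  Raising a column from height \<open>d\<close> to \<open>d + 1\<close> does not change the other columns.
\<close>

lemma column_prod_next_row:
  assumes "0 < d"
  shows "column_prod n (\<kappa>(Suc d := Suc (\<kappa> (Suc d)))) (Suc d) = column_prod n \<kappa> d"
  unfolding column_prod_def by (intro prod.cong) auto

lemma fillings_pos: "\<rho> \<in> fillings a n \<Longrightarrow> i \<in> {a..n} \<Longrightarrow> 0 < \<rho> i"
  by (auto simp: PiE_iff Suc_le_eq)

text \<open>
  Putting the marked column back multiplies by \<open>h e\<^sub>h\<close>, as \<open>h (h - 1)! = h!\<close>.
\<close>

lemma tab_sum_weighted_total:
  assumes hm: "hess_on a n m" and "a \<le> n"
  shows "tab_sum a n m (\<lambda>\<rho>. sf_scale (c (\<rho> a)) (column_prod n (row_count a n \<rho>) 0)) =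
    (\<Sum>h=1..n. sf_scale (c h * of_nat h) (sf_e h * tab_marked a n m h))"
proof -
  let ?T = "\<lambda>\<rho> h. if \<rho> a = h then sf_scale (fact (h - 1)) (column_prod n (row_count a n \<rho>) h) else 0"
  have "(\<Sum>h=1..n. sf_scale (c h * of_nat h) (sf_e h * tab_marked a n m h)) =
      (\<Sum>\<rho>\<in>fillings a n. sf_scale (rows_prob a n m \<rho>) (\<Sum>h=1..n. sf_scale (c h * of_nat h) (sf_e h * ?T \<rho> h)))"
    unfolding tab_marked_def tab_sum_def sum_distrib_left symfun.scale_sum_right
    by (subst sum.swap) (simp only: sf_scale_mult_right symfun.scale_left_commute)
  also have "\<dots> = tab_sum a n m (\<lambda>\<rho>. sf_scale (c (\<rho> a)) (column_prod n (row_count a n \<rho>) 0))"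
    unfolding tab_sum_def
  proof (rule sum.cong)
    fix \<rho> assume \<rho>: "\<rho> \<in> fillings a n"
    show "sf_scale (rows_prob a n m \<rho>) (\<Sum>h=1..n. sf_scale (c h * of_nat h) (sf_e h * ?T \<rho> h)) =
        sf_scale (rows_prob a n m \<rho>) (sf_scale (c (\<rho> a)) (column_prod n (row_count a n \<rho>) 0))"
    proof (cases "rows_prob a n m \<rho> = 0")
      case False
      have h: "\<rho> a \<in> {1..n}" using \<rho> \<open>a \<le> n\<close> by (auto simp: PiE_iff)
      have "(\<Sum>h=1..n. sf_scale (c h * of_nat h) (sf_e h * ?T \<rho> h)) =
          sf_scale (c (\<rho> a) * of_nat (\<rho> a)) (sf_e (\<rho> a) * ?T \<rho> (\<rho> a))"
        using h by (subst sum.remove[of _ "\<rho> a"]) (auto intro!: sum.neutral)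
      also have "\<dots> = sf_scale (c (\<rho> a)) (sf_scale (of_nat (\<rho> a) * fact (\<rho> a - 1))
          (sf_e (\<rho> a) * column_prod n (row_count a n \<rho>) (\<rho> a)))"
        by (simp add: sf_scale_mult_right mult.assoc)
      also have "of_nat (\<rho> a) * fact (\<rho> a - 1) = (fact (\<rho> a) :: rat)"
        using h by (subst fact_reduce) auto
      also have "sf_scale (fact (\<rho> a)) (sf_e (\<rho> a) * column_prod n (row_count a n \<rho>) (\<rho> a)) =
          column_prod n (row_count a n \<rho>) 0"
        using rows_prob_shape[OF hm False fillings_pos[OF \<rho>] \<open>a \<le> n\<close>] h
        by (intro column_prod_remove[symmetric]) auto
      finally show ?thesis by simp
    qed simp
  qed simp
  finally show ?thesis ..
qed

lemma tab_total_marked: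
  assumes "hess_on a n m" "a \<le> n"
  shows "tab_total a n m = (\<Sum>h=1..n. sf_scale (of_nat h) (sf_e h * tab_marked a n m h))"
  using tab_sum_weighted_total[OF assms, of "\<lambda>_. 1"] by (simp add: tab_total_def)

lemma tab_marked_bound:
  assumes "hess_on a n m" "a \<le> n" "Suc n - a < h"
  shows "tab_marked a n m h = 0"
  unfolding tab_marked_def tab_sum_def
proof (rule sum.neutral, rule ballI)
  fix \<rho>
  show "sf_scale (rows_prob a n m \<rho>) (if \<rho> a = h then sf_scale (fact (h - 1)) (column_prod n (row_count a n \<rho>) h) else 0) = 0"
    using rows_prob_bound[OF assms(1) _ assms(2), of \<rho>] assms(3) by (cases "rows_prob a n m \<rho> = 0") auto
qed

lemma tab_sum_Suc:
  assumes "a \<le> n"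
  shows "tab_sum a n m \<Phi> = (\<Sum>\<rho>\<in>fillings (Suc a) n. sf_scale (rows_prob (Suc a) n m \<rho>)
    (\<Sum>h=1..n. sf_scale (row_prob (\<rho> ` {a<..m a}) h) (\<Phi> (\<rho>(a := h)))))"
proof -
  have ins: "{a..n} = insert a {Suc a..n}" using assms by auto
  have upd: "rows_prob (Suc a) n m (\<rho>(a := h)) = rows_prob (Suc a) n m \<rho>" for \<rho> h
    unfolding rows_prob_def by (intro prod.cong refl arg_cong2[of _ _ _ _ row_prob] image_cong) auto
  have inj: "inj_on (\<lambda>(h, \<rho>). \<rho>(a := h :: nat)) ({1..n} \<times> fillings (Suc a) n)"
    by (rule inj_combinator) simp
  have "tab_sum a n m \<Phi> = (\<Sum>(h, \<rho>)\<in>{1..n} \<times> fillings (Suc a) n.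
      sf_scale (rows_prob a n m (\<rho>(a := h))) (\<Phi> (\<rho>(a := h))))"
    unfolding tab_sum_def ins PiE_insert_eq
    by (subst sum.reindex[OF inj]) (simp add: case_prod_unfold)
  also have "\<dots> = (\<Sum>(h, \<rho>)\<in>{1..n} \<times> fillings (Suc a) n.
      sf_scale (rows_prob (Suc a) n m \<rho>) (sf_scale (row_prob (\<rho> ` {a<..m a}) h) (\<Phi> (\<rho>(a := h)))))"
  proof (rule sum.cong[OF refl], clarify)
    fix h and \<rho> :: "nat \<Rightarrow> nat"
    have "(\<rho>(a := h)) ` {a<..m a} = \<rho> ` {a<..m a}" by (intro image_cong) auto
    then show "sf_scale (rows_prob a n m (\<rho>(a := h))) (\<Phi> (\<rho>(a := h))) =
        sf_scale (rows_prob (Suc a) n m \<rho>) (sf_scale (row_prob (\<rho> ` {a<..m a}) h) (\<Phi> (\<rho>(a := h))))"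
      using rows_prob_Suc[OF assms, of m "\<rho>(a := h)"] upd by (simp add: mult.commute)
  qed
  also have "\<dots> = (\<Sum>\<rho>\<in>fillings (Suc a) n. \<Sum>h=1..n.
      sf_scale (rows_prob (Suc a) n m \<rho>) (sf_scale (row_prob (\<rho> ` {a<..m a}) h) (\<Phi> (\<rho>(a := h)))))"
    by (subst sum.swap) (simp add: sum.cartesian_product)
  finally show ?thesis by (simp add: symfun.scale_sum_right)
qed

lemma tab_marked_isolated:
  assumes "hess_on a n m" "a \<le> n" "0 < a" "m a = a"
  shows "tab_marked a n m h = (if h = 1 then tab_total (Suc a) n m else 0)"
proof -
  let ?\<Phi> = "\<lambda>\<rho>. if \<rho> a = h then sf_scale (fact (h - 1)) (column_prod n (row_count a n \<rho>) h) else 0"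
  have one: "1 \<in> {1..n}" using assms by simp
  have "(\<Sum>j=1..n. sf_scale (row_prob (\<rho> ` {a<..m a}) j) (?\<Phi> (\<rho>(a := j)))) =
      (if h = 1 then column_prod n (row_count (Suc a) n \<rho>) 0 else 0)" for \<rho>
    using one assms(2,4) column_prod_first_row[of n "row_count (Suc a) n \<rho>"]
    by (subst sum.remove[of _ 1]) (auto simp: row_count_insert intro!: sum.neutral)
  then show ?thesis
    unfolding tab_marked_def tab_total_def tab_sum_Suc[OF assms(2)] by (simp add: tab_sum_def)
qed

text \<open>
  The only neighbour \<open>a + 1\<close> of \<open>a\<close> in row \<open>d\<close> leaves two choices: row \<open>d + 1\<close> with probability \<open>1/d\<close>, which raises
  the marked column, and row \<open>1\<close> with probability \<open>(d - 1)/d\<close>, which starts a new one.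
\<close>

lemma tab_marked_pendant:
  assumes hm: "hess_on a n m" and a: "a < n" "0 < a" "m a = Suc a" and h: "h \<in> {1..n}"
  shows "tab_marked a n m h = (if h = 1 then \<Sum>d=1..n. sf_scale (of_nat d - 1) (sf_e d * tab_marked (Suc a) n m d)
    else tab_marked (Suc a) n m (h - 1))"
proof -
  let ?\<Phi> = "\<lambda>\<rho>. if \<rho> a = h then sf_scale (fact (h - 1)) (column_prod n (row_count a n \<rho>) h) else 0"
  have hm': "hess_on (Suc a) n m" using hm by (rule hess_on_Suc)
  have int: "{a<..m a} = {Suc a}" using a by auto
  have "tab_marked a n m h = tab_sum (Suc a) n m
      (\<lambda>\<rho>. sf_scale (row_prob {\<rho> (Suc a)} h) (?\<Phi> (\<rho>(a := h))))"
    unfolding tab_marked_def tab_sum_Suc[OF less_imp_le[OF a(1)]] unfolding tab_sum_def int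
    using h by (intro sum.cong refl arg_cong[of _ _ "sf_scale _"]) (subst sum.remove[of _ h], auto intro!: sum.neutral)
  also have "\<dots> = tab_sum (Suc a) n m (\<lambda>\<rho>. if h = 1
      then sf_scale ((of_nat (\<rho> (Suc a)) - 1) / of_nat (\<rho> (Suc a))) (column_prod n (row_count (Suc a) n \<rho>) 0)
      else if \<rho> (Suc a) = h - 1 then sf_scale (fact (h - 1 - 1)) (column_prod n (row_count (Suc a) n \<rho>) (h - 1)) else 0)"
    unfolding tab_sum_def
  proof (intro sum.cong refl arg_cong[of _ _ "sf_scale _"])
    fix \<rho> assume \<rho>: "\<rho> \<in> fillings (Suc a) n"
    define d where "d = \<rho> (Suc a)"
    have d: "0 < d" using fillings_pos[OF \<rho>, of "Suc a"] a by (simp add: d_def)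
    have cnt: "row_count a n (\<rho>(a := h)) = (row_count (Suc a) n \<rho>)(h := Suc (row_count (Suc a) n \<rho> h))"
      using a by (intro row_count_insert) simp
    show "sf_scale (row_prob {\<rho> (Suc a)} h) (?\<Phi> (\<rho>(a := h))) = (if h = 1
      then sf_scale ((of_nat (\<rho> (Suc a)) - 1) / of_nat (\<rho> (Suc a))) (column_prod n (row_count (Suc a) n \<rho>) 0)
      else if \<rho> (Suc a) = h - 1 then sf_scale (fact (h - 1 - 1)) (column_prod n (row_count (Suc a) n \<rho>) (h - 1)) else 0)"
    proof (cases "h = 1")
      case True
      have "row_prob {d} 1 = (of_nat d - 1) / of_nat d"
        using d by (simp add: row_prob_def row_factor_def divide_simps)
      then show ?thesis
        using True column_prod_first_row[of n "row_count (Suc a) n \<rho>"] cnt[unfolded True] by (simp add: d_def)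
    next
      case False
      show ?thesis
      proof (cases "h = Suc d")
        case True
        have "row_prob {d} h = 1 / of_nat d" using True by (simp add: row_prob_def row_factor_def)
        moreover have "fact d / of_nat d = (fact (d - 1) :: rat)" using d by (simp add: fact_reduce[of d])
        ultimately show ?thesis
          using True d column_prod_next_row[OF d, of n "row_count (Suc a) n \<rho>"] cnt[unfolded True] by (simp add: d_def[symmetric])
      next
        case ne: False
        then have "row_prob {d} h = 0" "d \<noteq> h - 1" using False h by (auto simp: row_prob_def)
        then show ?thesis using False by (simp add: d_def)
      qed
    qed
  qed
  also have "\<dots> = (if h = 1 then \<Sum>d=1..n. sf_scale (of_nat d - 1) (sf_e d * tab_marked (Suc a) n m d)
    else tab_marked (Suc a) n m (h - 1))"
  proof (cases "h = 1")
    case True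
    have "(\<Sum>d=1..n. sf_scale ((of_nat d - 1) / of_nat d * of_nat d) (sf_e d * tab_marked (Suc a) n m d)) =
        (\<Sum>d=1..n. sf_scale (of_nat d - 1) (sf_e d * tab_marked (Suc a) n m d))"
      by (intro sum.cong) auto
    then show ?thesis
      using True tab_sum_weighted_total[OF hm', of "\<lambda>d. (of_nat d - 1) / of_nat d"] a by simp
  next
    case False
    then show ?thesis unfolding tab_marked_def by (simp only: if_False)
  qed
  finally show ?thesis .
qed

section \<open>Permutations and fillings agree\<close>

text \<open>
  In a block of \<open>h\<close> vertices with all permutations allowed, the cycle of a fixed vertex has length \<open>k\<close> for each \<open>k \<le> h\<close>
  equally often, and the permutations of the remaining vertices add up to a multiple of \<open>e\<^sub>h\<^sub>-\<^sub>k\<close>.  The marked column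
  behaves like such a block.
\<close>

definition tab_cycle :: "nat \<Rightarrow> nat \<Rightarrow> (nat \<Rightarrow> nat) \<Rightarrow> nat \<Rightarrow> rat symfun" where
  "tab_cycle a n m k = (\<Sum>h=k..n. sf_e (h - k) * tab_marked a n m h)"

lemma tab_marked_column_law:
  assumes hm: "hess_on a n m" and t: "a \<le> t" "t + 2 \<le> q" "q \<le> n" "m t = q" "m (q - 1) = m q"
    and below: "\<And>u. a \<le> u \<Longrightarrow> u < t \<Longrightarrow> m u \<le> q - 2" and above: "\<And>u. t < u \<Longrightarrow> u \<le> n \<Longrightarrow> q \<le> m u"
  shows "tab_marked a n m h + tab_marked a n (m(t := q - 2)) h =
    tab_marked a n (m(t := q - 1)) h + tab_marked a n (m(t := q - 1)) h"
  unfolding tab_marked_def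
proof (rule tab_sum_second_difference)
  show bc: "q - 1 \<in> {a..n}" "q \<in> {a..n}" using t by auto
  fix \<rho> :: "nat \<Rightarrow> nat"
  have "transpose (q - 1) q a = a" using t by (auto simp: transpose_def)
  then show "(if (\<rho> \<circ> transpose (q - 1) q) a = h then sf_scale (fact (h - 1)) (column_prod n (row_count a n (\<rho> \<circ> transpose (q - 1) q)) h) else 0) =
      (if \<rho> a = h then sf_scale (fact (h - 1)) (column_prod n (row_count a n \<rho>) h) else 0)"
    unfolding row_count_swap[OF bc] by simp
next
  fix \<rho> assume "\<rho> \<in> fillings a n"
  from rows_prob_column_law[OF assms(1-6) below above this]
  show "rows_prob a n m \<rho> - 2 * rows_prob a n (m(t := q - 1)) \<rho> + rows_prob a n (m(t := q - 2)) \<rho> +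
      (rows_prob a n m (\<rho> \<circ> transpose (q - 1) q) - 2 * rows_prob a n (m(t := q - 1)) (\<rho> \<circ> transpose (q - 1) q) +
        rows_prob a n (m(t := q - 2)) (\<rho> \<circ> transpose (q - 1) q)) = 0" .
qed

lemma tab_marked_row_law:
  assumes hm: "hess_on a n m" and s: "a < s" "s + 2 \<le> q" "q \<le> n" "m s = q" "m (Suc s) = q"
    and below: "\<And>u. a \<le> u \<Longrightarrow> u < s \<Longrightarrow> m u \<noteq> s"
  shows "tab_marked a n m h + tab_marked a n (m(s := q - 1, Suc s := q - 1)) h =
    tab_marked a n (m(s := q - 1)) h + tab_marked a n (m(s := q - 1)) h"
  unfolding tab_marked_def
proof (rule tab_sum_second_difference)
  show bc: "s \<in> {a..n}" "Suc s \<in> {a..n}" using s by auto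
  fix \<rho> :: "nat \<Rightarrow> nat"
  have "transpose s (Suc s) a = a" using s by (auto simp: transpose_def)
  then show "(if (\<rho> \<circ> transpose s (Suc s)) a = h then sf_scale (fact (h - 1)) (column_prod n (row_count a n (\<rho> \<circ> transpose s (Suc s))) h) else 0) =
      (if \<rho> a = h then sf_scale (fact (h - 1)) (column_prod n (row_count a n \<rho>) h) else 0)"
    unfolding row_count_swap[OF bc] by simp
next
  fix \<rho> assume "\<rho> \<in> fillings a n"
  from rows_prob_row_law[OF assms(1-6) below this]
  show "rows_prob a n m \<rho> - 2 * rows_prob a n (m(s := q - 1)) \<rho> + rows_prob a n (m(s := q - 1, Suc s := q - 1)) \<rho> +
      (rows_prob a n m (\<rho> \<circ> transpose s (Suc s)) - 2 * rows_prob a n (m(s := q - 1)) (\<rho> \<circ> transpose s (Suc s)) +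
        rows_prob a n (m(s := q - 1, Suc s := q - 1)) (\<rho> \<circ> transpose s (Suc s))) = 0" .
qed

lemma tab_cycle_law:
  assumes "\<And>h. tab_marked a n m h + tab_marked a n m'' h = tab_marked a n m' h + tab_marked a n m' h"
  shows "tab_cycle a n m k + tab_cycle a n m'' k = tab_cycle a n m' k + tab_cycle a n m' k"
  unfolding tab_cycle_def by (simp add: assms flip: sum.distrib distrib_left)

lemma sum_swap_triangle:
  "(\<Sum>k=b..n. \<Sum>h=k..n. F k h) = (\<Sum>h=b..n. \<Sum>k=b..h. F k (h :: nat))"
  unfolding sum.Sigma[OF finite_atLeastAtMost ballI[OF finite_atLeastAtMost]]
  by (rule sum.reindex_bij_witness[of _ prod.swap prod.swap]) auto

abbreviation omega_power :: "nat \<Rightarrow> rat symfun" where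
  "omega_power \<equiv> newton of_nat"

text \<open>
  Newton's identity turns the sum of the \<open>e\<^sub>h\<^sub>-\<^sub>k \<omega>(p\<^sub>k)\<close> into \<open>h e\<^sub>h\<close>, the factor by which the marked and the complete weights of
  fillings differ.
\<close>

lemma cyc_total_eq_tab_total:
  assumes hm: "hess_on a n m" and a: "a \<le> n" "0 < a"
    and eq: "\<And>k. 0 < k \<Longrightarrow> cyc_marked omega_power a n m k = tab_cycle a n m k"
  shows "cyc_total omega_power a n m = tab_total a n m"
proof -
  have "cyc_total omega_power a n m = (\<Sum>k=1..n. omega_power k * cyc_marked omega_power a n m k)"
    using a by (intro cyc_total_marked) auto
  also have "\<dots> = (\<Sum>k=1..n. \<Sum>h=k..n. omega_power k * sf_e (h - k) * tab_marked a n m h)"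
    by (intro sum.cong) (auto simp: eq tab_cycle_def sum_distrib_left mult.assoc)
  also have "\<dots> = (\<Sum>h=1..n. (\<Sum>k=1..h. sf_e (h - k) * omega_power k) * tab_marked a n m h)"
    unfolding sum_swap_triangle sum_distrib_right
    by (intro sum.cong refl) (simp only: mult.commute[of "omega_power _"])
  also have "\<dots> = tab_total a n m"
    unfolding tab_total_marked[OF hm a(1)]
  proof (rule sum.cong)
    fix h assume "h \<in> {1..n}"
    then have "1 \<le> h" by simp
    from newton_recursion[OF this, of "of_nat :: nat \<Rightarrow> rat"]
    show "(\<Sum>k=1..h. sf_e (h - k) * omega_power k) * tab_marked a n m h =
        sf_scale (of_nat h) (sf_e h * tab_marked a n m h)" by (simp add: sf_scale_mult_left)
  qed simp
  finally show ?thesis .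
qed

lemma double_cancel:
  fixes f g :: "rat symfun" assumes "f + f = g + g" shows "f = g"
proof (rule symfun_eqI)
  fix x
  have "sf_coeff f x + sf_coeff f x = sf_coeff g x + sf_coeff g x"
    using assms by (metis sf_coeff_add)
  then show "sf_coeff f x = sf_coeff g x" by simp
qed

text \<open>
  Induction on the number of vertices.  The modular laws reduce the claim to \<open>m a \<le> a + 1\<close>, where both sides satisfy the
  same recursion.
\<close>

theorem cyc_marked_eq_tab_cycle:
  assumes "hess_on a n m" "0 < a" "a \<le> n" "0 < k"
  shows "cyc_marked omega_power a n m k = tab_cycle a n m k"
  using assms
proof (induction "n - a" arbitrary: a m k rule: less_induct)
  case less
  note a = less.prems(2,3)
  define P where "P m \<longleftrightarrow> (\<forall>k>0. cyc_marked omega_power a n m k = tab_cycle a n m k)" for m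
  have IH: "cyc_marked omega_power (Suc a) n m k = tab_cycle (Suc a) n m k"
    if "hess_on a n m" "a < n" "0 < k" for m k
    using less.hyps[of "Suc a" m k] that by (simp add: hess_on_Suc)
  have total: "cyc_total omega_power (Suc a) n m = tab_total (Suc a) n m" if hm: "hess_on a n m" for m
  proof (cases "a < n")
    case True
    then show ?thesis using IH hm by (intro cyc_total_eq_tab_total) (auto simp: hess_on_Suc)
  next
    case False
    then have e: "{Suc a..n} = {}" by simp
    have "perms_on (Suc a) n m = {id}" unfolding perms_on_def e by auto
    then show ?thesis
      unfolding cyc_total_def tab_total_def tab_sum_def e
      by (simp add: cycle_weight_def rows_prob_def column_prod_def row_count_def False e)
  qed
  interpret modular_closed a n P
  proof
    fix m t q
    assume hm: "hess_on a n m" and t: "a \<le> t" "t + 2 \<le> q" "q \<le> n" "m t = q" "m (q - 1) = m q"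
      and below: "\<And>u. a \<le> u \<Longrightarrow> u < t \<Longrightarrow> m u \<le> q - 2" and above: "\<And>u. t < u \<Longrightarrow> u \<le> n \<Longrightarrow> q \<le> m u"
      and P: "P (m(t := q - 1))" "P (m(t := q - 2))"
    show "P m"
      unfolding P_def
    proof (intro allI impI)
      fix k :: nat assume k: "0 < k"
      have "m u \<noteq> q - 1" if "u \<in> {a..n}" "u \<noteq> t" for u
        using below[of u] above[of u] that t by (cases "u < t") fastforce+
      then have "cyc_marked omega_power a n m k + cyc_marked omega_power a n (m(t := q - 2)) k =
          cyc_marked omega_power a n (m(t := q - 1)) k + cyc_marked omega_power a n (m(t := q - 1)) k"
        using t by (intro cyc_marked_column_law) auto
      moreover have "tab_cycle a n m k + tab_cycle a n (m(t := q - 2)) k =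
          tab_cycle a n (m(t := q - 1)) k + tab_cycle a n (m(t := q - 1)) k"
        by (intro tab_cycle_law tab_marked_column_law hm t below above)
      moreover have "cyc_marked omega_power a n (m(t := q - 1)) k = tab_cycle a n (m(t := q - 1)) k"
        "cyc_marked omega_power a n (m(t := q - 2)) k = tab_cycle a n (m(t := q - 2)) k"
        using P k unfolding P_def by blast+
      ultimately show "cyc_marked omega_power a n m k = tab_cycle a n m k"
        by (metis add_right_cancel)
    qed
  next
    fix m s q
    assume hm: "hess_on a n m" and s: "a < s" "s + 2 \<le> q" "q \<le> n" "m s = q" "m (Suc s) = q"
      and below: "\<And>u. a \<le> u \<Longrightarrow> u < s \<Longrightarrow> m u \<le> q - 1 \<and> m u \<noteq> s"
      and P: "P m" "P (m(s := q - 1, Suc s := q - 1))"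
    show "P (m(s := q - 1))"
      unfolding P_def
    proof (intro allI impI)
      fix k :: nat assume k: "0 < k"
      have "m u \<noteq> s" if "u \<in> {a..n}" for u
        using below[of u] hess_onD[OF hm, of u] that s by (cases "u < s"; cases "u = s") auto
      then have "cyc_marked omega_power a n m k + cyc_marked omega_power a n (m(s := q - 1, Suc s := q - 1)) k =
          cyc_marked omega_power a n (m(s := q - 1)) k + cyc_marked omega_power a n (m(s := q - 1)) k"
        using s by (intro cyc_marked_row_law) auto
      moreover have "tab_cycle a n m k + tab_cycle a n (m(s := q - 1, Suc s := q - 1)) k =
          tab_cycle a n (m(s := q - 1)) k + tab_cycle a n (m(s := q - 1)) k"
        using below by (intro tab_cycle_law tab_marked_row_law hm s) auto
      ultimately show "cyc_marked omega_power a n (m(s := q - 1)) k = tab_cycle a n (m(s := q - 1)) k"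
        using P k unfolding P_def by (metis double_cancel)
    qed
  next
    fix m assume hm: "hess_on a n m" and ma: "m a \<le> Suc a"
    have m_a: "a \<le> m a" "m a \<le> n" using hess_onD[OF hm, of a] a by auto
    show "P m"
      unfolding P_def
    proof (intro allI impI)
      fix k :: nat assume k: "0 < k"
      consider "m a = a" | "m a = Suc a" "a < n" using m_a ma by linarith
      then show "cyc_marked omega_power a n m k = tab_cycle a n m k"
      proof cases
        case 1
        have "tab_cycle a n m k = (if k = 1 then tab_total (Suc a) n m else 0)"
          unfolding tab_cycle_def tab_marked_isolated[OF hm a(2,1) 1]
          using k a by (cases "k = 1") (auto simp: if_distrib sum.delta cong: if_cong intro!: sum.neutral)
        then show ?thesis
          using total[OF hm] a 1 by (simp add: cyc_marked_isolated)
      next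
        case 2
        let ?T = "tab_marked (Suc a) n m"
        have hm': "hess_on (Suc a) n m" using hm by (rule hess_on_Suc)
        \<comment> \<open>Row \<open>n\<close> is out of reach with fewer than \<open>n\<close> vertices, so shifting the row index loses no term.\<close>
        have last: "?T n = 0" using tab_marked_bound[OF hm', of n] 2 a by simp
        have shift: "(\<Sum>h=Suc j..n. sf_e (h - Suc j) * ?T (h - 1)) = (\<Sum>h=j..n. sf_e (h - j) * ?T h)" if "j \<le> n" for j
        proof -
          obtain N where N: "n = Suc N" using 2 by (cases n) auto
          have "(\<Sum>h=Suc j..n. sf_e (h - Suc j) * ?T (h - 1)) = (\<Sum>h=j..N. sf_e (h - j) * ?T h)"
            unfolding N by (subst sum.shift_bounds_cl_Suc_ivl) simp
          also have "\<dots> = (\<Sum>h=j..n. sf_e (h - j) * ?T h)"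
            using last that by (cases "j = n") (simp_all add: N)
          finally show ?thesis .
        qed
        show ?thesis
        proof (cases "k = 1")
          case True
          have "tab_cycle a n m 1 = tab_marked a n m 1 + (\<Sum>h=Suc 1..n. sf_e (h - 1) * tab_marked a n m h)"
            unfolding tab_cycle_def using a by (subst sum.atLeast_Suc_atMost) auto
          also have "(\<Sum>h=Suc 1..n. sf_e (h - 1) * tab_marked a n m h) = (\<Sum>h=Suc 1..n. sf_e (h - 1) * ?T (h - 1))"
            using 2 a hm by (intro sum.cong) (auto simp: tab_marked_pendant)
          also have "\<dots> = (\<Sum>h=Suc 0..n. sf_e h * ?T h)"
          proof -
            obtain N where N: "n = Suc N" using 2 by (cases n) auto
            have "(\<Sum>h=Suc 1..n. sf_e (h - 1) * ?T (h - 1)) = (\<Sum>h=1..N. sf_e h * ?T h)"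
              unfolding N by (subst sum.shift_bounds_cl_Suc_ivl) simp
            then show ?thesis using last by (simp add: N)
          qed
          also have "tab_marked a n m 1 = (\<Sum>d=1..n. sf_scale (of_nat d - 1) (sf_e d * ?T d))"
            using 2 a hm by (subst tab_marked_pendant) auto
          also have "\<dots> + (\<Sum>h=Suc 0..n. sf_e h * ?T h) = tab_total (Suc a) n m"
          proof -
            have "sf_scale (of_nat d - 1) f + f = sf_scale (of_nat d) f" for d and f :: "rat symfun"
              by (simp add: symfun.scale_left_diff_distrib)
            then show ?thesis
              using tab_total_marked[OF hm'] 2 by (simp flip: sum.distrib)
          qed
          finally have "tab_cycle a n m 1 = tab_total (Suc a) n m" .
          moreover have "cyc_marked omega_power (Suc a) n m 0 = 0"
            unfolding cyc_marked_def
          proof (rule sum.neutral, rule ballI)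
            fix \<sigma> assume "\<sigma> \<in> perms_on (Suc a) n m"
            then have \<sigma>: "\<sigma> permutes {Suc a..n}" by (simp add: perms_on_def)
            have "finite (orbit \<sigma> (Suc a))"
              using permutes_self_in_orbit[OF \<sigma>] by (rule finite_orbit)
            then show "marked_weight omega_power (Suc a) n 0 \<sigma> = 0"
              using orbit_nonempty[of \<sigma> "Suc a"] by (simp add: marked_weight_def)
          qed
          ultimately show ?thesis
            using True total[OF hm] cyc_marked_pendant[OF 2(2,1) hm, of omega_power 1] by simp
        next
          case False
          then obtain j where j: "k = Suc j" "0 < j" using k by (cases k) auto
          have "tab_cycle a n m k = (\<Sum>h=Suc j..n. sf_e (h - Suc j) * ?T (h - 1))"
            unfolding tab_cycle_def j(1) using 2 a hm j(2) by (intro sum.cong) (auto simp: tab_marked_pendant)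
          also have "\<dots> = tab_cycle (Suc a) n m j"
            using shift[of j] by (cases "j \<le> n") (simp_all add: tab_cycle_def)
          finally show ?thesis
            using IH[OF hm 2(2) j(2)] cyc_marked_pendant[OF 2(2,1) hm, of omega_power k] False j by simp
        qed
      qed
    qed
  qed
  show ?case using all_hessenberg[OF less.prems(1) a(2)] less.prems(4) by (simp add: P_def)
qed


section \<open>Inverting the passage from rows to cycles\<close>

lemma sf_h_e_alternating:
  "(\<Sum>i\<le>n. sf_scale ((-1) ^ i) (sf_h i * sf_e (n - i))) = (if n = 0 then 1 else 0 :: 'a :: comm_ring_1 symfun)"
proof (cases "n = 0")
  case False
  have "(\<Sum>i\<le>n. sf_scale ((-1) ^ i) (sf_h i * sf_e (n - i))) =
      (\<Sum>i\<le>n. sf_scale ((-1) ^ (n - i)) (sf_h (n - i) * sf_e i) :: 'a symfun)"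
    by (rule sum.reindex_bij_witness[of _ "\<lambda>i. n - i" "\<lambda>i. n - i"]) auto
  also have "\<dots> = (\<Sum>i\<le>n. sf_scale ((-1) ^ n) (sf_scale ((-1) ^ i) (sf_e i * sf_h (n - i))))"
  proof (rule sum.cong)
    fix i assume "i \<in> {..n}"
    then have "(-1) ^ n * (-1) ^ i = ((-1) ^ ((n - i) + i) * (-1) ^ i :: 'a)"
      by (simp only: le_add_diff_inverse2 atMost_iff)
    also have "\<dots> = (-1) ^ (n - i) * ((-1) * (-1)) ^ i"
      by (simp only: power_add power_mult_distrib mult.assoc)
    also have "\<dots> = (-1) ^ (n - i)" by simp
    finally show "sf_scale ((-1) ^ (n - i)) (sf_h (n - i) * sf_e i) =
        sf_scale ((-1) ^ n) (sf_scale ((-1) ^ i) (sf_e i * sf_h (n - i)) :: 'a symfun)"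
      by (simp add: mult.commute)
  qed simp
  also have "\<dots> = 0"
    unfolding symfun.scale_sum_right[symmetric] using sf_e_h_alternating[of n, where 'a = 'a] False
    by (simp del: symfun.scale_scale)
  finally show ?thesis using False by simp
qed simp

text \<open>
  The matrices \<open>(e\<^sub>j\<^sub>-\<^sub>k)\<close> and \<open>((-1)\<^sup>k\<^sup>-\<^sup>h h\<^sub>k\<^sub>-\<^sub>h)\<close> are inverse to each other.
\<close>

lemma tab_cycle_inversion:
  "(\<Sum>k=h..n. sf_scale ((-1) ^ (k - h)) (sf_h (k - h) * tab_cycle a n m k)) = (if h \<le> n then tab_marked a n m h else 0)"
proof -
  have "(\<Sum>k=h..n. sf_scale ((-1) ^ (k - h)) (sf_h (k - h) * tab_cycle a n m k)) =
      (\<Sum>k=h..n. \<Sum>j=k..n. sf_scale ((-1) ^ (k - h)) (sf_h (k - h) * sf_e (j - k)) * tab_marked a n m j)"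
    unfolding tab_cycle_def sum_distrib_left symfun.scale_sum_right
    by (simp add: sf_scale_mult_left mult.assoc)
  also have "\<dots> = (\<Sum>j=h..n. (\<Sum>k=h..j. sf_scale ((-1) ^ (k - h)) (sf_h (k - h) * sf_e (j - k))) * tab_marked a n m j)"
    unfolding sum_swap_triangle sum_distrib_right ..
  also have "\<dots> = (\<Sum>j=h..n. if j = h then tab_marked a n m h else 0)"
  proof (rule sum.cong)
    fix j assume j: "j \<in> {h..n}"
    have "(\<Sum>k=h..j. sf_scale ((-1) ^ (k - h)) (sf_h (k - h) * sf_e (j - k)) :: rat symfun) =
        (\<Sum>i\<le>j - h. sf_scale ((-1) ^ i) (sf_h i * sf_e (j - h - i)))"
      using j by (intro sum.reindex_bij_witness[of _ "\<lambda>i. i + h" "\<lambda>k. k - h"]) auto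
    then show "(\<Sum>k=h..j. sf_scale ((-1) ^ (k - h)) (sf_h (k - h) * sf_e (j - k))) * tab_marked a n m j =
        (if j = h then tab_marked a n m h else 0)"
      unfolding sf_h_e_alternating using j by auto
  qed simp
  finally show ?thesis by simp
qed

section \<open>Nonnegative combinations of elementary symmetric functions\<close>

lemma is_expansion_update:
  assumes "is_expansion b c f" "is_partition l"
  shows "is_expansion b (c(l := c l + x)) (f + sf_scale x (b l))"
proof -
  let ?S = "insert l {k. c k \<noteq> 0}"
  have fin: "finite {k. c k \<noteq> 0}" and f: "f = (\<Sum>k | c k \<noteq> 0. sf_scale (c k) (b k))"
    using assms by (auto simp: is_expansion_def)
  have "(\<Sum>k\<in>?S. sf_scale ((c(l := c l + x)) k) (b k)) =
      (\<Sum>k\<in>?S. sf_scale (c k) (b k) + (if k = l then sf_scale x (b l) else 0))"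
    by (intro sum.cong) (auto simp: symfun.scale_left_distrib)
  also have "\<dots> = (\<Sum>k\<in>?S. sf_scale (c k) (b k)) + sf_scale x (b l)"
    using fin by (simp only: sum.distrib) simp
  also have "(\<Sum>k\<in>?S. sf_scale (c k) (b k)) = f"
    unfolding f using fin by (intro sum.mono_neutral_right) auto
  finally have eq: "(\<Sum>k\<in>?S. sf_scale ((c(l := c l + x)) k) (b k)) = f + sf_scale x (b l)" .
  show ?thesis
    unfolding eq[symmetric] using assms fin by (intro is_expansion_sum) (auto simp: is_expansion_def)
qed

lemma is_expansion_zero: "is_expansion b (\<lambda>_. 0) 0"
  by (simp add: is_expansion_def)

text \<open>
  The inductive form gives closure under products by a simple induction, which the coefficient functions of
  \<^const>\<open>e_positive\<close> do not.
\<close>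

inductive e_cone :: "'a :: linordered_idom symfun \<Rightarrow> bool" where
  zero: "e_cone 0"
| step: "e_cone f \<Longrightarrow> is_partition l \<Longrightarrow> 0 \<le> x \<Longrightarrow> e_cone (f + sf_scale x (sf_e_part l))"

lemma e_cone_positive: "e_cone f \<Longrightarrow> e_positive f"
  unfolding e_positive_def
proof (induction rule: e_cone.induct)
  case zero
  show ?case using is_expansion_zero by (intro exI[of _ "\<lambda>_. 0"]) auto
next
  case (step f l x)
  then obtain c where c: "is_expansion sf_e_part c f" "\<forall>l. 0 \<le> c l" by blast
  show ?case
    using is_expansion_update[OF c(1) step(2), of x] c(2) step(3)
    by (intro exI[of _ "c(l := c l + x)"] conjI) (assumption, simp)
qed

lemma e_cone_add: "e_cone g \<Longrightarrow> e_cone f \<Longrightarrow> e_cone (f + g)"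
proof (induction rule: e_cone.induct)
  case (step g l x)
  then show ?case using e_cone.step[of "f + g" l x] by (simp add: add.assoc)
qed simp

lemma e_cone_scale: "e_cone f \<Longrightarrow> 0 \<le> y \<Longrightarrow> e_cone (sf_scale y f)"
proof (induction rule: e_cone.induct)
  case (step f l x)
  then show ?case using e_cone.step[of "sf_scale y f" l "y * x"] by (simp add: symfun.scale_right_distrib)
qed (simp add: e_cone.zero)

lemma e_cone_mult: "e_cone f \<Longrightarrow> e_cone g \<Longrightarrow> e_cone (f * g)"
proof (induction rule: e_cone.induct)
  case (step f l x)
  have "e_cone (sf_e_part l * g)"
    using step.prems
  proof (induction rule: e_cone.induct)
    case (step g k y)
    have "sf_e_part l * sf_e_part k = (sf_e_part (l + k) :: 'a symfun)" by (simp add: sf_e_part_def)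
    then show ?case
      using e_cone.step[OF step.IH, of "l + k" y] step.hyps \<open>is_partition l\<close>
      by (simp add: distrib_left sf_scale_mult_right)
  qed (simp add: e_cone.zero)
  then have "e_cone (sf_scale x (sf_e_part l * g))" using step.hyps by (intro e_cone_scale)
  then show ?case
    using e_cone_add step by (simp add: distrib_right sf_scale_mult_left)
qed (simp add: e_cone.zero)

lemma e_cone_e_part: "is_partition l \<Longrightarrow> e_cone (sf_e_part l)"
  using e_cone.step[OF e_cone.zero, of l 1] by simp

lemma e_cone_one: "e_cone 1"
  using e_cone_e_part[of "{#}"] by (simp add: sf_e_part_def)

lemma e_cone_e: "e_cone (sf_e i)"
  using e_cone_e_part[of "{#i#}"] e_cone_one by (cases "i = 0") (simp_all add: sf_e_part_def)

lemma e_cone_sum: "(\<And>x. x \<in> A \<Longrightarrow> e_cone (F x)) \<Longrightarrow> e_cone (sum F A)"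
  by (induction A rule: infinite_finite_induct) (simp_all add: e_cone.zero e_cone_add)

lemma e_cone_prod: "(\<And>x. x \<in> A \<Longrightarrow> e_cone (F x)) \<Longrightarrow> e_cone (prod F A)"
  by (induction A rule: infinite_finite_induct) (simp_all add: e_cone_one e_cone_mult)

lemma e_cone_power: "e_cone f \<Longrightarrow> e_cone (f ^ k)"
  by (induction k) (simp_all add: e_cone_one e_cone_mult)

lemma e_cone_tab_marked: "e_cone (tab_marked a n m h)"
  unfolding tab_marked_def tab_sum_def column_prod_def
  by (intro e_cone_sum e_cone_scale rows_prob_nonneg)
    (auto intro!: e_cone_scale e_cone_prod e_cone_power e_cone_e simp: e_cone.zero)

section \<open>The involution on products\<close>

text \<open>
  Pairs of equal expansions in the \<open>h\<^sub>\<lambda>\<close> and the \<open>e\<^sub>\<lambda>\<close>.  This relation is closed under products, so \<^const>\<open>sf_omega\<close> is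
  multiplicative on the pairs that it contains, in particular on the products of the \<open>\<rho>\<^sub>n\<close>.
\<close>

inductive omega_rel :: "'a :: comm_ring_1 symfun \<Rightarrow> 'a symfun \<Rightarrow> bool" where
  zero: "omega_rel 0 0"
| step: "omega_rel f g \<Longrightarrow> is_partition l \<Longrightarrow> omega_rel (f + sf_scale x (sf_h_part l)) (g + sf_scale x (sf_e_part l))"

lemma omega_rel_sf_omega: "omega_rel f g \<Longrightarrow> sf_omega f = g"
proof -
  assume "omega_rel f g"
  then have "\<exists>c. is_expansion sf_h_part c f \<and> is_expansion sf_e_part c g"
  proof (induction rule: omega_rel.induct)
    case zero
    show ?case using is_expansion_zero by blast
  next
    case (step f g l x)
    then show ?case using is_expansion_update by blast
  qed
  then show ?thesis using sf_omega_eqI by blast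
qed

lemma omega_rel_add: "omega_rel f' g' \<Longrightarrow> omega_rel f g \<Longrightarrow> omega_rel (f + f') (g + g')"
proof (induction rule: omega_rel.induct)
  case (step f' g' l x)
  then show ?case using omega_rel.step[of "f + f'" "g + g'" l x] by (simp add: add.assoc)
qed simp

lemma omega_rel_scale: "omega_rel f g \<Longrightarrow> omega_rel (sf_scale y f) (sf_scale y g)"
proof (induction rule: omega_rel.induct)
  case (step f g l x)
  then show ?case
    using omega_rel.step[of "sf_scale y f" "sf_scale y g" l "y * x"] by (simp add: symfun.scale_right_distrib)
qed (simp add: omega_rel.zero)

lemma omega_rel_mult: "omega_rel f g \<Longrightarrow> omega_rel f' g' \<Longrightarrow> omega_rel (f * f') (g * g')"
proof (induction rule: omega_rel.induct)
  case (step f g l x)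
  have "omega_rel (sf_h_part l * f') (sf_e_part l * g')"
    using step.prems
  proof (induction rule: omega_rel.induct)
    case (step f' g' k y)
    have "sf_h_part l * sf_h_part k = (sf_h_part (l + k) :: 'a symfun)"
      "sf_e_part l * sf_e_part k = (sf_e_part (l + k) :: 'a symfun)"
      by (simp_all add: sf_h_part_def sf_e_part_def)
    then show ?case
      using omega_rel.step[OF step.IH, of "l + k" y] step.hyps \<open>is_partition l\<close>
      by (simp add: distrib_left sf_scale_mult_right)
  qed (simp add: omega_rel.zero)
  then have "omega_rel (sf_scale x (sf_h_part l * f')) (sf_scale x (sf_e_part l * g'))" by (rule omega_rel_scale)
  then show ?case
    using omega_rel_add step by (simp add: distrib_right sf_scale_mult_left)
qed (simp add: omega_rel.zero)

lemma omega_rel_h_part: "is_partition l \<Longrightarrow> omega_rel (sf_h_part l) (sf_e_part l)"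
  using omega_rel.step[OF omega_rel.zero, of l 1] by simp

lemma omega_rel_one: "omega_rel 1 1"
  using omega_rel_h_part[of "{#}"] by (simp add: sf_e_part_def sf_h_part_def)

lemma omega_rel_h: "omega_rel (sf_h i) (sf_e i)"
  using omega_rel_h_part[of "{#i#}"] omega_rel_one by (cases "i = 0") (simp_all add: sf_h_part_def sf_e_part_def)

lemma omega_rel_sum: "(\<And>x. x \<in> A \<Longrightarrow> omega_rel (F x) (G x)) \<Longrightarrow> omega_rel (sum F A) (sum G A)"
  by (induction A rule: infinite_finite_induct) (simp_all add: omega_rel.zero omega_rel_add)

lemma omega_rel_rho: "0 < n \<Longrightarrow> omega_rel (sf_rho n) (newton q_int n)"
proof (induction n rule: less_induct)
  case (less n)
  have "omega_rel (\<Sum>i\<in>{1..<n}. sf_h (n - i) * sf_rho i) (\<Sum>i\<in>{1..<n}. sf_e (n - i) * newton q_int i)"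
    using less.IH by (intro omega_rel_sum omega_rel_mult omega_rel_h) auto
  from omega_rel_scale[OF this, of "-1"]
  have "omega_rel (sf_scale (q_int n) (sf_h n) + - (\<Sum>i\<in>{1..<n}. sf_h (n - i) * sf_rho i))
      (sf_scale (q_int n) (sf_e n) + - (\<Sum>i\<in>{1..<n}. sf_e (n - i) * newton q_int i))"
    by (intro omega_rel_add omega_rel_scale omega_rel_h) simp
  then show ?case
    using less.prems by (simp add: sf_rho.simps[of n] newton.simps[of q_int n])
qed

lemma sf_omega_rho_prod:
  assumes "\<And>\<tau>. \<tau> \<in> set xs \<Longrightarrow> \<tau> \<noteq> []"
  shows "sf_omega (\<Prod>\<tau>\<leftarrow>xs. sf_rho (length \<tau>)) = (\<Prod>\<tau>\<leftarrow>xs. newton q_int (length \<tau>))"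
proof (rule omega_rel_sf_omega)
  show "omega_rel (\<Prod>\<tau>\<leftarrow>xs. sf_rho (length \<tau>)) (\<Prod>\<tau>\<leftarrow>xs. newton q_int (length \<tau>))"
    using assms by (induction xs) (simp_all add: omega_rel_one omega_rel_mult omega_rel_rho)
qed

section \<open>Change of coefficients\<close>

lemma sf_specialize_add: "sf_specialize c (f + g) = sf_specialize c f + sf_specialize c g"
  by (rule symfun_eqI) (transfer, simp)

lemma sf_specialize_diff: "sf_specialize c (f - g) = sf_specialize c f - sf_specialize c g"
  by (rule symfun_eqI) (transfer, simp)

lemma sf_specialize_mult: "sf_specialize c (f * g) = sf_specialize c f * sf_specialize c g"
  by (rule symfun_eqI) (transfer, simp add: poly_sum)

lemma sf_specialize_scale: "sf_specialize c (sf_scale p f) = sf_scale (poly p c) (sf_specialize c f)"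
  by (rule symfun_eqI) (transfer, simp)

lemma sf_specialize_basis [simp]:
  "sf_specialize c 0 = 0" "sf_specialize c 1 = 1" "sf_specialize c (sf_h n) = sf_h n" "sf_specialize c (sf_e n) = sf_e n"
  by (rule symfun_eqI, transfer, simp)+

lemma sf_specialize_sum: "sf_specialize c (sum F A) = (\<Sum>x\<in>A. sf_specialize c (F x))"
  by (induction A rule: infinite_finite_induct) (simp_all add: sf_specialize_add)

lemma sf_specialize_prod_list: "sf_specialize c (prod_list fs) = (\<Prod>f\<leftarrow>fs. sf_specialize c f)"
  by (induction fs) (simp_all add: sf_specialize_mult)

lemma sf_specialize_newton: "sf_specialize c (newton \<phi> n) = newton (\<lambda>k. poly (\<phi> k) c) n"
proof (induction n rule: less_induct)
  case (less n)
  then show ?case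
    by (subst (1 2) newton.simps) (simp add: sf_specialize_diff sf_specialize_scale sf_specialize_sum sf_specialize_mult)
qed

lift_definition sf_of_int :: "int symfun \<Rightarrow> 'a :: comm_ring_1 symfun" is "\<lambda>f m. of_int (f m)"
  by (auto, metis of_int_0)

lemma sf_of_int_add: "sf_of_int (f + g) = sf_of_int f + sf_of_int g"
  by (rule symfun_eqI) (transfer, simp)

lemma sf_of_int_diff: "sf_of_int (f - g) = sf_of_int f - sf_of_int g"
  by (rule symfun_eqI) (transfer, simp)

lemma sf_of_int_mult: "sf_of_int (f * g) = sf_of_int f * sf_of_int g"
  by (rule symfun_eqI) (transfer, simp)

lemma sf_of_int_scale: "sf_of_int (sf_scale x f) = sf_scale (of_int x) (sf_of_int f)"
  by (rule symfun_eqI) (transfer, simp)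

lemma sf_of_int_basis [simp]:
  "sf_of_int 0 = 0" "sf_of_int 1 = 1" "sf_of_int (sf_h n) = sf_h n" "sf_of_int (sf_e n) = sf_e n"
  by (rule symfun_eqI, transfer, simp)+

lemma sf_of_int_sum: "sf_of_int (sum F A) = (\<Sum>x\<in>A. sf_of_int (F x))"
  by (induction A rule: infinite_finite_induct) (simp_all add: sf_of_int_add)

lemma sf_of_int_prod: "sf_of_int (prod F A) = (\<Prod>x\<in>A. sf_of_int (F x))"
  by (induction A rule: infinite_finite_induct) (simp_all add: sf_of_int_mult)

lemma sf_of_int_newton: "sf_of_int (newton of_nat n) = newton of_nat n"
proof (induction n rule: less_induct)
  case (less n)
  then show ?case
    by (subst (1 2) newton.simps) (simp add: sf_of_int_diff sf_of_int_scale sf_of_int_sum sf_of_int_mult)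
qed

lemma sf_of_int_e_part: "sf_of_int (sf_e_part l) = sf_e_part l"
  by (induction l) (simp_all add: sf_e_part_def sf_of_int_mult)

text \<open>
  The integral expansion is also the rational one, because expansions in the \<open>e\<^sub>\<lambda>\<close> are unique.
\<close>

lemma e_positive_of_int:
  assumes "f \<in> e_span 0" "e_positive (sf_of_int f :: rat symfun)"
  shows "e_positive f"
proof -
  obtain S c where S: "finite S" "\<And>l. l \<in> S \<Longrightarrow> is_partition l" "f = (\<Sum>l\<in>S. sf_scale (c l) (sf_e_part l))"
    using e_span_explicit[OF assms(1)] by blast
  define c' where "c' l = (if l \<in> S then c l else 0)" for l
  have f: "f = (\<Sum>l\<in>S. sf_scale (c' l) (sf_e_part l))" using S(3) by (simp add: c'_def)
  have int: "is_expansion sf_e_part c' f"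
    unfolding f using S(1,2) by (intro is_expansion_sum) (auto simp: c'_def)
  have "sf_of_int f = (\<Sum>l\<in>S. sf_scale (of_int (c' l)) (sf_e_part l) :: rat symfun)"
    unfolding f by (simp add: sf_of_int_sum sf_of_int_scale sf_of_int_e_part)
  then have rat: "is_expansion sf_e_part (\<lambda>l. of_int (c' l) :: rat) (sf_of_int f)"
    using S(1,2) by (simp only:) (intro is_expansion_sum, auto simp: c'_def)
  obtain d where d: "is_expansion sf_e_part d (sf_of_int f :: rat symfun)" "\<And>l. 0 \<le> d l"
    using assms(2) by (auto simp: e_positive_def)
  have "(\<lambda>l. of_int (c' l)) = d" by (rule is_expansion_e_unique[OF rat d(1)])
  then have "0 \<le> (of_int (c' l) :: rat)" for l using d(2) by metis
  then show ?thesis unfolding e_positive_def using int by auto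
qed

lemma e_span_one: "1 \<in> e_span 0"
  using e_part_in_e_span[of "{#}" 0] by (simp add: sf_e_part_def)

lemma e_span_e: "sf_e i \<in> e_span 0"
  using e_part_in_e_span[of "{#i#}" 0] e_span_one by (cases "i = 0") (simp_all add: sf_e_part_def)

lemma e_span_mult_0: "f \<in> e_span 0 \<Longrightarrow> g \<in> e_span 0 \<Longrightarrow> f * g \<in> e_span 0"
  using e_span_mult[of f 0 g 0] by simp

lemma e_span_diff: "f \<in> e_span k \<Longrightarrow> g \<in> e_span k \<Longrightarrow> f - g \<in> e_span k"
  using e_span_intros(2)[OF _ e_span_intros(4)] by fastforce

lemma e_span_h: "(sf_h n :: 'a :: comm_ring_1 symfun) \<in> e_span 0"
proof (cases "n = 0")
  case False
  then have "sf_h n - sf_scale ((-1) ^ Suc n) (sf_e n) \<in> (e_span 0 :: 'a symfun set)"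
    using sf_h_triangular[of n] e_span_mono[of 0 2] by auto
  from e_span_intros(2)[OF this e_span_intros(3)[OF e_span_e, of "(-1) ^ Suc n" n]]
  show ?thesis by simp
qed (simp add: e_span_one)

lemma e_span_newton: "newton c n \<in> e_span 0"
proof (induction n rule: less_induct)
  case (less n)
  then show ?case
    by (subst newton.simps) (auto intro!: e_span_diff e_span_intros(3,5) e_span_e e_span_mult_0)
qed

lemma e_span_prod: "(\<And>x. x \<in> A \<Longrightarrow> F x \<in> e_span 0) \<Longrightarrow> prod F A \<in> e_span 0"
  by (induction A rule: infinite_finite_induct) (simp_all add: e_span_one e_span_mult_0)

section \<open>Cycle lists and orbits\<close>

lemma set_support:
  assumes "\<sigma> permutes {1..n :: nat}" shows "set (support \<sigma> x) = orbit \<sigma> x"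
proof -
  have "permutation \<sigma>" using assms unfolding permutation_permutes by blast
  then show ?thesis by (simp only: support_set orbit_altdef_permutation full_SetCompr_eq) auto
qed

lemma length_support:
  assumes "\<sigma> permutes {1..n :: nat}" shows "length (support \<sigma> x) = card (orbit \<sigma> x)"
proof -
  have "permutation \<sigma>" using assms unfolding permutation_permutes by blast
  then show ?thesis
    using distinct_card[OF cycle_of_permutation, of \<sigma> x] set_support[OF assms, of x] by metis
qed

text \<open>
  Each cycle is listed once, at its minimum, and the cycle of \<open>1\<close> comes first.
\<close>

lemma cycle_list_eq:
  assumes \<sigma>: "\<sigma> permutes {1..n}" and "1 \<le> n"
  shows "length (hd (cycle_list n \<sigma>)) = card (orbit \<sigma> 1)"
    and "(\<Prod>\<tau>\<leftarrow>tl (cycle_list n \<sigma>). f (length \<tau>)) = cycle_weight f (orbit \<sigma> ` {1..n} - {orbit \<sigma> 1})"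
    and "\<tau> \<in> set (tl (cycle_list n \<sigma>)) \<Longrightarrow> \<tau> \<noteq> []"
proof -
  define M where "M = {a \<in> {1..n}. \<forall>b \<in> orbit \<sigma> a. a \<le> b}"
  have sub: "orbit \<sigma> a \<subseteq> {1..n}" if "a \<in> {1..n}" for a using permutes_orbit_subset[OF \<sigma> that] .
  have self: "a \<in> orbit \<sigma> a" for a by (rule permutes_self_in_orbit[OF \<sigma>])
  have M: "finite M" "1 \<in> M" "M \<subseteq> {1..n}" using sub[of 1] \<open>1 \<le> n\<close> by (auto simp: M_def)
  have "Min M = 1" using M by (intro Min_eqI) auto
  then have sorted: "sorted_list_of_set M = 1 # sorted_list_of_set (M - {1})"
    using M by (subst sorted_list_of_set_nonempty) auto
  have list: "cycle_list n \<sigma> = support \<sigma> 1 # map (support \<sigma>) (sorted_list_of_set (M - {1}))"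
    unfolding cycle_list_def set_support[OF \<sigma>] M_def[symmetric] sorted by simp
  show "length (hd (cycle_list n \<sigma>)) = card (orbit \<sigma> 1)"
    unfolding list using length_support[OF \<sigma>] by simp
  show "\<tau> \<noteq> []" if \<tau>: "\<tau> \<in> set (tl (cycle_list n \<sigma>))"
  proof -
    obtain x where "\<tau> = support \<sigma> x" using \<tau> unfolding list list.sel set_map by blast
    then show ?thesis using self[of x] set_support[OF \<sigma>, of x] by (metis empty_iff list.set(1))
  qed
  have same: "orbit \<sigma> a = orbit \<sigma> b \<longleftrightarrow> a = b" if "a \<in> M" "b \<in> M" for a b
  proof
    assume eq: "orbit \<sigma> a = orbit \<sigma> b"
    have "a \<le> b" using that(1) self[of b] eq by (auto simp: M_def)
    moreover have "b \<le> a" using that(2) self[of a] eq by (auto simp: M_def)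
    ultimately show "a = b" by simp
  qed simp
  have "bij_betw (orbit \<sigma>) (M - {1}) (orbit \<sigma> ` {1..n} - {orbit \<sigma> 1})"
  proof (rule bij_betw_imageI)
    show "inj_on (orbit \<sigma>) (M - {1})" using same by (auto simp: inj_on_def)
    show "orbit \<sigma> ` (M - {1}) = orbit \<sigma> ` {1..n} - {orbit \<sigma> 1}"
    proof (intro equalityI subsetI)
      fix C assume "C \<in> orbit \<sigma> ` (M - {1})"
      then show "C \<in> orbit \<sigma> ` {1..n} - {orbit \<sigma> 1}" using same M by auto
    next
      fix C assume C: "C \<in> orbit \<sigma> ` {1..n} - {orbit \<sigma> 1}"
      then obtain x where x: "x \<in> {1..n}" "C = orbit \<sigma> x" "C \<noteq> orbit \<sigma> 1" by blast
      have fin: "finite C" "C \<noteq> {}" using finite_subset[OF sub[OF x(1)]] self x(2) by auto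
      define a where "a = Min C"
      have a: "a \<in> C" "\<And>b. b \<in> C \<Longrightarrow> a \<le> b" using fin by (auto simp: a_def)
      then have "orbit \<sigma> a = C" using orbit_eq_iff_permutes[OF \<sigma>] x(2) by blast
      then show "C \<in> orbit \<sigma> ` (M - {1})"
        using a x sub[OF x(1)] by (intro image_eqI[of _ _ a]) (auto simp: M_def)
    qed
  qed
  then have "(\<Prod>a\<in>M - {1}. f (card (orbit \<sigma> a))) = cycle_weight f (orbit \<sigma> ` {1..n} - {orbit \<sigma> 1})"
    unfolding cycle_weight_def by (rule prod.reindex_bij_betw)
  moreover have "(\<Prod>\<tau>\<leftarrow>tl (cycle_list n \<sigma>). f (length \<tau>)) = (\<Prod>a\<in>M - {1}. f (card (orbit \<sigma> a)))"
    unfolding list using M(1) length_support[OF \<sigma>]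
    by (simp add: comp_def prod.distinct_set_conv_list[symmetric] del: length_map)
  ultimately show "(\<Prod>\<tau>\<leftarrow>tl (cycle_list n \<sigma>). f (length \<tau>)) = cycle_weight f (orbit \<sigma> ` {1..n} - {orbit \<sigma> 1})"
    by simp
qed

section \<open>The specialization at 1\<close>

lemma poly_q_int_1: "poly (q_int k) 1 = of_nat k"
  by (simp add: q_int_def poly_sum poly_monom)

text \<open>
  The factor \<open>q\<close> to the power of \<^const>\<open>hess_wt\<close> disappears at \<open>q = 1\<close>; the permutations are then collected by the length \<open>j\<close> of the
  cycle of \<open>1\<close>.
\<close>

lemma specialized_hess_g:
  assumes "1 \<le> n"
  shows "sf_specialize 1 (hess_g n m k) = (\<Sum>j=n - k..n. sf_scale ((-1) ^ (j - (n - k)))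
    (sf_h (j - (n - k)) * cyc_marked (newton of_nat) 1 n m j))"
proof -
  let ?h = "n - k"
  let ?W = "\<lambda>\<sigma>. cycle_weight (newton of_nat) (orbit \<sigma> ` {1..n} - {orbit \<sigma> 1}) :: int symfun"
  let ?F = "\<lambda>\<sigma> j. sf_scale ((-1) ^ (j - ?h)) (sf_h (j - ?h) * ?W \<sigma>)"
  have perms: "hess_perms n m = perms_on 1 n m" by (simp add: hess_perms_def perms_on_def)
  have summand: "sf_specialize 1 (let d = length (hd (cycle_list n \<sigma>)) - ?h in
        sf_scale ((-1) ^ d * monom 1 (hess_wt n m \<sigma>))
          (sf_h d * sf_omega (\<Prod>\<tau>\<leftarrow>tl (cycle_list n \<sigma>). sf_rho (length \<tau>)))) = ?F \<sigma> (card (orbit \<sigma> 1))"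
    if "\<sigma> \<in> perms_on 1 n m" for \<sigma>
  proof -
    have \<sigma>: "\<sigma> permutes {1..n}" using that by (simp add: perms_on_def)
    have "sf_omega (\<Prod>\<tau>\<leftarrow>tl (cycle_list n \<sigma>). sf_rho (length \<tau>)) =
        (\<Prod>\<tau>\<leftarrow>tl (cycle_list n \<sigma>). newton q_int (length \<tau>))"
      using cycle_list_eq(3)[OF \<sigma> assms] by (rule sf_omega_rho_prod)
    moreover have "sf_specialize 1 (\<Prod>\<tau>\<leftarrow>tl (cycle_list n \<sigma>). newton q_int (length \<tau>)) = ?W \<sigma>"
      using cycle_list_eq(2)[OF \<sigma> assms, of "newton of_nat"]
      by (simp add: sf_specialize_prod_list sf_specialize_newton poly_q_int_1 comp_def)
    ultimately show ?thesis
      by (simp add: Let_def cycle_list_eq(1)[OF \<sigma> assms] sf_specialize_scale sf_specialize_mult poly_monom)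
  qed
  have "sf_specialize 1 (hess_g n m k) = (\<Sum>\<sigma> | \<sigma> \<in> perms_on 1 n m \<and> ?h \<le> card (orbit \<sigma> 1). ?F \<sigma> (card (orbit \<sigma> 1)))"
    unfolding hess_g_def sf_specialize_sum perms
  proof (rule sum.cong)
    show "{\<sigma> \<in> perms_on 1 n m. ?h \<le> length (hd (cycle_list n \<sigma>))} =
        {\<sigma> \<in> perms_on 1 n m. ?h \<le> card (orbit \<sigma> 1)}"
      using cycle_list_eq(1)[OF _ assms] by (auto simp: perms_on_def)
  qed (use summand in blast)
  also have "\<dots> = (\<Sum>\<sigma>\<in>perms_on 1 n m. if ?h \<le> card (orbit \<sigma> 1) then ?F \<sigma> (card (orbit \<sigma> 1)) else 0)"
    by (simp add: sum.If_cases Int_def)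
  also have "\<dots> = (\<Sum>\<sigma>\<in>perms_on 1 n m. \<Sum>j=?h..n. if card (orbit \<sigma> 1) = j then ?F \<sigma> j else 0)"
  proof (rule sum.cong)
    fix \<sigma> assume "\<sigma> \<in> perms_on 1 n m"
    then have "orbit \<sigma> 1 \<subseteq> {1..n}" using assms by (intro permutes_orbit_subset) (auto simp: perms_on_def)
    from card_mono[OF _ this] have "card (orbit \<sigma> 1) \<le> n" by simp
    then show "(if ?h \<le> card (orbit \<sigma> 1) then ?F \<sigma> (card (orbit \<sigma> 1)) else 0) =
        (\<Sum>j=?h..n. if card (orbit \<sigma> 1) = j then ?F \<sigma> j else 0)" by simp
  qed simp
  also have "\<dots> = (\<Sum>j=?h..n. \<Sum>\<sigma>\<in>perms_on 1 n m. if card (orbit \<sigma> 1) = j then ?F \<sigma> j else 0)"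
    by (rule sum.swap)
  also have "\<dots> = (\<Sum>j=?h..n. sf_scale ((-1) ^ (j - ?h)) (sf_h (j - ?h) * cyc_marked (newton of_nat) 1 n m j))"
    unfolding cyc_marked_def marked_weight_def sum_distrib_left symfun.scale_sum_right
    by (intro sum.cong) auto
  finally show ?thesis .
qed

lemma cycle_weight_of_int: "sf_of_int (cycle_weight (newton of_nat) \<C>) = cycle_weight (newton of_nat) \<C>"
  by (simp add: cycle_weight_def sf_of_int_prod sf_of_int_newton)

lemma cyc_marked_of_int: "sf_of_int (cyc_marked (newton of_nat) a n m k) = cyc_marked (newton of_nat) a n m k"
  unfolding cyc_marked_def marked_weight_def sf_of_int_sum by (intro sum.cong) (auto simp: cycle_weight_of_int)

lemma e_span_cyc_marked: "cyc_marked (newton c) a n m k \<in> e_span 0"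
  unfolding cyc_marked_def marked_weight_def cycle_weight_def
  by (intro e_span_intros(5)) (auto intro: e_span_prod e_span_newton e_span_intros(1))

theorem corollary1p9:
  fixes n k :: nat and m :: "nat \<Rightarrow> nat"
  assumes "1 \<le> n" and "hessenberg n m" and "k < n"
  shows "e_positive (sf_specialize 1 (hess_g n m k))"
proof (rule e_positive_of_int)
  let ?g = "sf_specialize 1 (hess_g n m k)"
  have hm: "hess_on 1 n m"
    using assms(2) by (auto simp: hessenberg_def hess_on_def mono_on_def Pi_iff)
  show "?g \<in> e_span 0"
    unfolding specialized_hess_g[OF assms(1)]
    by (intro e_span_intros(3,5) e_span_mult_0 e_span_h e_span_cyc_marked)
  have "sf_of_int ?g = (\<Sum>j=n - k..n. sf_scale ((-1) ^ (j - (n - k)))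
      (sf_h (j - (n - k)) * cyc_marked omega_power 1 n m j))"
    unfolding specialized_hess_g[OF assms(1)]
    by (simp add: sf_of_int_sum sf_of_int_scale sf_of_int_mult cyc_marked_of_int)
  also have "\<dots> = (\<Sum>j=n - k..n. sf_scale ((-1) ^ (j - (n - k))) (sf_h (j - (n - k)) * tab_cycle 1 n m j))"
  proof (rule sum.cong)
    fix j assume "j \<in> {n - k..n}"
    then have "0 < j" using assms(3) by (simp, linarith)
    then show "sf_scale ((-1) ^ (j - (n - k))) (sf_h (j - (n - k)) * cyc_marked omega_power 1 n m j) =
        sf_scale ((-1) ^ (j - (n - k))) (sf_h (j - (n - k)) * tab_cycle 1 n m j)"
      using cyc_marked_eq_tab_cycle[OF hm _ assms(1)] by simp
  qed simp
  also have "\<dots> = tab_marked 1 n m (n - k)"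
    by (simp add: tab_cycle_inversion)
  finally show "e_positive (sf_of_int ?g :: rat symfun)"
    using e_cone_positive[OF e_cone_tab_marked] by simp
qed

end
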